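(* Let $p$ be a prime and let $G$ be a finitely generated uniform pro-$p$ group. Then $G$ is locally powerful if, and only if, there exists an orientation $\theta\colon G\to\mathbb{Z}_p^\times$ such that $(G,\theta)$ is $\theta$-abelian.
   Context: All subgroups are closed and generators are topological generators. A pro-$p$ group $G$ is powerful if $[G,G]\subseteq G^p$ for $p$ odd, and $[G,G]\subseteq G^4$ for $p=2$, where $[G,G]$ (resp. $G^m$) is the closed subgroup generated by all commutators (resp. all $m$-th powers). Set $\lambda_1(G)=G$ and $\lambda_{i+1}(G)=\lambda_i(G)^p[\lambda_i(G),G]$ (closed subgroups); $\Phi(G)=\lambda_2(G)$ is the Frattini subgroup. A pro-$p$ group $G$ is uniform (uniformly powerful) if it is finitely generated, powerful, and $|\lambda_i(G):\lambda_{i+1}(G)|=|G:\Phi(G)|$ for all $i\ge 1$; equivalently, if it is finitely generated, powerful and torsion-free. A pro-$p$ group $G$ is locally powerful if every finitely generated closed subgroup of $G$ is powerful. An orientation of a pro-$p$ group $G$ is a continuous group homomorphism $\theta\colon G\to\mathbb{Z}_p^\times$, and $(G,\theta)$ is then called an oriented pro-$p$ group. Its $\theta$-center is $Z_\theta(G)=\{h\in\ker(\theta) : ghg^{-1}=h^{\theta(g)}\text{ for all }g\in G\}$ (with $h^{a}$, $a\in\mathbb{Z}_p$, the $p$-adic power). $(G,\theta)$ is $\theta$-abelian if $Z_\theta(G)=\ker(\theta)$. *)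

theory Defs
  imports
    "HOL-Analysis.Analysis"
    "HOL-Algebra.Generated_Groups"
    "HOL-Algebra.Ring"
    "HOL-Computational_Algebra.Primes"
begin

section \<open>Topological groups and pro-\<open>p\<close> groups\<close>

locale topological_group = group G for G :: "('a, 'b) monoid_scheme" (structure) +
  fixes T :: "'a topology"
  assumes topspace_eq: "topspace T = carrier G"
    and continuous_mult: "continuous_map (prod_topology T T) T (\<lambda>(x, y). x \<otimes> y)"
    and continuous_inv: "continuous_map T T (\<lambda>x. inv x)"

text \<open>A profinite group is a compact Hausdorff group in which the open subgroups form a base of
  neighbourhoods of the identity; it is pro-\<open>p\<close> if every open normal subgroup has index a power
  of \<open>p\<close>. As \<^const>\<open>card\<close> is \<open>0\<close> on infinite sets, the last assumption
  includes finiteness of the index.\<close>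

locale pro_p_group = topological_group G T
  for p :: nat and G :: "('a, 'b) monoid_scheme" (structure) and T :: "'a topology" +
  assumes compact: "compact_space T"
    and Hausdorff: "Hausdorff_space T"
    and open_subgroup_base:
      "\<And>U. openin T U \<Longrightarrow> \<one> \<in> U \<Longrightarrow> \<exists>H. subgroup H G \<and> openin T H \<and> H \<subseteq> U"
    and open_normal_index:
      "\<And>N. N \<lhd> G \<Longrightarrow> openin T N \<Longrightarrow> \<exists>k. card (rcosets N) = p ^ k"

text \<open>A closed subgroup \<open>H\<close> of \<open>(G, T)\<close> is itself regarded as the topological group
  \<open>(G\<lparr>carrier := H\<rparr>, subtopology T H)\<close>.\<close>

definition closed_generate :: "('a, 'b) monoid_scheme \<Rightarrow> 'a topology \<Rightarrow> 'a set \<Rightarrow> 'a set" where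
  "closed_generate G T S = T closure_of (generate G S)"

definition topologically_fg :: "('a, 'b) monoid_scheme \<Rightarrow> 'a topology \<Rightarrow> bool" where
  "topologically_fg G T \<longleftrightarrow>
     (\<exists>S. finite S \<and> S \<subseteq> carrier G \<and> closed_generate G T S = carrier G)"

definition closed_commutator ::
    "('a, 'b) monoid_scheme \<Rightarrow> 'a topology \<Rightarrow> 'a set \<Rightarrow> 'a set \<Rightarrow> 'a set" where
  "closed_commutator G T H K = closed_generate G T
     {h \<otimes>\<^bsub>G\<^esub> k \<otimes>\<^bsub>G\<^esub> inv\<^bsub>G\<^esub> h \<otimes>\<^bsub>G\<^esub> inv\<^bsub>G\<^esub> k | h k. h \<in> H \<and> k \<in> K}"

definition closed_power ::
    "('a, 'b) monoid_scheme \<Rightarrow> 'a topology \<Rightarrow> 'a set \<Rightarrow> nat \<Rightarrow> 'a set" where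
  "closed_power G T H m = closed_generate G T {h [^]\<^bsub>G\<^esub> m | h. h \<in> H}"

definition powerful :: "nat \<Rightarrow> ('a, 'b) monoid_scheme \<Rightarrow> 'a topology \<Rightarrow> bool" where
  "powerful p G T \<longleftrightarrow>
     closed_commutator G T (carrier G) (carrier G)
       \<subseteq> closed_power G T (carrier G) (if p = 2 then 4 else p)"

text \<open>The lower \<open>p\<close>-series, indexed from \<open>0\<close>: the term \<open>\<lambda>\<^sub>i(G)\<close> of the usual
  numbering is \<open>lower_p_series p G T (i - 1)\<close>.\<close>

primrec lower_p_series ::
    "nat \<Rightarrow> ('a, 'b) monoid_scheme \<Rightarrow> 'a topology \<Rightarrow> nat \<Rightarrow> 'a set" where
  "lower_p_series p G T 0 = carrier G"
| "lower_p_series p G T (Suc i) =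
     closed_power G T (lower_p_series p G T i) p
       <#>\<^bsub>G\<^esub> closed_commutator G T (lower_p_series p G T i) (carrier G)"

definition frattini :: "nat \<Rightarrow> ('a, 'b) monoid_scheme \<Rightarrow> 'a topology \<Rightarrow> 'a set" where
  "frattini p G T = lower_p_series p G T 1"

definition uniform :: "nat \<Rightarrow> ('a, 'b) monoid_scheme \<Rightarrow> 'a topology \<Rightarrow> bool" where
  "uniform p G T \<longleftrightarrow>
     topologically_fg G T \<and> powerful p G T \<and>
     (\<forall>i. card (rcosets\<^bsub>G\<lparr>carrier := lower_p_series p G T i\<rparr>\<^esub> (lower_p_series p G T (Suc i)))
          = card (rcosets\<^bsub>G\<^esub> (frattini p G T)))"

definition locally_powerful :: "nat \<Rightarrow> ('a, 'b) monoid_scheme \<Rightarrow> 'a topology \<Rightarrow> bool" where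
  "locally_powerful p G T \<longleftrightarrow>
     (\<forall>H. subgroup H G \<and> closedin T H
            \<and> topologically_fg (G\<lparr>carrier := H\<rparr>) (subtopology T H)
          \<longrightarrow> powerful p (G\<lparr>carrier := H\<rparr>) (subtopology T H))"


section \<open>The \<open>p\<close>-adic integers\<close>

text \<open>\<open>\<int>\<^sub>p\<close> is the inverse limit of the rings \<open>\<int>/p\<^sup>n\<int>\<close>. An element is a coherent sequence of
  residues, the \<open>n\<close>-th one being represented in \<open>{0..<p\<^sup>n}\<close>; the topology is induced from the
  product of the discrete topologies.\<close>

definition padic_int :: "nat \<Rightarrow> (nat \<Rightarrow> int) ring" where
  "padic_int p =
     \<lparr>carrier = {a. \<forall>n. a n \<in> {0..<int p ^ n} \<and> a (Suc n) mod int p ^ n = a n},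
      monoid.mult = (\<lambda>a b n. (a n * b n) mod int p ^ n),
      monoid.one = (\<lambda>n. 1 mod int p ^ n),
      ring.zero = (\<lambda>n. 0),
      ring.add = (\<lambda>a b n. (a n + b n) mod int p ^ n)\<rparr>"

definition padic_topology :: "nat \<Rightarrow> (nat \<Rightarrow> int) topology" where
  "padic_topology p =
     subtopology (product_topology (\<lambda>_. discrete_topology UNIV) UNIV) (carrier (padic_int p))"

definition padic_units :: "nat \<Rightarrow> (nat \<Rightarrow> int) monoid" where
  "padic_units p = units_of (padic_int p)"

definition padic_units_topology :: "nat \<Rightarrow> (nat \<Rightarrow> int) topology" where
  "padic_units_topology p = subtopology (padic_topology p) (carrier (padic_units p))"

text \<open>For \<open>a \<in> \<int>\<^sub>p\<close> the integers \<open>a n\<close> converge to \<open>a\<close>, so \<open>h\<^sup>a\<close> is the limit of the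
  integer powers \<open>h\<^bsup>a n\<^esup>\<close>; in a pro-\<open>p\<close> group this limit exists and is unique.\<close>

definition padic_pow ::
    "('a, 'b) monoid_scheme \<Rightarrow> 'a topology \<Rightarrow> 'a \<Rightarrow> (nat \<Rightarrow> int) \<Rightarrow> 'a" where
  "padic_pow G T h a = (THE y. limitin T (\<lambda>n. h [^]\<^bsub>G\<^esub> a n) y sequentially)"


section \<open>Oriented pro-\<open>p\<close> groups\<close>

definition orientation ::
    "nat \<Rightarrow> ('a, 'b) monoid_scheme \<Rightarrow> 'a topology \<Rightarrow> ('a \<Rightarrow> nat \<Rightarrow> int) \<Rightarrow> bool" where
  "orientation p G T \<theta> \<longleftrightarrow>
     \<theta> \<in> hom G (padic_units p) \<and> continuous_map T (padic_units_topology p) \<theta>"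

definition theta_center ::
    "nat \<Rightarrow> ('a, 'b) monoid_scheme \<Rightarrow> 'a topology \<Rightarrow> ('a \<Rightarrow> nat \<Rightarrow> int) \<Rightarrow> 'a set" where
  "theta_center p G T \<theta> =
     {h \<in> kernel G (padic_units p) \<theta>.
        \<forall>g\<in>carrier G. g \<otimes>\<^bsub>G\<^esub> h \<otimes>\<^bsub>G\<^esub> inv\<^bsub>G\<^esub> g = padic_pow G T h (\<theta> g)}"

definition theta_abelian ::
    "nat \<Rightarrow> ('a, 'b) monoid_scheme \<Rightarrow> 'a topology \<Rightarrow> ('a \<Rightarrow> nat \<Rightarrow> int) \<Rightarrow> bool" where
  "theta_abelian p G T \<theta> \<longleftrightarrow> theta_center p G T \<theta> = kernel G (padic_units p) \<theta>"

end

theory Submission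
  imports
    Defs
    "HOL-Algebra.Group_Action"
    "HOL-Algebra.Multiplicative_Group"
    "HOL-Number_Theory.Cong"
begin

text \<open>
  Suppose \<open>G\<close> is locally powerful; it is torsion-free, being uniform. Put \<open>q = p\<close>, or \<open>q = 4\<close> if
  \<open>p = 2\<close>. In the finite quotients of \<open>H = \<langle>x,y\<rangle>\<close> powerfulness forces the derived subgroup to be
  generated by the commutator \<open>c = [x,y]\<close>. Hence \<open>c\<close> is an eigenvector for conjugation by elements of \<open>H\<close>,
  and it has the form \<open>(x\<^sup>a y\<^sup>b c\<^sup>e)\<^sup>q c\<^bsup>pl\<^esup>\<close>. Together with torsion-freeness the latter excludes
  Heisenberg groups inside \<open>G\<close>. So if \<open>G\<close> is not abelian, there are \<open>h, k\<close> with \<open>h k h\<inverse> = k\<^sup>m \<noteq> k\<close>; the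
  eigenspace \<open>{a. h a h\<inverse> = a\<^sup>m}\<close> is an abelian normal subgroup containing all \<open>[h,g]\<close>, every element of
  \<open>G\<close> acts on it by a scalar, and this scalar is the orientation.

  Conversely, let \<open>G\<close> be \<open>\<theta>\<close>-abelian. Uniformity makes the \<open>p\<close>-th power map injective between
  successive factors of the lower \<open>p\<close>-series, which forces \<open>\<theta> \<equiv> 1\<close> modulo \<open>q\<close> unless the kernel of
  \<open>\<theta>\<close> is trivial. The closed subgroups of \<open>1 + q\<int>\<^sub>p\<close> form a chain, so for \<open>x, y\<close> in a closed subgroup
  \<open>H\<close> one may, up to exchanging them, write \<open>y = x\<^sup>a w\<close> with \<open>w \<in> H\<close> in the kernel of \<open>\<theta>\<close>, and
  \<open>[x,y]\<close> is conjugate to \<open>[x,w] = w\<^bsup>\<theta>(x)-1\<^esup>\<close>, a \<open>q\<close>-th power in \<open>H\<close>.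
\<close>

section \<open>Commutators and finite powerful \<open>p\<close>-groups\<close>

text \<open>Local powerfulness speaks about one pair at a time: the elements of the closed subgroup
  generated by \<open>x, y\<close> scale the single element \<open>[x,y]\<close>, by a factor that
  may depend on the pair. Comparing pairs is the obstacle. Torsion-freeness, combined with this
  scaling, gives the tools: \<open>x^a = 1\<close> forces \<open>x = 1\<close> or
  \<open>a = 0\<close>, a nonzero p-adic power has the same centralizer as its root, and it
  determines its root. So a scalar action on a nontrivial power descends to the root, and a common
  nontrivial power of two eigenvectors identifies their scalars. Heisenberg groups are impossible
  because there the root formula for \<open>c = [x,y]\<close> loses its \<open>y\<close>-part, while
  the exponents of \<open>c\<close> on its right-hand side are divisible by \<open>p\<close>; so
  \<open>c\<close> becomes a power of \<open>x\<close>, and as it commutes with \<open>y\<close> it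
  must be trivial. The value \<open>q = 4\<close> at \<open>p = 2\<close> makes \<open>p\<close>
  divide \<open>q(q-1)/2\<close> in the class-two power formula, makes
  \<open>1 + u + ... + u^(p-1)\<close> equal to \<open>p\<close> times a unit for \<open>u\<close>
  in \<open>1 + q\<int>_p\<close>, and makes \<open>1 + q\<int>_p\<close> procyclic, which
  \<open>1 + 2\<int>_2\<close> is not, since it contains \<open>-1\<close>.\<close>

definition group_commutator :: "('a, 'b) monoid_scheme \<Rightarrow> 'a \<Rightarrow> 'a \<Rightarrow> 'a"  ("\<lbrakk>_,_\<rbrakk>\<index>")
  where "\<lbrakk>x,y\<rbrakk>\<^bsub>G\<^esub> = x \<otimes>\<^bsub>G\<^esub> y \<otimes>\<^bsub>G\<^esub> inv\<^bsub>G\<^esub> x \<otimes>\<^bsub>G\<^esub> inv\<^bsub>G\<^esub> y"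

context group
begin

lemma inv_cancel_left [simp]:
  assumes "x \<in> carrier G" "y \<in> carrier G"
  shows "inv x \<otimes> (x \<otimes> y) = y" "x \<otimes> (inv x \<otimes> y) = y"
  using assms by (simp_all add: m_assoc[symmetric])

lemmas word_simps = m_assoc inv_mult_group

lemma commutator_closed [simp, intro]:
  "x \<in> carrier G \<Longrightarrow> y \<in> carrier G \<Longrightarrow> \<lbrakk>x,y\<rbrakk> \<in> carrier G"
  by (simp add: group_commutator_def)

lemma commutator_mult_left:
  assumes "x \<in> carrier G" "x' \<in> carrier G" "y \<in> carrier G"
  shows "\<lbrakk>x \<otimes> x', y\<rbrakk> = x \<otimes> \<lbrakk>x', y\<rbrakk> \<otimes> inv x \<otimes> \<lbrakk>x, y\<rbrakk>"
  using assms by (simp add: group_commutator_def word_simps)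

lemma commutator_mult_right:
  assumes "x \<in> carrier G" "y' \<in> carrier G" "y \<in> carrier G"
  shows "\<lbrakk>x, y \<otimes> y'\<rbrakk> = \<lbrakk>x, y\<rbrakk> \<otimes> (y \<otimes> \<lbrakk>x, y'\<rbrakk> \<otimes> inv y)"
  using assms by (simp add: group_commutator_def word_simps)

lemma inv_commutator:
  assumes "x \<in> carrier G" "y \<in> carrier G"
  shows "inv \<lbrakk>x,y\<rbrakk> = \<lbrakk>y,x\<rbrakk>"
  using assms by (simp add: group_commutator_def word_simps)

lemma commutator_inv_left:
  assumes "x \<in> carrier G" "y \<in> carrier G"
  shows "\<lbrakk>inv x,y\<rbrakk> = inv x \<otimes> inv \<lbrakk>x,y\<rbrakk> \<otimes> x"
  using assms by (simp add: group_commutator_def word_simps)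

lemma conj_eq_commutator_mult:
  assumes "x \<in> carrier G" "y \<in> carrier G"
  shows "x \<otimes> y \<otimes> inv x = \<lbrakk>x,y\<rbrakk> \<otimes> y"
  using assms by (simp add: group_commutator_def word_simps)

lemma mult_eq_commutator_mult:
  assumes "x \<in> carrier G" "y \<in> carrier G"
  shows "x \<otimes> y = \<lbrakk>x,y\<rbrakk> \<otimes> y \<otimes> x"
  using assms by (simp add: group_commutator_def word_simps)

lemma commutator_eq_one_iff:
  assumes "x \<in> carrier G" "y \<in> carrier G"
  shows "\<lbrakk>x,y\<rbrakk> = \<one> \<longleftrightarrow> x \<otimes> y = y \<otimes> x"
  using assms mult_eq_commutator_mult[OF assms]
  by (metis commutator_closed m_closed l_one m_assoc r_cancel_one')

lemma conj_closed [simp, intro]: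
  "g \<in> carrier G \<Longrightarrow> x \<in> carrier G \<Longrightarrow> g \<otimes> x \<otimes> inv g \<in> carrier G"
  by simp

lemma conj_mult:
  assumes "g \<in> carrier G" "x \<in> carrier G" "y \<in> carrier G"
  shows "g \<otimes> (x \<otimes> y) \<otimes> inv g = (g \<otimes> x \<otimes> inv g) \<otimes> (g \<otimes> y \<otimes> inv g)"
  using assms by (simp add: word_simps)

lemma conj_inv:
  assumes "g \<in> carrier G" "x \<in> carrier G"
  shows "g \<otimes> inv x \<otimes> inv g = inv (g \<otimes> x \<otimes> inv g)"
  using assms by (simp add: word_simps)

lemma conj_nat_pow:
  assumes "g \<in> carrier G" "x \<in> carrier G"
  shows "g \<otimes> x [^] (n::nat) \<otimes> inv g = (g \<otimes> x \<otimes> inv g) [^] n"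
proof (induction n)
  case (Suc n)
  have "g \<otimes> x [^] Suc n \<otimes> inv g = (g \<otimes> x [^] n \<otimes> inv g) \<otimes> (g \<otimes> x \<otimes> inv g)"
    using assms by (simp add: word_simps)
  then show ?case using Suc by simp
qed (use assms in simp)

lemma conj_int_pow:
  assumes "g \<in> carrier G" "x \<in> carrier G"
  shows "g \<otimes> x [^] (n::int) \<otimes> inv g = (g \<otimes> x \<otimes> inv g) [^] n"
proof -
  have "(\<lambda>y. g \<otimes> y \<otimes> inv g) \<in> hom G G"
    using assms by (auto simp: hom_def conj_mult)
  then show ?thesis
    using hom_int_pow[of "\<lambda>y. g \<otimes> y \<otimes> inv g" G G x n] assms is_group by simp
qed

lemma conj_conj:
  assumes "g \<in> carrier G" "h \<in> carrier G" "x \<in> carrier G"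
  shows "g \<otimes> (h \<otimes> x \<otimes> inv h) \<otimes> inv g = (g \<otimes> h) \<otimes> x \<otimes> inv (g \<otimes> h)"
  using assms by (simp add: word_simps)

lemma conj_eq_iff_commute:
  assumes "g \<in> carrier G" "x \<in> carrier G"
  shows "g \<otimes> x \<otimes> inv g = x \<longleftrightarrow> g \<otimes> x = x \<otimes> g"
  using assms by (metis inv_closed inv_solve_right' m_closed inv_solve_right)

lemma commute_int_pow:
  assumes "g \<in> carrier G" "x \<in> carrier G" "g \<otimes> x = x \<otimes> g"
  shows "g \<otimes> x [^] (n::int) = x [^] n \<otimes> g"
  using conj_int_pow[OF assms(1,2), of n] assms conj_eq_iff_commute[OF assms(1,2)]
    conj_eq_iff_commute[OF assms(1) int_pow_closed[OF assms(2)]] by simp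

lemma conj_pow_of_conj_pow:
  assumes "g \<in> carrier G" "c \<in> carrier G" "g \<otimes> c \<otimes> inv g = c [^] (l::int)"
  shows "g \<otimes> c [^] (k::int) \<otimes> inv g = c [^] (l * k)"
  using assms by (simp add: conj_int_pow int_pow_pow)

text \<open>In a group of class two, \<open>(xy)\<^sup>n = x\<^sup>n y\<^sup>n [y,x]\<^bsup>n(n-1)/2\<^esup>\<close>.\<close>

lemma pow_mult_class_two:
  assumes "x \<in> carrier G" "y \<in> carrier G"
    and cen: "\<And>g. g \<in> carrier G \<Longrightarrow> g \<otimes> \<lbrakk>y,x\<rbrakk> = \<lbrakk>y,x\<rbrakk> \<otimes> g"
  shows "(x \<otimes> y) [^] (n::nat) = x [^] n \<otimes> y [^] n \<otimes> \<lbrakk>y,x\<rbrakk> [^] (\<Sum>i<n. i)"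
proof -
  let ?e = "\<lbrakk>y,x\<rbrakk>"
  have cen': "g \<otimes> ?e [^] (k::nat) = ?e [^] k \<otimes> g" if "g \<in> carrier G" for g k
    using that assms cen by (metis commutator_closed nat_pow_closed group_commutes_pow)
  have mv: "y [^] (n::nat) \<otimes> x = x \<otimes> y [^] n \<otimes> ?e [^] n" for n
  proof (induction n)
    case (Suc n)
    have "y [^] (Suc n) \<otimes> x = y [^] n \<otimes> (y \<otimes> x)" using assms(1,2) by (simp add: word_simps)
    also have "y \<otimes> x = ?e \<otimes> (x \<otimes> y)"
      using mult_eq_commutator_mult[OF assms(2,1)] assms(1,2) by (simp add: m_assoc)
    also have "\<dots> = x \<otimes> y \<otimes> ?e" by (rule cen[symmetric]) (use assms in simp)
    also have "y [^] n \<otimes> (x \<otimes> y \<otimes> ?e) = (y [^] n \<otimes> x) \<otimes> y \<otimes> ?e" using assms(1,2) by (simp add: word_simps)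
    also have "\<dots> = x \<otimes> y [^] n \<otimes> (?e [^] n \<otimes> y) \<otimes> ?e" using assms(1,2) Suc by (simp add: word_simps)
    also have "\<dots> = x \<otimes> y [^] n \<otimes> (y \<otimes> ?e [^] n) \<otimes> ?e" using assms(1,2) cen' by simp
    also have "\<dots> = x \<otimes> y [^] Suc n \<otimes> ?e [^] Suc n" using assms(1,2) by (simp add: word_simps)
    finally show ?case .
  qed (use assms in simp)
  show ?thesis
  proof (induction n)
    case (Suc n)
    let ?s = "\<Sum>i<n. i"
    have "(x \<otimes> y) [^] Suc n = x [^] n \<otimes> y [^] n \<otimes> (?e [^] ?s \<otimes> (x \<otimes> y))"
      using Suc assms by (simp add: word_simps)
    also have "\<dots> = x [^] n \<otimes> y [^] n \<otimes> ((x \<otimes> y) \<otimes> ?e [^] ?s)"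
      using cen'[of "x \<otimes> y"] assms by simp
    also have "\<dots> = x [^] n \<otimes> (y [^] n \<otimes> x) \<otimes> y \<otimes> ?e [^] ?s"
      using assms(1,2) by (simp add: word_simps)
    also have "\<dots> = x [^] n \<otimes> x \<otimes> y [^] n \<otimes> (?e [^] n \<otimes> y) \<otimes> ?e [^] ?s"
      using assms(1,2) by (simp add: mv word_simps)
    also have "\<dots> = x [^] n \<otimes> x \<otimes> y [^] n \<otimes> (y \<otimes> ?e [^] n) \<otimes> ?e [^] ?s"
      using assms(1,2) cen' by simp
    also have "\<dots> = x [^] Suc n \<otimes> y [^] Suc n \<otimes> (?e [^] n \<otimes> ?e [^] ?s)"
      using assms(1,2) by (simp add: word_simps)
    also have "\<dots> = x [^] Suc n \<otimes> y [^] Suc n \<otimes> ?e [^] (\<Sum>i<Suc n. i)"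
      using assms by (simp add: nat_pow_mult add.commute)
    finally show ?case .
  qed (use assms in simp)
qed

end

context normal
begin

lemma coset_eq_iff:
  assumes "x \<in> carrier G" "y \<in> carrier G"
  shows "H #> x = H #> y \<longleftrightarrow> (\<exists>z\<in>H. x = y \<otimes> z)"
proof
  assume "H #> x = H #> y"
  then have "x \<in> y <# H"
    using assms coset_eq rcos_self by (metis subgroup_axioms is_subgroup)
  then show "\<exists>z\<in>H. x = y \<otimes> z" by (auto simp: l_coset_def)
next
  assume "\<exists>z\<in>H. x = y \<otimes> z"
  then have "x \<in> H #> y" using assms coset_eq by (auto simp: l_coset_def)
  then show "H #> x = H #> y" using repr_independence assms(2) is_subgroup by metis
qed

lemma coset_mult: "x \<in> carrier G \<Longrightarrow> y \<in> carrier G \<Longrightarrow>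
   (H #> x) \<otimes>\<^bsub>G Mod H\<^esub> (H #> y) = H #> (x \<otimes> y)"
  by (simp add: rcos_sum)

lemma coset_inv: "x \<in> carrier G \<Longrightarrow> inv\<^bsub>G Mod H\<^esub> (H #> x) = H #> inv x"
  using inv_FactGroup[of "H #> x"] rcos_inv[of x]
  by (simp add: carrier_FactGroup)

lemma coset_in_Mod: "x \<in> carrier G \<Longrightarrow> H #> x \<in> carrier (G Mod H)"
  by (simp add: carrier_FactGroup)

lemma coset_nat_pow: "x \<in> carrier G \<Longrightarrow> (H #> x) [^]\<^bsub>G Mod H\<^esub> (n::nat) = H #> (x [^] n)"
  by (rule FactGroup_pow)

lemma coset_int_pow: "x \<in> carrier G \<Longrightarrow> (H #> x) [^]\<^bsub>G Mod H\<^esub> (n::int) = H #> (x [^] n)"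
  by (rule FactGroup_int_pow)

lemma coset_commutator:
  assumes "x \<in> carrier G" "y \<in> carrier G"
  shows "\<lbrakk>H #> x, H #> y\<rbrakk>\<^bsub>G Mod H\<^esub> = H #> \<lbrakk>x,y\<rbrakk>"
  using assms by (simp add: group_commutator_def coset_inv coset_mult del: mult_FactGroup)

text \<open>The class-two formula holds in \<open>G Mod H\<close>; lifting it to \<open>G\<close>
  costs one factor \<open>z\<close> in \<open>H\<close>. In this form later computations can stay
  inside \<open>G\<close>.\<close>

lemma pow_mult_class_two_mod:
  assumes xy: "x \<in> carrier G" "y \<in> carrier G"
    and cen: "\<And>g. g \<in> carrier G \<Longrightarrow> \<lbrakk>g, \<lbrakk>y,x\<rbrakk>\<rbrakk> \<in> H"
  shows "\<exists>z\<in>H. (x \<otimes> y) [^] (n::nat) = x [^] n \<otimes> y [^] n \<otimes> \<lbrakk>y,x\<rbrakk> [^] (\<Sum>i<n. i) \<otimes> z"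
proof -
  interpret Q: group "G Mod H" by (rule factorgroup_is_group)
  have "((H #> x) \<otimes>\<^bsub>G Mod H\<^esub> (H #> y)) [^]\<^bsub>G Mod H\<^esub> n = (H #> x) [^]\<^bsub>G Mod H\<^esub> n
     \<otimes>\<^bsub>G Mod H\<^esub> (H #> y) [^]\<^bsub>G Mod H\<^esub> n \<otimes>\<^bsub>G Mod H\<^esub> \<lbrakk>H #> y, H #> x\<rbrakk>\<^bsub>G Mod H\<^esub> [^]\<^bsub>G Mod H\<^esub> (\<Sum>i<n. i)"
  proof (rule Q.pow_mult_class_two)
    fix g assume "g \<in> carrier (G Mod H)"
    then obtain g' where g': "g' \<in> carrier G" "g = H #> g'" by (auto simp: carrier_FactGroup)
    have "\<lbrakk>g, \<lbrakk>H #> y, H #> x\<rbrakk>\<^bsub>G Mod H\<^esub>\<rbrakk>\<^bsub>G Mod H\<^esub> = \<one>\<^bsub>G Mod H\<^esub>"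
      using cen[OF g'(1)] g' xy by (simp add: coset_commutator coset_join2 is_subgroup)
    then show "g \<otimes>\<^bsub>G Mod H\<^esub> \<lbrakk>H #> y, H #> x\<rbrakk>\<^bsub>G Mod H\<^esub> = \<lbrakk>H #> y, H #> x\<rbrakk>\<^bsub>G Mod H\<^esub> \<otimes>\<^bsub>G Mod H\<^esub> g"
      using Q.commutator_eq_one_iff g' xy coset_in_Mod Q.commutator_closed by metis
  qed (use xy coset_in_Mod in auto)
  then have "H #> (x \<otimes> y) [^] n = H #> (x [^] n \<otimes> y [^] n \<otimes> \<lbrakk>y,x\<rbrakk> [^] (\<Sum>i<n. i))"
    using xy by (simp add: coset_commutator coset_nat_pow coset_mult del: mult_FactGroup)
  then show ?thesis using xy by (subst (asm) coset_eq_iff) auto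
qed

end

section \<open>Finite p-groups: centre and descent through central sections of exponent p\<close>

lemma (in group) p_group_center_nontrivial:
  assumes "prime p" "order G = p ^ k" "k > 0"
  shows "\<exists>z\<in>carrier G. z \<noteq> \<one> \<and> (\<forall>g\<in>carrier G. g \<otimes> z = z \<otimes> g)"
proof (rule ccontr)
  assume none: "\<not> ?thesis"
  define \<phi> where "\<phi> = (\<lambda>g. (\<lambda>h \<in> carrier G. g \<otimes> h \<otimes> (inv g)))"
  interpret A: group_action G "carrier G" \<phi> unfolding \<phi>_def by (rule action_by_conjugation)
  let ?O = "orbits G (carrier G) \<phi>"
  have fin: "finite (carrier G)" using assms by (simp add: order_gt_0_iff_finite[symmetric] prime_gt_0_nat)
  have "orbit G \<phi> \<one> = {\<one>}"
    unfolding orbit_def \<phi>_def by (auto intro!: exI[of _ "\<one>"])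
  then have one: "{\<one>} \<in> ?O"
    unfolding orbits_def using one_closed by blast
  \<comment> \<open>If the centre is trivial, \<open>{\<one>}\<close> is the only one-element
    conjugacy class. All other class sizes are then positive powers of \<open>p\<close>, and the
    class equation reads 0 = 1 modulo \<open>p\<close>.\<close>
  have dv: "p dvd card X" if X: "X \<in> ?O - {{\<one>}}" for X
  proof -
    obtain x where x: "x \<in> carrier G" "X = orbit G \<phi> x" using X by (auto simp: orbits_def)
    have xX: "x \<in> X" using x A.orbit_refl by simp
    have "card X dvd p ^ k"
      using A.orbit_stabilizer_theorem[OF x(1)] x(2) assms(2) by (metis dvd_triv_left)
    then obtain j where j: "card X = p ^ j" using divides_primepow_nat assms(1) by blast
    moreover have "j \<noteq> 0"
    proof
      assume "j = 0"
      then have "X = {x}" using j xX by (metis card_1_singletonE power_0 singletonD)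
      then have "g \<otimes> x = x \<otimes> g" if "g \<in> carrier G" for g
        using that x(1) conj_eq_iff_commute[OF that x(1)] unfolding x(2) orbit_def \<phi>_def by auto
      then have "x = \<one>" using none x(1) by blast
      then show False using X \<open>X = {x}\<close> by simp
    qed
    ultimately show ?thesis by simp
  qed
  have finO: "finite ?O" using fin A.orbits_coverture by (metis finite_UnionD)
  have "card (carrier G) = (\<Sum>X\<in>?O. \<Sum>x\<in>X. 1)"
    using A.disjoint_sum[OF fin, of "\<lambda>_. 1 :: nat"] by simp
  also have "\<dots> = (\<Sum>X\<in>?O. card X)" by simp
  also have "\<dots> = 1 + (\<Sum>X\<in>?O - {{\<one>}}. card X)"
    using one finO by (simp add: sum.remove)
  finally have "p ^ k = 1 + (\<Sum>X\<in>?O - {{\<one>}}. card X)" using assms(2) by (simp add: order_def)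
  moreover have "p dvd (\<Sum>X\<in>?O - {{\<one>}}. card X)" using dv by (rule dvd_sum)
  moreover have "p dvd p ^ k" using assms(3) by simp
  ultimately have "p dvd 1" by (metis dvd_add_left_iff)
  then show False using assms(1) by (simp add: prime_gt_1_nat)
qed

context normal
begin

lemma commutator_in:
  assumes "g \<in> carrier G" "z \<in> H"
  shows "\<lbrakk>g,z\<rbrakk> \<in> H" "\<lbrakk>z,g\<rbrakk> \<in> H"
proof -
  have z: "z \<in> carrier G" using assms subset by auto
  have "\<lbrakk>g,z\<rbrakk> = (g \<otimes> z \<otimes> inv g) \<otimes> inv z" by (simp add: group_commutator_def)
  then show *: "\<lbrakk>g,z\<rbrakk> \<in> H" using assms inv_op_closed2 by auto
  then show "\<lbrakk>z,g\<rbrakk> \<in> H" using inv_commutator[OF assms(1) z] by (metis m_inv_closed)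
qed

lemma commutator_swap_in:
  assumes "g \<in> carrier G" "z \<in> carrier G" "\<lbrakk>g,z\<rbrakk> \<in> H"
  shows "\<lbrakk>z,g\<rbrakk> \<in> H"
  using assms inv_commutator by (metis m_inv_closed)

text \<open>This set is the preimage of the centralizer of the image of \<open>A\<close> in the
  quotient by \<open>H\<close>. It serves to extend a commutation property from generators, or from
  \<open>q\<close>-th powers, to everything they generate.\<close>

lemma centralizer_mod_subgroup:
  assumes "A \<subseteq> carrier G"
  shows "subgroup {u \<in> carrier G. \<forall>v\<in>A. \<lbrakk>u,v\<rbrakk> \<in> H} G"
proof
  show "\<one> \<in> {u \<in> carrier G. \<forall>v\<in>A. \<lbrakk>u,v\<rbrakk> \<in> H}"
    using assms by (auto simp: group_commutator_def subset_iff)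
next
  fix x y assume "x \<in> {u \<in> carrier G. \<forall>v\<in>A. \<lbrakk>u,v\<rbrakk> \<in> H}" "y \<in> {u \<in> carrier G. \<forall>v\<in>A. \<lbrakk>u,v\<rbrakk> \<in> H}"
  then show "x \<otimes> y \<in> {u \<in> carrier G. \<forall>v\<in>A. \<lbrakk>u,v\<rbrakk> \<in> H}"
    using assms commutator_mult_left inv_op_closed2 m_closed by (auto simp: subset_iff)
next
  fix x assume "x \<in> {u \<in> carrier G. \<forall>v\<in>A. \<lbrakk>u,v\<rbrakk> \<in> H}"
  then show "inv x \<in> {u \<in> carrier G. \<forall>v\<in>A. \<lbrakk>u,v\<rbrakk> \<in> H}"
    using assms commutator_inv_left inv_op_closed1 by (auto simp: subset_iff)
qed auto

end

context group
begin

lemma subgroup_nat_pow_closed: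
  assumes "subgroup H G" "x \<in> H"
  shows "x [^] (n::nat) \<in> H"
  using subgroup_int_pow_closed[OF assms, of "int n"] by (simp add: int_pow_int)

lemma normal_iff_conj:
  "N \<lhd> G \<longleftrightarrow> subgroup N G \<and> (\<forall>g\<in>carrier G. \<forall>x\<in>N. g \<otimes> x \<otimes> inv g \<in> N)"
  using normal_inv_iff by simp

lemma cyclic_normalI:
  assumes c: "c \<in> carrier G" and conj: "\<And>g. g \<in> carrier G \<Longrightarrow> \<exists>l::int. g \<otimes> c \<otimes> inv g = c [^] l"
  shows "generate G {c} \<lhd> G"
  unfolding normal_iff_conj
proof (intro conjI ballI)
  show "subgroup (generate G {c}) G" using c by (intro generate_is_subgroup) auto
  fix g x assume g: "g \<in> carrier G" and "x \<in> generate G {c}"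
  then obtain k :: int where k: "x = c [^] k" using generate_pow[OF c] by auto
  obtain l :: int where "g \<otimes> c \<otimes> inv g = c [^] l" using conj g by blast
  then have "g \<otimes> x \<otimes> inv g = c [^] (l * k)" using conj_pow_of_conj_pow k g c by simp
  then show "g \<otimes> x \<otimes> inv g \<in> generate G {c}" using generate_pow[OF c] by auto
qed

text \<open>For normal \<open>M\<close> this is the preimage of the subgroup of central elements of
  order dividing \<open>p\<close> in the quotient by \<open>M\<close>. It is formed inside
  \<open>G\<close>, so that \<open>M\<close> can vary while the group stays fixed.\<close>

definition omega_mod :: "nat \<Rightarrow> 'a set \<Rightarrow> 'a set" where
  "omega_mod p M = {z \<in> carrier G. z [^] p \<in> M \<and> (\<forall>g\<in>carrier G. \<lbrakk>g,z\<rbrakk> \<in> M)}"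

lemma omega_mod_normal:
  assumes "M \<lhd> G"
  shows "omega_mod p M \<lhd> G" "M \<subseteq> omega_mod p M"
proof -
  interpret M: normal M G by fact
  have mult: "x \<otimes> y \<in> omega_mod p M" if "x \<in> omega_mod p M" "y \<in> omega_mod p M" for x y
  proof -
    have xy: "x \<in> carrier G" "y \<in> carrier G" "x [^] p \<in> M" "y [^] p \<in> M"
      and c: "\<And>g. g \<in> carrier G \<Longrightarrow> \<lbrakk>g,x\<rbrakk> \<in> M" "\<And>g. g \<in> carrier G \<Longrightarrow> \<lbrakk>g,y\<rbrakk> \<in> M"
      using that by (auto simp: omega_mod_def)
    have e: "\<lbrakk>y,x\<rbrakk> \<in> M" using c xy by simp
    have "\<exists>z\<in>M. (x \<otimes> y) [^] p = x [^] p \<otimes> y [^] p \<otimes> \<lbrakk>y,x\<rbrakk> [^] (\<Sum>i<p. i) \<otimes> z"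
      using e xy M.commutator_in by (intro M.pow_mult_class_two_mod) auto
    then have "(x \<otimes> y) [^] p \<in> M"
      using xy(3,4) subgroup_nat_pow_closed[OF M.subgroup_axioms e] by auto
    moreover have "\<lbrakk>g, x \<otimes> y\<rbrakk> \<in> M" if "g \<in> carrier G" for g
      using that xy c M.inv_op_closed2 by (simp add: commutator_mult_right)
    ultimately show ?thesis using xy by (simp add: omega_mod_def)
  qed
  show sub: "M \<subseteq> omega_mod p M"
    using M.subset M.commutator_in subgroup_nat_pow_closed[OF M.subgroup_axioms]
    by (auto simp: omega_mod_def)
  have inv: "inv x \<in> omega_mod p M" if "x \<in> omega_mod p M" for x
  proof -
    have x: "x \<in> carrier G" "x [^] p \<in> M" "\<And>g. g \<in> carrier G \<Longrightarrow> \<lbrakk>g,x\<rbrakk> \<in> M"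
      using that by (auto simp: omega_mod_def)
    have "\<lbrakk>inv x, g\<rbrakk> \<in> M" if "g \<in> carrier G" for g
    proof -
      have "inv \<lbrakk>x,g\<rbrakk> \<in> M" using x that by (simp add: inv_commutator)
      then show ?thesis using x(1) that M.inv_op_closed1 by (simp add: commutator_inv_left)
    qed
    then have "\<lbrakk>g, inv x\<rbrakk> \<in> M" if "g \<in> carrier G" for g
      using that x M.commutator_swap_in by simp
    then show ?thesis using x by (simp add: omega_mod_def nat_pow_inv)
  qed
  show "omega_mod p M \<lhd> G"
    unfolding normal_iff_conj
  proof (intro conjI ballI)
    show "subgroup (omega_mod p M) G"
    proof
      show "omega_mod p M \<subseteq> carrier G" by (auto simp: omega_mod_def)
    qed (use mult inv sub M.one_closed in auto)
    fix g x assume g: "g \<in> carrier G" and x: "x \<in> omega_mod p M"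
    then have "\<lbrakk>g,x\<rbrakk> \<in> omega_mod p M" using sub by (auto simp: omega_mod_def)
    then show "g \<otimes> x \<otimes> inv g \<in> omega_mod p M"
      using g x mult conj_eq_commutator_mult by (auto simp: omega_mod_def)
  qed
qed

text \<open>The quotient by \<open>M\<close> is a nontrivial p-group, so it has a nontrivial central
  element, and a suitable power of that element has order exactly \<open>p\<close>.\<close>

lemma omega_mod_strict:
  assumes p: "prime p" and ord: "order G = p ^ k" and M: "M \<lhd> G" and ne: "M \<noteq> carrier G"
  shows "M \<subset> omega_mod p M"
proof -
  interpret M: normal M G by fact
  interpret Q: group "G Mod M" by (rule M.factorgroup_is_group)
  have fin: "finite (carrier G)" using p ord by (simp add: order_gt_0_iff_finite[symmetric] prime_gt_0_nat)
  have lag: "card (rcosets M) * card M = p ^ k"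
    using lagrange[OF M.subgroup_axioms] ord by simp
  then have "card (rcosets M) dvd p ^ k" by (metis dvd_triv_left)
  then obtain j where j: "card (rcosets M) = p ^ j" using divides_primepow_nat p by blast
  have "j > 0"
  proof (rule ccontr)
    assume "\<not> j > 0"
    then have "card M = card (carrier G)" using lag j ord by (simp add: order_def)
    then show False using fin M.subset ne by (metis card_subset_eq)
  qed
  moreover have "order (G Mod M) = p ^ j" using j by (simp add: order_def FactGroup_def)
  ultimately obtain Z where Z: "Z \<in> carrier (G Mod M)" "Z \<noteq> \<one>\<^bsub>G Mod M\<^esub>"
    "\<And>g. g \<in> carrier (G Mod M) \<Longrightarrow> g \<otimes>\<^bsub>G Mod M\<^esub> Z = Z \<otimes>\<^bsub>G Mod M\<^esub> g"
    using Q.p_group_center_nontrivial[OF p] by metis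
  obtain z where z: "z \<in> carrier G" "Z = M #> z" using Z(1) by (auto simp: carrier_FactGroup)
  have cen: "\<lbrakk>g,z\<rbrakk> \<in> M" if g: "g \<in> carrier G" for g
  proof -
    have "\<lbrakk>M #> g, M #> z\<rbrakk>\<^bsub>G Mod M\<^esub> = \<one>\<^bsub>G Mod M\<^esub>"
      using Q.commutator_eq_one_iff M.coset_in_Mod g z Z by simp
    then have "M #> \<lbrakk>g,z\<rbrakk> = M" using M.coset_commutator g z by simp
    then show ?thesis using coset_join1 M.subgroup_axioms M.subset g z by (metis commutator_closed)
  qed
  have "Z [^]\<^bsub>G Mod M\<^esub> (p ^ j) = \<one>\<^bsub>G Mod M\<^esub>"
    using Q.pow_order_eq_1[OF Z(1)] \<open>order (G Mod M) = p ^ j\<close> by simp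
  then have zj: "z [^] (p ^ j) \<in> M"
    using M.coset_nat_pow z coset_join1 M.subgroup_axioms M.subset by (metis nat_pow_closed one_FactGroup)
  have "z [^] (p ^ 0) \<notin> M" using Z(2) z coset_join2[OF z(1) M.subgroup_axioms] by auto
  obtain i where i: "z [^] (p ^ i) \<notin> M" "z [^] (p ^ Suc i) \<in> M"
  proof (rule ccontr)
    assume none: "\<not> thesis"
    have "z [^] (p ^ m) \<notin> M" for m
    proof (induction m)
      case 0
      then show ?case using \<open>z [^] (p ^ 0) \<notin> M\<close> .
    next
      case (Suc m)
      then show ?case using none that by blast
    qed
    then show False using zj by blast
  qed
  let ?w = "z [^] (p ^ i)"
  have "?w [^] p \<in> M" using i(2) z by (simp add: nat_pow_pow mult.commute)
  moreover have "\<lbrakk>g,?w\<rbrakk> \<in> M" if g: "g \<in> carrier G" for g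
  proof -
    have "subgroup {u \<in> carrier G. \<forall>v\<in>{g}. \<lbrakk>u,v\<rbrakk> \<in> M} G" using M.centralizer_mod_subgroup[of "{g}"] g by blast
    moreover have "z \<in> {u \<in> carrier G. \<forall>v\<in>{g}. \<lbrakk>u,v\<rbrakk> \<in> M}"
      using z cen g M.commutator_swap_in by simp
    ultimately have "?w \<in> {u \<in> carrier G. \<forall>v\<in>{g}. \<lbrakk>u,v\<rbrakk> \<in> M}" by (rule subgroup_nat_pow_closed)
    then show ?thesis using M.commutator_swap_in g by simp
  qed
  ultimately have "?w \<in> omega_mod p M" using z by (simp add: omega_mod_def)
  then show ?thesis using i(1) omega_mod_normal(2)[OF M] by blast
qed

text \<open>Stands in for induction on the order of a p-group: by \<open>omega_mod_strict\<close>,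
  iterating \<open>omega_mod\<close> climbs from \<open>M\<close> to the whole group, and
  \<open>P\<close> comes back down through sections that are central of exponent
  \<open>p\<close>.\<close>

lemma p_group_descent:
  assumes p: "prime p" and ord: "order G = p ^ k"
    and top: "P (carrier G)"
    and step: "\<And>M. M \<lhd> G \<Longrightarrow> P (omega_mod p M) \<Longrightarrow> P M"
    and M: "M \<lhd> G"
  shows "P M"
  using M
proof (induction "card (carrier G - M)" arbitrary: M rule: less_induct)
  case less
  have fin: "finite (carrier G)" using p ord by (simp add: order_gt_0_iff_finite[symmetric] prime_gt_0_nat)
  show ?case
  proof (cases "M = carrier G")
    case False
    let ?O = "omega_mod p M"
    have "?O \<subseteq> carrier G" by (auto simp: omega_mod_def)
    then have "carrier G - ?O \<subset> carrier G - M"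
      using omega_mod_strict[OF p ord less.prems False] by blast
    then have "P ?O" using fin omega_mod_normal(1)[OF less.prems] less.hyps
      by (meson finite_Diff psubset_card_mono)
    then show ?thesis using step less.prems by blast
  qed (use top in simp)
qed

end

section \<open>Two divisibility facts about the exponent of powerfulness\<close>

lemma dvd_sum_lessThan:
  fixes p :: nat
  assumes "prime p"
  shows "p dvd (\<Sum>i<(if p = 2 then 4 else p). i)"
proof (cases "p = 2")
  case True
  have "(\<Sum>i<4::nat. i) = 6" by (simp add: eval_nat_numeral)
  then show ?thesis using True by simp
next
  case False
  then have "odd p" using assms prime_odd_nat[of p] prime_ge_2_nat[of p] by linarith
  then obtain m where m: "p = 2 * m + 1" by (metis oddE)
  have "(\<Sum>i<n. i) * 2 = n * (n - 1)" for n :: nat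
  proof (induction n)
    case (Suc n)
    then show ?case by (cases n) (auto simp: algebra_simps)
  qed simp
  from this[of p] have "(\<Sum>i<p. i) = p * m" using m by simp
  then show ?thesis using False by simp
qed

text \<open>For odd \<open>p\<close> there are \<open>p\<close> summands, each 1 modulo
  \<open>p\<close>. For \<open>p = 2\<close> the sum factors as \<open>(1 + l)(1 + l^2)\<close>, a
  product of two even numbers.\<close>

lemma geometric_sum_dvd:
  fixes l :: int and p :: nat
  assumes "prime p" "[l = 1] (mod int p)"
  shows "int (if p = 2 then 4 else p) dvd (\<Sum>i<(if p = 2 then 4 else p). l ^ i)"
proof (cases "p = 2")
  case True
  then have "odd l" using assms(2) by (auto simp: cong_def)
  then obtain m where m: "l = 2 * m + 1" by (metis oddE)
  have "(\<Sum>i<4. l ^ i) = (1 + l) * (1 + l ^ 2)"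
    by (simp add: eval_nat_numeral algebra_simps)
  also have "\<dots> = 4 * ((1 + m) * (2 * m\<^sup>2 + 2 * m + 1))"
    unfolding m by (simp add: power2_eq_square algebra_simps)
  finally show ?thesis using True by simp
next
  case False
  have "[(\<Sum>i<p. l ^ i) = (\<Sum>i<p. 1 ^ i)] (mod int p)"
    by (intro cong_sum cong_pow assms(2))
  then have "[(\<Sum>i<p. l ^ i) = 0] (mod int p)" by (simp add: cong_def)
  then show ?thesis using False by (simp add: cong_0_iff)
qed

section \<open>The derived subgroup of a powerful two-generator p-group\<close>

context group
begin

lemma int_pow_in_generate: "c \<in> carrier G \<Longrightarrow> c [^] (k::int) \<in> generate G {c}"
  using generate_pow by auto

text \<open>Modulo the cyclic normal subgroup generated by \<open>c\<close> the group is abelian, so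
  a word in \<open>x\<close> and \<open>y\<close> can be sorted there.\<close>

lemma generate_pairE:
  assumes xy: "x \<in> carrier G" "y \<in> carrier G" "c \<in> carrier G"
    and comm: "\<And>u v. u \<in> carrier G \<Longrightarrow> v \<in> carrier G \<Longrightarrow> \<exists>k::int. \<lbrakk>u,v\<rbrakk> = c [^] k"
    and g: "g \<in> generate G {x, y}"
  shows "\<exists>(i::int) (j::int) (k::int). g = x [^] i \<otimes> y [^] j \<otimes> c [^] k"
proof -
  let ?C = "generate G {c}"
  interpret C: normal ?C G
  proof (rule cyclic_normalI[OF xy(3)])
    fix g assume g: "g \<in> carrier G"
    then obtain k :: int where "\<lbrakk>g,c\<rbrakk> = c [^] k" using comm xy by blast
    then have "g \<otimes> c \<otimes> inv g = c [^] (k + 1)"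
      using conj_eq_commutator_mult[OF g xy(3)] xy by (simp add: int_pow_mult)
    then show "\<exists>l::int. g \<otimes> c \<otimes> inv g = c [^] l" by blast
  qed
  interpret Q: group "G Mod ?C" by (rule C.factorgroup_is_group)
  have Qcomm: "A \<otimes>\<^bsub>G Mod ?C\<^esub> B = B \<otimes>\<^bsub>G Mod ?C\<^esub> A"
    if AB: "A \<in> carrier (G Mod ?C)" "B \<in> carrier (G Mod ?C)" for A B
  proof -
    obtain a b where ab: "a \<in> carrier G" "b \<in> carrier G" "A = ?C #> a" "B = ?C #> b"
      using AB by (auto simp: carrier_FactGroup)
    have "\<lbrakk>a,b\<rbrakk> \<in> ?C" using comm[OF ab(1,2)] int_pow_in_generate xy(3) by auto
    then have "\<lbrakk>A,B\<rbrakk>\<^bsub>G Mod ?C\<^esub> = \<one>\<^bsub>G Mod ?C\<^esub>"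
      using ab C.coset_commutator by (simp add: coset_join2 C.is_subgroup C.subgroup_axioms)
    then show ?thesis using Q.commutator_eq_one_iff AB by simp
  qed
  let ?X = "?C #> x" and ?Y = "?C #> y"
  have XY: "?X \<in> carrier (G Mod ?C)" "?Y \<in> carrier (G Mod ?C)"
    using xy C.coset_in_Mod by auto
  have *: "\<exists>(i::int) (j::int). ?C #> g = ?X [^]\<^bsub>G Mod ?C\<^esub> i \<otimes>\<^bsub>G Mod ?C\<^esub> ?Y [^]\<^bsub>G Mod ?C\<^esub> j"
    using g
  proof (induction g rule: generate.induct)
    case one
    have "?C #> \<one> = \<one>\<^bsub>G Mod ?C\<^esub>" using C.subset by (simp add: coset_mult_one)
    moreover have "\<dots> = ?X [^]\<^bsub>G Mod ?C\<^esub> (0::int) \<otimes>\<^bsub>G Mod ?C\<^esub> ?Y [^]\<^bsub>G Mod ?C\<^esub> (0::int)"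
      by (simp only: int_pow_0 Q.l_one Q.one_closed)
    ultimately have "?C #> \<one> = ?X [^]\<^bsub>G Mod ?C\<^esub> (0::int) \<otimes>\<^bsub>G Mod ?C\<^esub> ?Y [^]\<^bsub>G Mod ?C\<^esub> (0::int)"
      by (rule trans)
    then show ?case by blast
  next
    case (incl h)
    have "?C #> x = ?X [^]\<^bsub>G Mod ?C\<^esub> (1::int) \<otimes>\<^bsub>G Mod ?C\<^esub> ?Y [^]\<^bsub>G Mod ?C\<^esub> (0::int)" "?C #> y = ?X [^]\<^bsub>G Mod ?C\<^esub> (0::int) \<otimes>\<^bsub>G Mod ?C\<^esub> ?Y [^]\<^bsub>G Mod ?C\<^esub> (1::int)"
      using XY xy C.coset_inv by (simp_all del: mult_FactGroup one_FactGroup)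
    then show ?case using incl by blast
  next
    case (inv h)
    have "?C #> inv x = ?X [^]\<^bsub>G Mod ?C\<^esub> (-1::int) \<otimes>\<^bsub>G Mod ?C\<^esub> ?Y [^]\<^bsub>G Mod ?C\<^esub> (0::int)" "?C #> inv y = ?X [^]\<^bsub>G Mod ?C\<^esub> (0::int) \<otimes>\<^bsub>G Mod ?C\<^esub> ?Y [^]\<^bsub>G Mod ?C\<^esub> (-1::int)"
      using XY xy by (simp_all add: Q.int_pow_neg C.coset_inv[symmetric] del: mult_FactGroup one_FactGroup)
    then show ?case using inv by blast
  next
    case (eng h1 h2)
    have h: "h1 \<in> carrier G" "h2 \<in> carrier G"
      using eng.hyps xy generate_in_carrier[of "{x,y}"] by auto
    obtain i j i' j' :: int where ij:
      "?C #> h1 = ?X [^]\<^bsub>G Mod ?C\<^esub> i \<otimes>\<^bsub>G Mod ?C\<^esub> ?Y [^]\<^bsub>G Mod ?C\<^esub> j"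
      "?C #> h2 = ?X [^]\<^bsub>G Mod ?C\<^esub> i' \<otimes>\<^bsub>G Mod ?C\<^esub> ?Y [^]\<^bsub>G Mod ?C\<^esub> j'"
      using eng.IH by blast
    have "?C #> (h1 \<otimes> h2) = (?C #> h1) \<otimes>\<^bsub>G Mod ?C\<^esub> (?C #> h2)" using h C.coset_mult by simp
    also have "\<dots> = ?X [^]\<^bsub>G Mod ?C\<^esub> i \<otimes>\<^bsub>G Mod ?C\<^esub> (?Y [^]\<^bsub>G Mod ?C\<^esub> j \<otimes>\<^bsub>G Mod ?C\<^esub> ?X [^]\<^bsub>G Mod ?C\<^esub> i') \<otimes>\<^bsub>G Mod ?C\<^esub> ?Y [^]\<^bsub>G Mod ?C\<^esub> j'"
      unfolding ij using XY by (simp add: Q.m_assoc del: mult_FactGroup)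
    also have "?Y [^]\<^bsub>G Mod ?C\<^esub> j \<otimes>\<^bsub>G Mod ?C\<^esub> ?X [^]\<^bsub>G Mod ?C\<^esub> i' = ?X [^]\<^bsub>G Mod ?C\<^esub> i' \<otimes>\<^bsub>G Mod ?C\<^esub> ?Y [^]\<^bsub>G Mod ?C\<^esub> j"
      using XY by (intro Qcomm) auto
    also have "?X [^]\<^bsub>G Mod ?C\<^esub> i \<otimes>\<^bsub>G Mod ?C\<^esub> (?X [^]\<^bsub>G Mod ?C\<^esub> i' \<otimes>\<^bsub>G Mod ?C\<^esub> ?Y [^]\<^bsub>G Mod ?C\<^esub> j) \<otimes>\<^bsub>G Mod ?C\<^esub> ?Y [^]\<^bsub>G Mod ?C\<^esub> j'
      = ?X [^]\<^bsub>G Mod ?C\<^esub> (i + i') \<otimes>\<^bsub>G Mod ?C\<^esub> ?Y [^]\<^bsub>G Mod ?C\<^esub> (j + j')"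
      using XY by (simp add: Q.m_assoc Q.int_pow_mult del: mult_FactGroup)
    finally show ?case by blast
  qed
  then obtain i j :: int where "?C #> g = ?X [^]\<^bsub>G Mod ?C\<^esub> i \<otimes>\<^bsub>G Mod ?C\<^esub> ?Y [^]\<^bsub>G Mod ?C\<^esub> j" by blast
  also have "\<dots> = ?C #> (x [^] i \<otimes> y [^] j)"
    using xy by (simp add: C.coset_int_pow C.coset_mult del: mult_FactGroup)
  finally obtain z where "z \<in> ?C" "g = x [^] i \<otimes> y [^] j \<otimes> z"
    using C.coset_eq_iff generate_in_carrier[of "{x,y}"] g xy by auto
  then show ?thesis using generate_pow xy(3) by auto
qed

text \<open>One step of the descent: modulo central elements of order \<open>p\<close> the derived subgroup is
  already known to be cyclic. Writing \<open>e = [h,g]\<close>, conjugation by \<open>h\<close> multiplies \<open>e\<close> by a central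
  element \<open>w\<close> of order \<open>p\<close>, up to \<open>p\<close>-th powers of \<open>c\<close>; hence
  \<open>[h\<^sup>q,g] = e\<^sup>q w\<^bsup>q(q-1)/2\<^esup> = 1\<close> modulo \<open>\<langle>c\<^sup>p\<rangle>\<close>, so that \<open>q\<close>-th powers, and with them all
  commutators, are central modulo \<open>\<langle>c\<^sup>p\<rangle>\<close>.\<close>

lemma derived_cyclic_step:
  fixes p q :: nat
  assumes q: "p dvd q" "p dvd (\<Sum>i<q. i)"
    and xy: "x \<in> carrier G" "y \<in> carrier G" and c: "c = \<lbrakk>x,y\<rbrakk>"
    and gen: "generate G {x, y} = carrier G"
    and pow: "\<And>u v. u \<in> carrier G \<Longrightarrow> v \<in> carrier G \<Longrightarrow> \<lbrakk>u,v\<rbrakk> \<in> generate G {h [^] q | h. h \<in> carrier G}"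
    and Z: "\<And>z. z \<in> Z \<Longrightarrow> z \<in> carrier G" "\<And>z. z \<in> Z \<Longrightarrow> z [^] p = \<one>"
      "\<And>z g. z \<in> Z \<Longrightarrow> g \<in> carrier G \<Longrightarrow> g \<otimes> z = z \<otimes> g"
    and D: "\<And>u v. u \<in> carrier G \<Longrightarrow> v \<in> carrier G \<Longrightarrow> \<exists>k::int. \<exists>z\<in>Z. \<lbrakk>u,v\<rbrakk> = c [^] k \<otimes> z"
    and A: "\<And>g. g \<in> carrier G \<Longrightarrow> \<exists>i::int. \<exists>z\<in>Z. g \<otimes> c \<otimes> inv g = c [^] (1 + int p * i) \<otimes> z"
  shows "\<And>u v. u \<in> carrier G \<Longrightarrow> v \<in> carrier G \<Longrightarrow> \<exists>k::int. \<lbrakk>u,v\<rbrakk> = c [^] k"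
    and "\<And>g. g \<in> carrier G \<Longrightarrow> \<exists>i::int. g \<otimes> c \<otimes> inv g = c [^] (1 + int p * i)"
proof -
  have cc: "c \<in> carrier G" using c xy by simp
  have Zpow: "z [^] (int p * k) = \<one>" if "z \<in> Z" for z k
    using Z[OF that] int_pow_pow[of z "int p" k] by (simp add: int_pow_int)
  have Zcomm: "g \<otimes> z [^] (k::int) = z [^] k \<otimes> g" if "z \<in> Z" "g \<in> carrier G" for g z k
    using commute_int_pow that Z by blast
  have conjc: "h \<otimes> c [^] k \<otimes> inv h = c [^] ((1 + int p * i) * k) \<otimes> z [^] k"
    if "h \<in> carrier G" "z \<in> Z" "h \<otimes> c \<otimes> inv h = c [^] (1 + int p * i) \<otimes> z" for h z and i k :: int
  proof -
    have "c [^] (1 + int p * i) \<otimes> z = z \<otimes> c [^] (1 + int p * i)"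
      using that(2) cc Z(3) by simp
    then have "(c [^] (1 + int p * i) \<otimes> z) [^] k = (c [^] (1 + int p * i)) [^] k \<otimes> z [^] k"
      using that(2) cc Z(1) by (intro int_pow_mult_distrib) auto
    then show ?thesis using that(1,3) cc by (simp add: conj_int_pow int_pow_pow)
  qed
  \<comment> \<open>This subgroup is normal although conjugation respects powers of \<open>c\<close>
    only up to an element of \<open>Z\<close>: that element is central of order dividing
    \<open>p\<close>, so it vanishes on passing to \<open>c^p\<close>.\<close>
  let ?B = "generate G {c [^] p}"
  interpret B: normal ?B G
  proof (rule cyclic_normalI)
    fix g assume g: "g \<in> carrier G"
    obtain i :: int and z where iz: "z \<in> Z" "g \<otimes> c \<otimes> inv g = c [^] (1 + int p * i) \<otimes> z"
      using A[OF g] by blast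
    have "g \<otimes> c [^] int p \<otimes> inv g = c [^] ((1 + int p * i) * int p) \<otimes> z [^] int p"
      by (rule conjc[OF g iz])
    also have "\<dots> = (c [^] int p) [^] (1 + int p * i)"
    proof -
      have "z [^] int p = \<one>" using Zpow[OF iz(1), of 1] by simp
      then show ?thesis using cc by (simp only: int_pow_pow mult.commute r_one int_pow_closed)
    qed
    finally show "\<exists>l::int. g \<otimes> c [^] p \<otimes> inv g = (c [^] p) [^] l" by (auto simp: int_pow_int)
  qed (use cc in simp)
  have B: "b \<in> ?B \<longleftrightarrow> (\<exists>k::int. b = c [^] (int p * k))" for b
    using cc generate_pow[of "c [^] p"] by (auto simp: int_pow_int[symmetric] int_pow_pow)
  have hq: "\<lbrakk>h [^] q, g\<rbrakk> \<in> ?B" if hg: "h \<in> carrier G" "g \<in> carrier G" for h g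
  proof -
    obtain k :: int and z1 where e: "z1 \<in> Z" "\<lbrakk>h,g\<rbrakk> = c [^] k \<otimes> z1" using D[OF hg] by blast
    obtain i :: int and z where iz: "z \<in> Z" "h \<otimes> c \<otimes> inv h = c [^] (1 + int p * i) \<otimes> z"
      using A[OF hg(1)] by blast
    note car = cc hg Z(1)[OF e(1)] Z(1)[OF iz(1)]
    \<comment> \<open>The exponent of \<open>c\<close> matters only modulo \<open>p\<close>, hence
      the unspecified \<open>m\<close>. The exponents of \<open>z1\<close> and \<open>z\<close> are
      kept exact, because at \<open>n = q\<close> both are divisible by \<open>p\<close> and the two
      factors disappear.\<close>
    have "\<exists>m::int. \<lbrakk>h [^] n, g\<rbrakk> = c [^] (k * int n + int p * m) \<otimes> (z1 [^] int n \<otimes> z [^] (k * int (\<Sum>i<n. i)))" for n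
    proof (induction n)
      case 0
      show ?case using hg by (intro exI[of _ 0]) (simp add: group_commutator_def)
    next
      case (Suc n)
      then obtain m :: int where m:
        "\<lbrakk>h [^] n, g\<rbrakk> = c [^] (k * int n + int p * m) \<otimes> (z1 [^] int n \<otimes> z [^] (k * int (\<Sum>i<n. i)))" by blast
      let ?a = "k * int n + int p * m" and ?t = "k * int (\<Sum>i<n. i)"
      let ?w = "z1 [^] int n \<otimes> z [^] ?t"
      have w: "?w \<in> carrier G" using car by simp
      have hw: "h \<otimes> ?w = ?w \<otimes> h"
        using Zcomm[OF e(1) hg(1)] Zcomm[OF iz(1) hg(1)] car
        by (metis (no_types, lifting) int_pow_closed m_assoc)
      have "\<lbrakk>h [^] Suc n, g\<rbrakk> = \<lbrakk>h \<otimes> h [^] n, g\<rbrakk>" using hg by (metis nat_pow_Suc2)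
      also have "\<dots> = h \<otimes> (c [^] ?a \<otimes> ?w) \<otimes> inv h \<otimes> (c [^] k \<otimes> z1)"
        using hg commutator_mult_left m e by simp
      also have "h \<otimes> (c [^] ?a \<otimes> ?w) \<otimes> inv h = (h \<otimes> c [^] ?a \<otimes> inv h) \<otimes> (h \<otimes> ?w \<otimes> inv h)"
        using conj_mult car w by simp
      also have "h \<otimes> ?w \<otimes> inv h = ?w" using conj_eq_iff_commute[OF hg(1) w] hw by simp
      also have "h \<otimes> c [^] ?a \<otimes> inv h = c [^] ((1 + int p * i) * ?a) \<otimes> z [^] ?a"
        by (rule conjc[OF hg(1) iz])
      also have "z [^] ?a = z [^] (k * int n)"
        using Zpow[OF iz(1)] car by (simp add: int_pow_mult)
      also have "c [^] ((1 + int p * i) * ?a) \<otimes> z [^] (k * int n) \<otimes> ?w \<otimes> (c [^] k \<otimes> z1)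
        = c [^] ((1 + int p * i) * ?a) \<otimes> ((z [^] (k * int n) \<otimes> ?w) \<otimes> c [^] k) \<otimes> z1"
        using car by (simp add: m_assoc)
      also have "(z [^] (k * int n) \<otimes> ?w) \<otimes> c [^] k = c [^] k \<otimes> (z [^] (k * int n) \<otimes> ?w)"
      proof -
        have "c [^] k \<otimes> z [^] j = z [^] j \<otimes> c [^] k" "c [^] k \<otimes> z1 [^] j = z1 [^] j \<otimes> c [^] k" for j :: int
          using Zcomm[OF e(1)] Zcomm[OF iz(1)] cc by simp_all
        then show ?thesis using car by (metis (no_types, lifting) int_pow_closed m_assoc m_closed)
      qed
      also have "c [^] ((1 + int p * i) * ?a) \<otimes> (c [^] k \<otimes> (z [^] (k * int n) \<otimes> ?w)) \<otimes> z1
        = c [^] ((1 + int p * i) * ?a + k) \<otimes> (z [^] (k * int n) \<otimes> ?w \<otimes> z1)"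
        using car by (simp add: m_assoc int_pow_mult)
      also have "z [^] (k * int n) \<otimes> ?w \<otimes> z1 = z1 [^] int (Suc n) \<otimes> z [^] (k * int (\<Sum>i<Suc n. i))"
      proof -
        have zz: "z [^] j \<otimes> z1 [^] l = z1 [^] l \<otimes> z [^] j" for j l :: int
          using Zcomm[OF iz(1)] car by simp
        have z1: "z [^] j \<otimes> z1 = z1 \<otimes> z [^] j" for j :: int
          using zz[of j 1] car by simp
        have "z [^] (k * int n) \<otimes> ?w \<otimes> z1 = (z [^] (k * int n) \<otimes> z1 [^] int n) \<otimes> (z [^] ?t \<otimes> z1)"
          using car by (simp add: m_assoc)
        also have "\<dots> = (z1 [^] int n \<otimes> z [^] (k * int n)) \<otimes> (z1 \<otimes> z [^] ?t)"
          unfolding zz z1 ..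
        also have "\<dots> = z1 [^] int n \<otimes> (z [^] (k * int n) \<otimes> z1) \<otimes> z [^] ?t"
          using car by (simp add: m_assoc)
        also have "\<dots> = z1 [^] int n \<otimes> z1 \<otimes> (z [^] (k * int n) \<otimes> z [^] ?t)"
          unfolding z1 using car by (simp add: m_assoc)
        also have "\<dots> = z1 [^] (int n + 1) \<otimes> z [^] (k * int n + ?t)"
          using car by (simp only: int_pow_mult int_pow_1)
        finally show ?thesis by (simp add: algebra_simps)
      qed
      also have "(1 + int p * i) * ?a + k = k * int (Suc n) + int p * (m + i * ?a)"
        by (simp add: algebra_simps)
      finally show ?case by blast
    qed
    from this[of q] obtain m :: int where m:
      "\<lbrakk>h [^] q, g\<rbrakk> = c [^] (k * int q + int p * m) \<otimes> (z1 [^] int q \<otimes> z [^] (k * int (\<Sum>i<q. i)))" by blast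
    obtain r s where rs: "q = p * r" "(\<Sum>i<q. i) = p * s" using q by (metis dvdE)
    have "z1 [^] int q = \<one>" using Zpow[OF e(1), of "int r"] rs(1) by simp
    moreover have "z [^] (k * int (\<Sum>i<q. i)) = \<one>"
      using Zpow[OF iz(1), of "k * int s"] rs(2) by (simp add: algebra_simps)
    ultimately have "\<lbrakk>h [^] q, g\<rbrakk> = c [^] (int p * (k * int r + m))"
      using m cc rs(1) by (simp add: algebra_simps)
    then show ?thesis using B by blast
  qed
  \<comment> \<open>The elements central modulo \<open>?B\<close>. Since \<open>q\<close>-th powers
    belong to this subgroup, powerfulness puts \<open>c\<close> there as well, which removes the
    error in \<open>Z\<close> from the conjugation formula.\<close>
  let ?S = "{u \<in> carrier G. \<forall>v\<in>carrier G. \<lbrakk>u,v\<rbrakk> \<in> ?B}"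
  have "generate G {h [^] q | h. h \<in> carrier G} \<subseteq> ?S"
    using hq by (intro generate_subgroup_incl B.centralizer_mod_subgroup) auto
  then have cS: "c \<in> ?S" using pow[OF xy] c by blast
  show A': "\<exists>i::int. g \<otimes> c \<otimes> inv g = c [^] (1 + int p * i)" if g: "g \<in> carrier G" for g
  proof -
    have "\<lbrakk>g,c\<rbrakk> \<in> ?B" using cS g B.commutator_swap_in cc by blast
    then obtain k :: int where "\<lbrakk>g,c\<rbrakk> = c [^] (int p * k)" using B by blast
    then have "g \<otimes> c \<otimes> inv g = c [^] (1 + int p * k)"
      using conj_eq_commutator_mult[OF g cc] int_pow_mult[OF cc, of "int p * k" 1] cc
      by (simp add: add.commute[of 1])
    then show ?thesis by blast
  qed
  interpret C: normal "generate G {c}" G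
    using A' by (intro cyclic_normalI[OF cc]) blast
  \<comment> \<open>An element commuting with both generators modulo the powers of \<open>c\<close>
    commutes with everything. This is used twice: first for \<open>u = x\<close> and
    \<open>u = y\<close>, then for arbitrary \<open>u\<close>.\<close>
  have step: "\<lbrakk>u,v\<rbrakk> \<in> generate G {c}"
    if u: "u \<in> carrier G" and v: "v \<in> carrier G" and "\<lbrakk>x,u\<rbrakk> \<in> generate G {c}" "\<lbrakk>y,u\<rbrakk> \<in> generate G {c}" for u v
  proof -
    have "generate G {x,y} \<subseteq> {w \<in> carrier G. \<forall>v\<in>{u}. \<lbrakk>w,v\<rbrakk> \<in> generate G {c}}"
      using that xy by (intro generate_subgroup_incl C.centralizer_mod_subgroup) auto
    then have "\<lbrakk>v,u\<rbrakk> \<in> generate G {c}" using v gen by blast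
    then show ?thesis using C.commutator_swap_in u v by blast
  qed
  have xy': "\<lbrakk>x,y\<rbrakk> \<in> generate G {c}" using c by (simp add: generate.incl)
  have "\<lbrakk>x,x\<rbrakk> = \<one>" "\<lbrakk>y,y\<rbrakk> = \<one>" using xy by (simp_all add: commutator_eq_one_iff)
  then have "\<lbrakk>x,v\<rbrakk> \<in> generate G {c}" "\<lbrakk>y,v\<rbrakk> \<in> generate G {c}" if "v \<in> carrier G" for v
    using step[OF xy(1) that] step[OF xy(2) that] xy' C.commutator_swap_in[OF xy xy'] C.one_closed
    by auto
  then show "\<exists>k::int. \<lbrakk>u,v\<rbrakk> = c [^] k" if "u \<in> carrier G" "v \<in> carrier G" for u v
    using step[OF that] that(1) generate_pow[OF cc] by auto
qed

text \<open>At \<open>M = carrier G\<close> the claim is trivial, and the way from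
  \<open>omega_mod p M\<close> to \<open>M\<close> is \<open>derived_cyclic_step\<close> in
  \<open>G Mod M\<close>. The two conjuncts have to descend together because each step consumes
  both.\<close>

lemma derived_cyclic_mod:
  fixes p q :: nat
  assumes p: "prime p" and ord: "order G = p ^ n"
    and q: "p dvd q" "p dvd (\<Sum>i<q. i)"
    and xy: "x \<in> carrier G" "y \<in> carrier G" and c: "c = \<lbrakk>x,y\<rbrakk>"
    and gen: "generate G {x, y} = carrier G"
    and pow: "\<And>u v. u \<in> carrier G \<Longrightarrow> v \<in> carrier G \<Longrightarrow> \<lbrakk>u,v\<rbrakk> \<in> generate G {h [^] q | h. h \<in> carrier G}"
    and M: "M \<lhd> G"
  shows "(\<forall>u\<in>carrier G. \<forall>v\<in>carrier G. \<exists>k::int. \<exists>m\<in>M. \<lbrakk>u,v\<rbrakk> = c [^] k \<otimes> m) \<and>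
     (\<forall>g\<in>carrier G. \<exists>i::int. \<exists>m\<in>M. g \<otimes> c \<otimes> inv g = c [^] (1 + int p * i) \<otimes> m)"
    (is "?P M")
proof (rule p_group_descent[OF p ord, of ?P, OF _ _ M])
  have cc: "c \<in> carrier G" using xy c by simp
  show "?P (carrier G)"
  proof (intro conjI ballI)
    fix u v assume "u \<in> carrier G" "v \<in> carrier G"
    then show "\<exists>k::int. \<exists>m\<in>carrier G. \<lbrakk>u,v\<rbrakk> = c [^] k \<otimes> m"
      by (intro exI[of _ "0::int"] bexI[of _ "\<lbrakk>u,v\<rbrakk>"]) auto
  next
    fix g assume "g \<in> carrier G"
    then show "\<exists>i::int. \<exists>m\<in>carrier G. g \<otimes> c \<otimes> inv g = c [^] (1 + int p * i) \<otimes> m"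
      using cc by (intro exI[of _ "0::int"] bexI[of _ "inv c \<otimes> (g \<otimes> c \<otimes> inv g)"]) auto
  qed
next
  fix M assume M: "M \<lhd> G" and PO: "?P (omega_mod p M)"
  have cc: "c \<in> carrier G" using xy c by simp
  interpret M: normal M G by fact
  let ?Q = "G Mod M"
  interpret Q: group ?Q by (rule M.factorgroup_is_group)
  let ?Z = "(\<lambda>z. M #> z) ` omega_mod p M"
  let ?x = "M #> x" and ?y = "M #> y" and ?c = "M #> c"
  have oc: "omega_mod p M \<subseteq> carrier G" by (auto simp: omega_mod_def)
  have hom: "group_hom G ?Q (\<lambda>a. M #> a)"
    using M.r_coset_hom_Mod by (simp add: group_hom_def group_hom_axioms_def is_group Q.is_group)
  have one: "M #> m = \<one>\<^bsub>?Q\<^esub>" if "m \<in> M" for m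
    using that M.subset coset_join2[OF _ M.subgroup_axioms that] by auto
  have lift: "\<exists>u\<in>carrier G. U = M #> u" if "U \<in> carrier ?Q" for U
    using that by (auto simp: carrier_FactGroup)
  have h1: "generate ?Q {?x, ?y} = carrier ?Q"
    using group_hom.generate_img[OF hom, of "{x,y}"] xy gen by (simp add: carrier_FactGroup)
  have h2: "\<lbrakk>U,V\<rbrakk>\<^bsub>?Q\<^esub> \<in> generate ?Q {h [^]\<^bsub>?Q\<^esub> q | h. h \<in> carrier ?Q}"
    if UV: "U \<in> carrier ?Q" "V \<in> carrier ?Q" for U V
  proof -
    obtain u v where uv: "u \<in> carrier G" "v \<in> carrier G" "U = M #> u" "V = M #> v"
      using lift[OF UV(1)] lift[OF UV(2)] by blast
    let ?H = "{h [^] q | h. h \<in> carrier G}"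
    have "(\<lambda>a. M #> a) ` ?H \<subseteq> {h [^]\<^bsub>?Q\<^esub> q | h. h \<in> carrier ?Q}"
    proof clarify
      fix h assume "h \<in> carrier G"
      then show "\<exists>h'. M #> h [^] q = h' [^]\<^bsub>?Q\<^esub> q \<and> h' \<in> carrier ?Q"
        using M.coset_nat_pow[of h q] M.coset_in_Mod[of h] by metis
    qed
    then have "generate ?Q ((\<lambda>a. M #> a) ` ?H) \<subseteq> generate ?Q {h [^]\<^bsub>?Q\<^esub> q | h. h \<in> carrier ?Q}"
      by (rule Q.mono_generate)
    moreover have "generate ?Q ((\<lambda>a. M #> a) ` ?H) = (\<lambda>a. M #> a) ` generate G ?H"
      by (rule group_hom.generate_img[OF hom]) auto
    moreover have "\<lbrakk>U,V\<rbrakk>\<^bsub>?Q\<^esub> = M #> \<lbrakk>u,v\<rbrakk>" using uv M.coset_commutator by simp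
    ultimately show ?thesis using pow[OF uv(1,2)] by blast
  qed
  have h3: "z \<in> carrier ?Q \<and> z [^]\<^bsub>?Q\<^esub> p = \<one>\<^bsub>?Q\<^esub>" if "z \<in> ?Z" for z
    using that oc M.coset_in_Mod M.coset_nat_pow one by (auto simp: omega_mod_def simp del: one_FactGroup)
  have h4: "g \<otimes>\<^bsub>?Q\<^esub> z = z \<otimes>\<^bsub>?Q\<^esub> g" if zZ: "z \<in> ?Z" and g: "g \<in> carrier ?Q" for g z
  proof -
    obtain w h where w: "w \<in> omega_mod p M" "z = M #> w" "h \<in> carrier G" "g = M #> h"
      using zZ lift[OF g] by blast
    then have "\<lbrakk>h,w\<rbrakk> \<in> M" "w \<in> carrier G" by (auto simp: omega_mod_def)
    then have "\<lbrakk>g,z\<rbrakk>\<^bsub>?Q\<^esub> = \<one>\<^bsub>?Q\<^esub>" using w M.coset_commutator one by simp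
    then show ?thesis using Q.commutator_eq_one_iff[OF g] h3[OF zZ] by blast
  qed
  have h5: "\<exists>k::int. \<exists>z\<in>?Z. \<lbrakk>U,V\<rbrakk>\<^bsub>?Q\<^esub> = ?c [^]\<^bsub>?Q\<^esub> k \<otimes>\<^bsub>?Q\<^esub> z"
    if UV: "U \<in> carrier ?Q" "V \<in> carrier ?Q" for U V
  proof -
    obtain u v where uv: "u \<in> carrier G" "v \<in> carrier G" "U = M #> u" "V = M #> v"
      using lift[OF UV(1)] lift[OF UV(2)] by blast
    obtain k :: int and m where m: "m \<in> omega_mod p M" "\<lbrakk>u,v\<rbrakk> = c [^] k \<otimes> m" using PO uv by blast
    then have "\<lbrakk>U,V\<rbrakk>\<^bsub>?Q\<^esub> = ?c [^]\<^bsub>?Q\<^esub> k \<otimes>\<^bsub>?Q\<^esub> (M #> m)"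
      using uv cc oc by (auto simp: M.coset_commutator M.coset_int_pow M.coset_mult simp del: mult_FactGroup)
    then show ?thesis using m(1) by blast
  qed
  have h6: "\<exists>i::int. \<exists>z\<in>?Z. g \<otimes>\<^bsub>?Q\<^esub> ?c \<otimes>\<^bsub>?Q\<^esub> inv\<^bsub>?Q\<^esub> g = ?c [^]\<^bsub>?Q\<^esub> (1 + int p * i) \<otimes>\<^bsub>?Q\<^esub> z"
    if g: "g \<in> carrier ?Q" for g
  proof -
    obtain h where h: "h \<in> carrier G" "g = M #> h" using lift[OF g] by blast
    obtain i :: int and m where m: "m \<in> omega_mod p M" "h \<otimes> c \<otimes> inv h = c [^] (1 + int p * i) \<otimes> m" using PO h by blast
    have "g \<otimes>\<^bsub>?Q\<^esub> ?c \<otimes>\<^bsub>?Q\<^esub> inv\<^bsub>?Q\<^esub> g = M #> (h \<otimes> c \<otimes> inv h)"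
      using h cc by (simp add: M.coset_inv M.coset_mult del: mult_FactGroup)
    also have "\<dots> = ?c [^]\<^bsub>?Q\<^esub> (1 + int p * i) \<otimes>\<^bsub>?Q\<^esub> (M #> m)"
      unfolding m(2) using m(1) cc oc by (auto simp: M.coset_int_pow M.coset_mult simp del: mult_FactGroup)
    finally show ?thesis using m(1) by blast
  qed
  have cQ: "?c = \<lbrakk>?x,?y\<rbrakk>\<^bsub>?Q\<^esub>" using c xy M.coset_commutator by simp
  note step = Q.derived_cyclic_step[OF q M.coset_in_Mod[OF xy(1)] M.coset_in_Mod[OF xy(2)] cQ h1 h2
      conjunct1[OF h3] conjunct2[OF h3] h4 h5 h6]
  show "?P M"
  proof (intro conjI ballI)
    fix u v assume uv: "u \<in> carrier G" "v \<in> carrier G"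
    then obtain k :: int where "\<lbrakk>M #> u, M #> v\<rbrakk>\<^bsub>?Q\<^esub> = ?c [^]\<^bsub>?Q\<^esub> k"
      using step(1) M.coset_in_Mod by blast
    then have "M #> \<lbrakk>u,v\<rbrakk> = M #> c [^] k"
      using uv cc by (simp add: M.coset_commutator M.coset_int_pow)
    then show "\<exists>k::int. \<exists>m\<in>M. \<lbrakk>u,v\<rbrakk> = c [^] k \<otimes> m"
      using uv cc by (subst (asm) M.coset_eq_iff) auto
  next
    fix g assume g: "g \<in> carrier G"
    then obtain i :: int where "(M #> g) \<otimes>\<^bsub>?Q\<^esub> ?c \<otimes>\<^bsub>?Q\<^esub> inv\<^bsub>?Q\<^esub> (M #> g) = ?c [^]\<^bsub>?Q\<^esub> (1 + int p * i)"
      using step(2) M.coset_in_Mod by blast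
    then have "M #> (g \<otimes> c \<otimes> inv g) = M #> c [^] (1 + int p * i)"
      using g cc by (simp add: M.coset_inv M.coset_int_pow M.coset_mult del: mult_FactGroup)
    then show "\<exists>i::int. \<exists>m\<in>M. g \<otimes> c \<otimes> inv g = c [^] (1 + int p * i) \<otimes> m"
      using g cc by (subst (asm) M.coset_eq_iff) auto
  qed
qed

text \<open>Exact cyclicity of the commutators is the case of trivial \<open>M\<close>. The modulus
  \<open>p\<close> in the conjugation exponent improves to \<open>q\<close> by repeating the
  centrality argument modulo \<open>c^q\<close>. Modulo \<open>c^p\<close> commutators are central
  of order dividing \<open>p\<close>, so there a product of \<open>q\<close>-th powers is a
  \<open>q\<close>-th power; this gives the root formula for \<open>c\<close>.\<close>

proposition powerful_p_group_two_generators: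
  fixes p q :: nat
  assumes p: "prime p" and ord: "order G = p ^ n"
    and q: "q = (if p = 2 then 4 else p)"
    and xy: "x \<in> carrier G" "y \<in> carrier G" and c: "c = \<lbrakk>x,y\<rbrakk>"
    and gen: "generate G {x, y} = carrier G"
    and pow: "\<And>u v. u \<in> carrier G \<Longrightarrow> v \<in> carrier G \<Longrightarrow> \<lbrakk>u,v\<rbrakk> \<in> generate G {h [^] q | h. h \<in> carrier G}"
  shows "\<And>u v. u \<in> carrier G \<Longrightarrow> v \<in> carrier G \<Longrightarrow> \<exists>k::int. \<lbrakk>u,v\<rbrakk> = c [^] k"
    and "\<And>g. g \<in> carrier G \<Longrightarrow> \<exists>i::int. g \<otimes> c \<otimes> inv g = c [^] (1 + int q * i)"
    and "\<exists>(i::int) (j::int) (k::int) (l::int). c = (x [^] i \<otimes> y [^] j \<otimes> c [^] k) [^] q \<otimes> c [^] (int p * l)"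
proof -
  have cc: "c \<in> carrier G" using xy c by simp
  have pq: "p dvd q" using q by auto
  have pt: "p dvd (\<Sum>i<q. i)" using dvd_sum_lessThan[OF p] q by simp
  note one = derived_cyclic_mod[OF p ord pq pt xy c gen pow one_is_normal]
  show D: "\<exists>k::int. \<lbrakk>u,v\<rbrakk> = c [^] k" if uv: "u \<in> carrier G" "v \<in> carrier G" for u v
  proof -
    obtain k :: int where "\<lbrakk>u,v\<rbrakk> = c [^] k \<otimes> \<one>" using one uv by blast
    then show ?thesis using cc by auto
  qed
  have A: "\<exists>i::int. g \<otimes> c \<otimes> inv g = c [^] (1 + int p * i)" if g: "g \<in> carrier G" for g
  proof -
    obtain i :: int where "g \<otimes> c \<otimes> inv g = c [^] (1 + int p * i) \<otimes> \<one>" using one g by blast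
    then show ?thesis using cc by auto
  qed
  have powN: "generate G {c [^] r} \<lhd> G" for r :: nat
  proof (rule cyclic_normalI)
    fix g assume g: "g \<in> carrier G"
    obtain i :: int where i: "g \<otimes> c \<otimes> inv g = c [^] (1 + int p * i)" using A g by blast
    have "g \<otimes> c [^] int r \<otimes> inv g = (c [^] int r) [^] (1 + int p * i)"
      using conj_pow_of_conj_pow[OF g cc i] cc by (simp only: int_pow_pow mult.commute)
    then show "\<exists>l::int. g \<otimes> c [^] r \<otimes> inv g = (c [^] r) [^] l" by (auto simp: int_pow_int)
  qed (use cc in simp)
  have inN: "b \<in> generate G {c [^] r} \<longleftrightarrow> (\<exists>k::int. b = c [^] (int r * k))" for b and r :: nat
    using cc generate_pow[of "c [^] r"] by (auto simp: int_pow_int[symmetric] int_pow_pow)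
  show "\<exists>i::int. g \<otimes> c \<otimes> inv g = c [^] (1 + int q * i)" if g: "g \<in> carrier G" for g
  proof -
    interpret N: normal "generate G {c [^] q}" G by (rule powN)
    \<comment> \<open>With an exact eigenvalue \<open>l\<close> of \<open>h\<close> on
      \<open>c\<close>, the exponent of this commutator is a multiple of
      \<open>1 + l + ... + l^(q-1)\<close>, which \<open>q\<close> divides.\<close>
    have hq: "\<lbrakk>h [^] q, v\<rbrakk> \<in> generate G {c [^] q}" if h: "h \<in> carrier G" and v: "v \<in> carrier G" for h v
    proof -
      obtain k :: int where k: "\<lbrakk>h,v\<rbrakk> = c [^] k" using D[OF h v] by blast
      obtain i :: int where i: "h \<otimes> c \<otimes> inv h = c [^] (1 + int p * i)" using A h by blast
      let ?l = "1 + int p * i"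
      have *: "\<lbrakk>h [^] (n::nat), v\<rbrakk> = c [^] (k * (\<Sum>i<n. ?l ^ i))" for n
      proof (induction n)
        case 0
        show ?case using h v by (simp add: group_commutator_def)
      next
        case (Suc n)
        have s: "(\<Sum>i<Suc n. ?l ^ i) = ?l * (\<Sum>i<n. ?l ^ i) + 1"
          by (subst sum.lessThan_Suc_shift) (simp add: sum_distrib_left)
        have "\<lbrakk>h [^] Suc n, v\<rbrakk> = \<lbrakk>h \<otimes> h [^] n, v\<rbrakk>" using h by (metis nat_pow_Suc2)
        also have "\<dots> = h \<otimes> c [^] (k * (\<Sum>i<n. ?l ^ i)) \<otimes> inv h \<otimes> c [^] k"
          using h v commutator_mult_left Suc k by simp
        also have "\<dots> = c [^] (?l * (k * (\<Sum>i<n. ?l ^ i)) + k)"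
          using conj_pow_of_conj_pow[OF h cc i] cc by (simp only: int_pow_mult)
        also have "?l * (k * (\<Sum>i<n. ?l ^ i)) + k = k * (\<Sum>i<Suc n. ?l ^ i)"
          unfolding s by (simp add: algebra_simps)
        finally show ?case .
      qed
      have "int q dvd (\<Sum>i<q. ?l ^ i)"
        using geometric_sum_dvd[OF p, of ?l] q by (simp add: cong_def)
      then show ?thesis unfolding * inN by (metis dvd_def dvd_mult)
    qed
    have "generate G {h [^] q | h. h \<in> carrier G} \<subseteq> {u \<in> carrier G. \<forall>v\<in>carrier G. \<lbrakk>u,v\<rbrakk> \<in> generate G {c [^] q}}"
      using hq by (intro generate_subgroup_incl N.centralizer_mod_subgroup) auto
    then have "\<lbrakk>c,g\<rbrakk> \<in> generate G {c [^] q}" using pow[OF xy] c g by blast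
    then have "\<lbrakk>g,c\<rbrakk> \<in> generate G {c [^] q}" using N.commutator_swap_in cc g by blast
    then obtain i :: int where "\<lbrakk>g,c\<rbrakk> = c [^] (int q * i)" using inN by blast
    then have "g \<otimes> c \<otimes> inv g = c [^] (1 + int q * i)"
      using conj_eq_commutator_mult[OF g cc] int_pow_mult[OF cc, of "int q * i" 1] cc
      by (simp add: add.commute[of 1])
    then show ?thesis by blast
  qed
  interpret N: normal "generate G {c [^] p}" G by (rule powN)
  have eN: "\<lbrakk>g, \<lbrakk>u,v\<rbrakk>\<rbrakk> \<in> generate G {c [^] p}" if guv: "g \<in> carrier G" "u \<in> carrier G" "v \<in> carrier G" for g u v
  proof -
    obtain k :: int where k: "\<lbrakk>u,v\<rbrakk> = c [^] k" using D[OF guv(2,3)] by blast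
    obtain i :: int where i: "g \<otimes> c \<otimes> inv g = c [^] (1 + int p * i)" using A[OF guv(1)] by blast
    have "\<lbrakk>g, \<lbrakk>u,v\<rbrakk>\<rbrakk> = (g \<otimes> c [^] k \<otimes> inv g) \<otimes> inv (c [^] k)"
      unfolding k by (simp add: group_commutator_def)
    also have "\<dots> = c [^] ((1 + int p * i) * k - k)"
      using conj_pow_of_conj_pow[OF guv(1) cc i] cc by (simp only: int_pow_diff)
    also have "(1 + int p * i) * k - k = int p * (i * k)" by (simp add: algebra_simps)
    finally show ?thesis unfolding inN by blast
  qed
  \<comment> \<open>Modulo \<open>c^p\<close> the set of \<open>q\<close>-th powers is closed under
    products: the correction \<open>[h2,h1]^(q(q-1)/2)\<close> is a power of
    \<open>c^p\<close>.\<close>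
  have "\<exists>h\<in>carrier G. \<exists>z\<in>generate G {c [^] p}. w = h [^] q \<otimes> z"
    if "w \<in> generate G {h [^] q | h. h \<in> carrier G}" for w
    using that
  proof (induction w rule: generate.induct)
    case one
    show ?case using N.one_closed by (intro bexI[of _ "\<one>"]) auto
  next
    case (incl h)
    then obtain h' where "h' \<in> carrier G" "h = h' [^] q" by blast
    then show ?case using N.one_closed by (intro bexI[of _ h'] bexI[of _ "\<one>"]) auto
  next
    case (inv h)
    then obtain h' where "h' \<in> carrier G" "h = h' [^] q" by blast
    then have "inv h = (inv h') [^] q \<otimes> \<one>" "inv h' \<in> carrier G" by (simp_all add: nat_pow_inv)
    then show ?case using N.one_closed by blast
  next
    case (eng w1 w2)
    then obtain h1 z1 h2 z2 where h: "h1 \<in> carrier G" "z1 \<in> generate G {c [^] p}" "w1 = h1 [^] q \<otimes> z1"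
      "h2 \<in> carrier G" "z2 \<in> generate G {c [^] p}" "w2 = h2 [^] q \<otimes> z2" by blast
    have z: "z1 \<in> carrier G" "z2 \<in> carrier G" using h N.subset by auto
    have "\<exists>z\<in>generate G {c [^] p}. (h1 \<otimes> h2) [^] q = h1 [^] q \<otimes> h2 [^] q \<otimes> \<lbrakk>h2,h1\<rbrakk> [^] (\<Sum>i<q. i) \<otimes> z"
      using h eN by (intro N.pow_mult_class_two_mod) auto
    then obtain z3 where z3: "z3 \<in> generate G {c [^] p}"
      "(h1 \<otimes> h2) [^] q = h1 [^] q \<otimes> h2 [^] q \<otimes> \<lbrakk>h2,h1\<rbrakk> [^] (\<Sum>i<q. i) \<otimes> z3" by blast
    define e where "e = \<lbrakk>h2,h1\<rbrakk> [^] (\<Sum>i<q. i)"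
    have e: "e \<in> generate G {c [^] p}"
    proof -
      obtain k :: int where k: "\<lbrakk>h2,h1\<rbrakk> = c [^] k" using D[OF h(4,1)] by blast
      obtain s where s: "(\<Sum>i<q. i) = p * s" using pt by (metis dvdE)
      have "e = (c [^] k) [^] int (p * s)" unfolding e_def k s by (simp only: int_pow_int)
      also have "\<dots> = c [^] (int p * (int s * k))" using cc by (simp add: int_pow_pow algebra_simps)
      finally show ?thesis using inN by blast
    qed
    have car: "e \<in> carrier G" "z3 \<in> carrier G" using e z3(1) N.subset by auto
    let ?z = "inv z3 \<otimes> inv e \<otimes> (inv (h2 [^] q) \<otimes> z1 \<otimes> h2 [^] q) \<otimes> z2"
    have "?z \<in> generate G {c [^] p}"
      using e z3(1) h N.inv_op_closed1 by simp
    moreover have "w1 \<otimes> w2 = (h1 \<otimes> h2) [^] q \<otimes> ?z"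
      unfolding z3(2) e_def[symmetric] h using h(1,4) z car by (simp add: word_simps)
    ultimately show ?case using h(1,4) by blast
  qed
  then obtain h z where hz: "h \<in> carrier G" "z \<in> generate G {c [^] p}" "c = h [^] q \<otimes> z"
    using pow[OF xy] c by blast
  obtain i j k :: int where "h = x [^] i \<otimes> y [^] j \<otimes> c [^] k"
    using generate_pairE[OF xy cc D, of h] gen hz(1) by auto
  moreover obtain l :: int where "z = c [^] (int p * l)" using hz(2) inN by blast
  ultimately show "\<exists>(i::int) (j::int) (k::int) (l::int). c = (x [^] i \<otimes> y [^] j \<otimes> c [^] k) [^] q \<otimes> c [^] (int p * l)"
    using hz(3) by blast
qed

end

section \<open>Sequences of integers representing \<open>p\<close>-adic integers\<close>

text \<open>A p-adic integer given by any compatible integers, not only by reduced residues as in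
  \<open>padic_int\<close>. Arithmetic is then plain pointwise integer arithmetic, and equality
  becomes \<open>padic_eq\<close>.\<close>

definition coherent :: "nat \<Rightarrow> (nat \<Rightarrow> int) \<Rightarrow> bool" where
  "coherent p a \<longleftrightarrow> (\<forall>n. [a (Suc n) = a n] (mod int p ^ n))"

definition padic_eq :: "nat \<Rightarrow> (nat \<Rightarrow> int) \<Rightarrow> (nat \<Rightarrow> int) \<Rightarrow> bool" where
  "padic_eq p a b \<longleftrightarrow> (\<forall>n. [a n = b n] (mod int p ^ n))"

lemma coherent_le:
  assumes "coherent p a" "m \<le> n"
  shows "[a n = a m] (mod int p ^ m)"
  using assms(2)
proof (induction n rule: dec_induct)
  case (step n)
  have "[a (Suc n) = a n] (mod int p ^ n)" using assms(1) by (simp add: coherent_def)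
  then have "[a (Suc n) = a n] (mod int p ^ m)"
    using step(1) by (meson cong_dvd_modulus le_imp_power_dvd)
  then show ?case using step.IH cong_trans by blast
qed simp

lemma coherent_const [simp]: "coherent p (\<lambda>_. k)"
  by (simp add: coherent_def)

lemma coherent_add [simp]: "coherent p a \<Longrightarrow> coherent p b \<Longrightarrow> coherent p (\<lambda>n. a n + b n)"
  by (simp add: coherent_def cong_add)

lemma coherent_diff [simp]: "coherent p a \<Longrightarrow> coherent p b \<Longrightarrow> coherent p (\<lambda>n. a n - b n)"
  by (simp add: coherent_def cong_diff)

lemma coherent_mult [simp]: "coherent p a \<Longrightarrow> coherent p b \<Longrightarrow> coherent p (\<lambda>n. a n * b n)"
  by (simp add: coherent_def cong_mult)

lemma coherent_uminus [simp]: "coherent p a \<Longrightarrow> coherent p (\<lambda>n. - a n)"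
  by (simp add: coherent_def cong_minus_minus_iff)

lemma coherent_power [simp]: "coherent p a \<Longrightarrow> coherent p (\<lambda>n. a n ^ k)"
  by (simp add: coherent_def cong_pow)

lemma coherent_sum [simp]:
  "(\<And>i. i \<in> I \<Longrightarrow> coherent p (a i)) \<Longrightarrow> coherent p (\<lambda>n. \<Sum>i\<in>I. a i n)"
  by (simp add: coherent_def cong_sum)

lemma padic_eq_sym: "padic_eq p a b \<Longrightarrow> padic_eq p b a"
  by (simp add: padic_eq_def cong_sym)

lemma padic_eq_trans: "padic_eq p a b \<Longrightarrow> padic_eq p b c \<Longrightarrow> padic_eq p a c"
  unfolding padic_eq_def using cong_trans by blast

lemma padic_eq_diff_0: "padic_eq p (\<lambda>n. a n - b n) (\<lambda>_. 0) \<longleftrightarrow> padic_eq p a b"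
  by (simp add: padic_eq_def cong_diff_iff_cong_0)

lemma coherent_inverse:
  assumes p: "prime p" and a: "coherent p a" and u: "\<not> int p dvd a 1"
  shows "\<exists>b. coherent p b \<and> padic_eq p (\<lambda>n. a n * b n) (\<lambda>_. 1)"
proof -
  have cop: "coprime (a n) (int p ^ n)" for n
  proof (cases "n = 0")
    case False
    have "[a n = a 1] (mod int p)" using coherent_le[OF a, of 1 n] False by simp
    then have "\<not> int p dvd a n" using u by (simp add: cong_dvd_iff)
    moreover have "prime (int p)" using p by simp
    ultimately have "coprime (int p) (a n)" by (metis prime_imp_coprime)
    then show ?thesis by (simp add: coprime_commute)
  qed simp
  then have "\<exists>b. [a n * b = 1] (mod int p ^ n)" for n by (rule cong_solve_coprime_int)
  then obtain b where b: "[a n * b n = 1] (mod int p ^ n)" for n by metis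
  have "[b (Suc n) = b n] (mod int p ^ n)" for n
  proof -
    have "[a n * b (Suc n) = a (Suc n) * b (Suc n)] (mod int p ^ n)"
      using a by (intro cong_mult cong_refl) (simp add: coherent_def cong_sym)
    also have "[a (Suc n) * b (Suc n) = 1] (mod int p ^ n)"
      using b[of "Suc n"] by (rule cong_dvd_modulus) (simp add: le_imp_power_dvd)
    also have "[1 = a n * b n] (mod int p ^ n)" using b by (rule cong_sym)
    finally show ?thesis using cop by (metis cong_mult_lcancel)
  qed
  then show ?thesis using b unfolding coherent_def padic_eq_def by blast
qed

lemma coherent_divide:
  assumes p: "p > 0" and a: "coherent p a" and d: "int p ^ m dvd a m"
  shows "\<exists>b. coherent p b \<and> padic_eq p a (\<lambda>n. int p ^ m * b n)"
proof -
  \<comment> \<open>Division by \<open>p^m\<close> loses \<open>m\<close> digits of precision, so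
    the \<open>n\<close>-th approximation is taken from index \<open>n + m\<close>.\<close>
  define b where "b n = a (n + m) div int p ^ m" for n
  have "[a (n + m) = a m] (mod int p ^ m)" for n by (rule coherent_le[OF a]) simp
  then have "int p ^ m dvd a (n + m)" for n using d cong_dvd_iff by blast
  then have b: "a (n + m) = int p ^ m * b n" for n by (simp add: b_def)
  have "coherent p b"
    unfolding coherent_def
  proof
    fix n
    have "int p ^ (n + m) dvd a (Suc n + m) - a (n + m)"
      using a by (simp add: coherent_def cong_iff_dvd_diff)
    then have "int p ^ m * int p ^ n dvd int p ^ m * (b (Suc n) - b n)"
      unfolding b by (simp add: power_add algebra_simps)
    then show "[b (Suc n) = b n] (mod int p ^ n)" using p by (simp add: cong_iff_dvd_diff)
  qed
  moreover have "padic_eq p a (\<lambda>n. int p ^ m * b n)"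
    unfolding padic_eq_def b[symmetric] using coherent_le[OF a] by (simp add: cong_sym)
  ultimately show ?thesis by blast
qed

text \<open>A nonzero p-adic integer is a power of \<open>p\<close> times a unit. In this form a
  statement about a nonzero exponent reduces to one about the exponent \<open>p^m\<close>.\<close>

lemma coherent_nonzero_associate:
  assumes p: "prime p" and a: "coherent p a" and nz: "\<not> padic_eq p a (\<lambda>_. 0)"
  shows "\<exists>b m. coherent p b \<and> padic_eq p (\<lambda>n. a n * b n) (\<lambda>_. int p ^ m)"
proof -
  have pp: "prime (int p)" using p by simp
  obtain N where N: "\<not> int p ^ N dvd a N" using nz by (auto simp: padic_eq_def cong_0_iff)
  define m where "m = multiplicity (int p) (a N)"
  have aN: "a N \<noteq> 0" using N by auto
  have mN: "m < N" using N unfolding m_def by (metis multiplicity_dvd' not_le)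
  have "[a N = a m] (mod int p ^ m)" "[a N = a (Suc m)] (mod int p ^ Suc m)"
    using mN by (intro coherent_le[OF a]; simp)+
  moreover have "int p ^ m dvd a N" "\<not> int p ^ Suc m dvd a N"
    using power_dvd_iff_le_multiplicity[OF aN, of "int p"] pp not_prime_unit
    unfolding m_def by (blast, metis Suc_n_not_le_n)
  ultimately have val: "int p ^ m dvd a m" "\<not> int p ^ Suc m dvd a (Suc m)"
    using cong_dvd_iff by blast+
  obtain a' where a': "coherent p a'" "padic_eq p a (\<lambda>n. int p ^ m * a' n)"
    using coherent_divide[OF prime_gt_0_nat[OF p] a val(1)] by blast
  have "\<not> int p dvd a' 1"
  proof
    assume "int p dvd a' 1"
    moreover have "[a' (Suc m) = a' 1] (mod int p)" using coherent_le[OF a'(1), of 1 "Suc m"] by simp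
    ultimately have "int p dvd a' (Suc m)" using cong_dvd_iff by blast
    then have "int p ^ Suc m dvd int p ^ m * a' (Suc m)" by (simp add: mult.commute mult_dvd_mono)
    moreover have "[a (Suc m) = int p ^ m * a' (Suc m)] (mod int p ^ Suc m)"
      using a'(2) unfolding padic_eq_def by blast
    ultimately show False using val(2) cong_dvd_iff by blast
  qed
  then obtain b where b: "coherent p b" "padic_eq p (\<lambda>n. a' n * b n) (\<lambda>_. 1)"
    using coherent_inverse[OF p a'(1)] by blast
  have "[a n * b n = int p ^ m] (mod int p ^ n)" for n
  proof -
    have "[a n * b n = int p ^ m * a' n * b n] (mod int p ^ n)"
      using a'(2) by (intro cong_mult cong_refl) (simp add: padic_eq_def)
    also have "int p ^ m * a' n * b n = int p ^ m * (a' n * b n)" by simp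
    also have "[\<dots> = int p ^ m * 1] (mod int p ^ n)"
      using b(2) by (intro cong_mult cong_refl) (simp add: padic_eq_def)
    finally show ?thesis by simp
  qed
  then show ?thesis using b(1) unfolding padic_eq_def by blast
qed

section \<open>One-units of the p-adic integers\<close>

lemma sum_powers_cong:
  fixes u :: int
  assumes p: "prime p" and u: "[u = 1] (mod int (if p = 2 then 4 else p))"
  shows "[(\<Sum>i<p. u ^ i) = int p] (mod (int p)\<^sup>2)"
proof (cases "p = 2")
  case True
  then have "[1 + u = 1 + 1] (mod 4)" using u by (intro cong_add cong_refl) simp
  then show ?thesis using True by (simp add: eval_nat_numeral)
next
  case False
  then obtain w where w: "u = 1 + int p * w" using u by (auto simp: cong_iff_dvd_diff dvd_def algebra_simps)
  \<comment> \<open>First-order expansion. The linear terms add up to \<open>p w\<close> times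
    \<open>0 + 1 + ... + (p-1)\<close>, a multiple of \<open>p^2\<close> for odd
    \<open>p\<close>.\<close>
  have pw: "[u ^ i = 1 + int i * int p * w] (mod (int p)\<^sup>2)" for i
  proof (induction i)
    case (Suc i)
    have "[u ^ Suc i = (1 + int p * w) * (1 + int i * int p * w)] (mod (int p)\<^sup>2)"
      using Suc w by (simp add: cong_mult)
    also have "(1 + int p * w) * (1 + int i * int p * w) = (1 + int (Suc i) * int p * w) + (int p)\<^sup>2 * (int i * w\<^sup>2)"
      by (simp add: algebra_simps power2_eq_square)
    also have "[\<dots> = 1 + int (Suc i) * int p * w] (mod (int p)\<^sup>2)" by (simp add: cong_def)
    finally show ?case .
  qed simp
  obtain s where s: "(\<Sum>i<p. i) = p * s" using dvd_sum_lessThan[OF p] False by (auto elim: dvdE)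
  have "[(\<Sum>i<p. u ^ i) = (\<Sum>i<p. 1 + int i * int p * w)] (mod (int p)\<^sup>2)"
    by (intro cong_sum pw)
  also have "(\<Sum>i<p. 1 + int i * int p * w) = int p + int (\<Sum>i<p. i) * (int p * w)"
    by (simp add: sum.distrib sum_distrib_right mult.assoc)
  also have "\<dots> = int p + (int p)\<^sup>2 * (int s * w)" unfolding s by (simp add: power2_eq_square algebra_simps)
  also have "[\<dots> = int p] (mod (int p)\<^sup>2)" by (simp add: cong_def)
  finally show ?thesis .
qed

lemma sum_powers_factor:
  fixes u :: int
  assumes p: "prime p" and u: "[u = 1] (mod int (if p = 2 then 4 else p))"
  obtains t where "(\<Sum>i<p. u ^ i) = int p * t" "\<not> int p dvd t"
proof -
  have p0: "int p \<noteq> 0" using p by (auto simp: prime_gt_0_nat)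
  have c: "(int p)\<^sup>2 dvd (\<Sum>i<p. u ^ i) - int p" using sum_powers_cong[OF assms] by (simp add: cong_iff_dvd_diff)
  then obtain r where r: "(\<Sum>i<p. u ^ i) - int p = (int p)\<^sup>2 * r" by (elim dvdE)
  have "(\<Sum>i<p. u ^ i) = int p * (1 + int p * r)" using r by (simp add: algebra_simps power2_eq_square)
  moreover have "\<not> int p dvd 1 + int p * r"
    using p by (metis dvd_add_left_iff dvd_triv_left int_dvd_int_iff not_prime_unit of_nat_1)
  ultimately show ?thesis using that by blast
qed

text \<open>Lifting the exponent: \<open>v^p - 1\<close> is \<open>v - 1\<close> times
  \<open>1 + v + ... + v^(p-1)\<close>, and the second factor has valuation exactly 1. For
  \<open>p = 2\<close> this needs \<open>v\<close> to be 1 modulo 4, whence the bound on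
  \<open>m\<close>.\<close>

lemma power_p_power_minus_one:
  fixes u w :: int
  assumes p: "prime p" and u: "u = 1 + int p ^ m * w" "\<not> int p dvd w" and m: "m \<ge> (if p = 2 then 2 else 1)"
  shows "\<exists>w'. u ^ (p ^ k) = 1 + int p ^ (m + k) * w' \<and> \<not> int p dvd w'"
proof (induction k)
  case (Suc k)
  then obtain w' where w': "u ^ (p ^ k) = 1 + int p ^ (m + k) * w'" "\<not> int p dvd w'" by blast
  let ?v = "u ^ (p ^ k)"
  have "int (if p = 2 then 4 else p) dvd int p ^ (m + k)"
    using m le_imp_power_dvd[of 2 "m + k" "2::int"] le_imp_power_dvd[of 1 "m + k" "int p"] by (auto split: if_splits)
  then have "[?v = 1] (mod int (if p = 2 then 4 else p))" using w' by (simp add: cong_iff_dvd_diff)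
  then obtain t where t: "(\<Sum>i<p. ?v ^ i) = int p * t" "\<not> int p dvd t" by (rule sum_powers_factor[OF p])
  have "u ^ (p ^ Suc k) - 1 = ?v ^ p - 1" by (simp add: power_mult[symmetric] mult.commute)
  also have "\<dots> = (?v - 1) * (\<Sum>i<p. ?v ^ i)" by (rule power_diff_1_eq)
  also have "\<dots> = int p ^ (m + Suc k) * (w' * t)" using w' t by simp
  finally have "u ^ (p ^ Suc k) = 1 + int p ^ (m + Suc k) * (w' * t)" by simp
  moreover have "\<not> int p dvd w' * t" using w'(2) t(2) p by (simp add: prime_dvd_mult_iff)
  ultimately show ?case by blast
qed (use u in auto)

text \<open>The group \<open>1 + p^m \<int>_p\<close> is procyclic, and any \<open>u\<close> of
  exact level \<open>m\<close> generates it. An exponent that is right modulo \<open>p^(m+k)\<close>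
  is corrected by a multiple of \<open>p^k\<close>, since \<open>u^(p^k)\<close> has exact level
  \<open>m + k\<close>.\<close>

lemma cong_power_of_one_unit:
  fixes u v :: int
  assumes p: "prime p" and u: "u = 1 + int p ^ m * w" "\<not> int p dvd w" and m: "m \<ge> (if p = 2 then 2 else 1)"
    and v: "[v = 1] (mod int p ^ m)"
  shows "\<exists>i::nat. [v = u ^ i] (mod int p ^ n)"
proof (cases "n \<le> m")
  case True
  have "[v = 1] (mod int p ^ n)" using v by (rule cong_dvd_modulus) (simp add: True le_imp_power_dvd)
  then show ?thesis by (intro exI[of _ 0]) simp
next
  case False
  have "\<exists>i::nat. [v = u ^ i] (mod int p ^ (m + k))" for k
  proof (induction k)
    case 0
    show ?case using v by (intro exI[of _ 0]) simp
  next
    case (Suc k)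
    let ?n = "m + k"
    obtain i :: nat where "[v = u ^ i] (mod int p ^ ?n)" using Suc by blast
    then obtain t where t: "v = u ^ i + int p ^ ?n * t"
      by (auto simp: cong_iff_dvd_diff dvd_def algebra_simps)
    obtain w' where w': "u ^ (p ^ k) = 1 + int p ^ ?n * w'" "\<not> int p dvd w'"
      using power_p_power_minus_one[OF p u m] by blast
    have "coprime w' (int p)" using w'(2) p prime_imp_coprime[of "int p" w'] by (simp add: coprime_commute)
    then obtain s0 where s0: "[w' * s0 = 1] (mod int p)" using cong_solve_coprime_int by blast
    \<comment> \<open>The correction solves \<open>w' s = t\<close> modulo \<open>p\<close>. The
      accompanying factor \<open>u^i\<close> is harmless because \<open>u\<close> is 1 modulo
      \<open>p\<close>.\<close>
    define s where "s = nat ((s0 * t) mod int p)"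
    have "p > 0" using p by (simp add: prime_gt_0_nat)
    then have "int s = (s0 * t) mod int p" by (simp add: s_def)
    then have "[w' * int s = w' * (s0 * t)] (mod int p)" by (intro cong_mult cong_refl) (simp add: cong_def)
    also have "w' * (s0 * t) = (w' * s0) * t" by simp
    also have "[\<dots> = 1 * t] (mod int p)" using s0 by (intro cong_mult cong_refl)
    finally have s: "[w' * int s = t] (mod int p)" by simp
    have pn: "int p dvd int p ^ ?n" using m by (intro dvd_power) (auto split: if_splits)
    have u1: "[u = 1] (mod int p)"
      using u(1) m by (auto simp: cong_iff_dvd_diff dvd_power split: if_splits)
    have pw: "[(1 + int p ^ ?n * w') ^ j = 1 + int p ^ ?n * (w' * int j)] (mod int p ^ Suc ?n)" for j :: nat
    proof (induction j)
      case (Suc j)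
      have "[(1 + int p ^ ?n * w') ^ Suc j = (1 + int p ^ ?n * w') * (1 + int p ^ ?n * (w' * int j))] (mod int p ^ Suc ?n)"
        using Suc unfolding power_Suc by (intro cong_mult cong_refl)
      also have "(1 + int p ^ ?n * w') * (1 + int p ^ ?n * (w' * int j)) =
        1 + int p ^ ?n * (w' * int (Suc j)) + int p ^ ?n * (int p ^ ?n * (w' * w' * int j))"
        by (simp add: algebra_simps)
      also have "[\<dots> = 1 + int p ^ ?n * (w' * int (Suc j)) + 0] (mod int p ^ Suc ?n)"
      proof (intro cong_add cong_refl)
        have "int p ^ Suc ?n dvd int p ^ ?n * int p ^ ?n" using pn by (simp add: mult.commute)
        then show "[int p ^ ?n * (int p ^ ?n * (w' * w' * int j)) = 0] (mod int p ^ Suc ?n)"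
          unfolding cong_0_iff by (metis dvd_mult2 mult.assoc)
      qed
      finally show ?case by simp
    qed simp
    have "[u ^ (i + p ^ k * s) = u ^ i * (1 + int p ^ ?n * (w' * int s))] (mod int p ^ Suc ?n)"
      unfolding power_add[of u] power_mult[of u] w'(1) by (intro cong_mult cong_refl pw)
    also have "u ^ i * (1 + int p ^ ?n * (w' * int s)) = u ^ i + int p ^ ?n * (u ^ i * (w' * int s))"
      by (simp add: algebra_simps)
    also have "[\<dots> = u ^ i + int p ^ ?n * t] (mod int p ^ Suc ?n)"
    proof (intro cong_add cong_refl)
      have "[u ^ i * (w' * int s) = 1 ^ i * t] (mod int p)" by (intro cong_mult cong_pow u1 s)
      then have "int p dvd u ^ i * (w' * int s) - t" by (simp add: cong_iff_dvd_diff)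
      then have "int p ^ ?n * int p dvd int p ^ ?n * (u ^ i * (w' * int s) - t)" by (rule mult_dvd_mono[OF dvd_refl])
      then show "[int p ^ ?n * (u ^ i * (w' * int s)) = int p ^ ?n * t] (mod int p ^ Suc ?n)"
        by (simp add: cong_iff_dvd_diff algebra_simps)
    qed
    finally have "[v = u ^ (i + p ^ k * s)] (mod int p ^ Suc ?n)" using t by (simp add: cong_sym_eq)
    then show ?case by auto
  qed
  from this[of "n - m"] show ?thesis using False by simp
qed

text \<open>The closed subgroups of \<open>1 + q\<int>\<^sub>p\<close> form a chain.\<close>

lemma one_units_comparable:
  assumes p: "prime p" and u: "coherent p u" and v: "coherent p v"
    and u1: "[u 2 = 1] (mod int (if p = 2 then 4 else p))" and v1: "[v 2 = 1] (mod int (if p = 2 then 4 else p))"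
  shows "(\<forall>n. \<exists>i::nat. [v n = u n ^ i] (mod int p ^ n)) \<or> (\<forall>n. \<exists>i::nat. [u n = v n ^ i] (mod int p ^ n))"
proof -
  have main: "\<forall>n. \<exists>i::nat. [v n = u n ^ i] (mod int p ^ n)"
    if u: "coherent p u" and v: "coherent p v" and u1: "[u 2 = 1] (mod int (if p = 2 then 4 else p))"
    and N: "\<not> [u (Suc N) = 1] (mod int p ^ Suc N)" "\<And>k. k \<le> N \<Longrightarrow> [u k = 1] (mod int p ^ k) \<and> [v k = 1] (mod int p ^ k)" for u v N
  proof
    fix n
    \<comment> \<open>The entry of index 2 knows \<open>u\<close> modulo \<open>p^2\<close>, which
      is enough to read it modulo 4 for \<open>p = 2\<close> and modulo \<open>p\<close> otherwise.
      So the first deviation from 1 cannot come too early.\<close>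
    have Nm: "N \<ge> (if p = 2 then 2 else 1)"
    proof (rule ccontr)
      assume "\<not> ?thesis"
      then have l: "Suc N \<le> (if p = 2 then 2 else 1)" "Suc N \<le> 2" by (auto split: if_splits)
      have "int p ^ (if p = 2 then 2 else 1) = int (if p = 2 then 4 else p)" by simp
      then have "[u 2 = 1] (mod int p ^ Suc N)"
        using u1 l(1) by (metis cong_dvd_modulus le_imp_power_dvd)
      moreover have "[u 2 = u (Suc N)] (mod int p ^ Suc N)" using coherent_le[OF u l(2)] .
      ultimately show False using N(1) cong_trans cong_sym by blast
    qed
    let ?n = "max n (Suc N)"
    have uN: "[u ?n = u N] (mod int p ^ N)" "[u ?n = u (Suc N)] (mod int p ^ Suc N)" "[v ?n = v N] (mod int p ^ N)"
      by (rule coherent_le[OF u] coherent_le[OF v], simp)+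
    then have "[u ?n = 1] (mod int p ^ N)" using N(2)[of N] cong_trans by blast
    then obtain w where w: "u ?n = 1 + int p ^ N * w" by (auto simp: cong_iff_dvd_diff dvd_def algebra_simps)
    have "\<not> int p dvd w"
    proof
      assume "int p dvd w"
      then have "int p ^ N * int p dvd int p ^ N * w" by (rule mult_dvd_mono[OF dvd_refl])
      then have "[u ?n = 1] (mod int p ^ Suc N)" unfolding w by (simp add: cong_iff_dvd_diff mult.commute)
      then show False using N(1) uN(2) cong_trans cong_sym by blast
    qed
    moreover have "[v ?n = 1] (mod int p ^ N)" using N(2)[of N] uN(3) cong_trans by blast
    ultimately obtain i :: nat where i: "[v ?n = u ?n ^ i] (mod int p ^ n)"
      using cong_power_of_one_unit[OF p w _ Nm] by blast
    have "[v n = v ?n] (mod int p ^ n)" "[u n = u ?n] (mod int p ^ n)"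
      by (auto intro!: cong_sym[OF coherent_le[OF u]] cong_sym[OF coherent_le[OF v]])
    then have "[v n = u n ^ i] (mod int p ^ n)"
      using i cong_trans cong_sym cong_pow by meson
    then show "\<exists>i::nat. [v n = u n ^ i] (mod int p ^ n)" by blast
  qed
  show ?thesis
  proof (cases "\<forall>n. [u n = 1] (mod int p ^ n) \<and> [v n = 1] (mod int p ^ n)")
    case True
    then show ?thesis by (metis power_0)
  next
    case False
    let ?P = "\<lambda>n. \<not> ([u n = 1] (mod int p ^ n) \<and> [v n = 1] (mod int p ^ n))"
    \<comment> \<open>At the first level where one of the two sequences differs from 1, that one has
      exact level \<open>M - 1\<close> and therefore generates the other.\<close>
    define M where "M = (LEAST n. ?P n)"
    have M: "?P M" "\<And>k. k < M \<Longrightarrow> \<not> ?P k"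
      using False LeastI_ex[of ?P] not_less_Least[of _ ?P] unfolding M_def by blast+
    have "M \<noteq> 0" using M(1) by (metis cong_1 power_0)
    then obtain N where N: "M = Suc N" using not0_implies_Suc by blast
    have below: "[u k = 1] (mod int p ^ k)" "[v k = 1] (mod int p ^ k)" if "k \<le> N" for k
      using M(2)[of k] N that by auto
    show ?thesis
    proof (cases "[u (Suc N) = 1] (mod int p ^ Suc N)")
      case False
      then show ?thesis using main[OF u v u1, of N] below by blast
    next
      case True
      then have "\<not> [v (Suc N) = 1] (mod int p ^ Suc N)" using M(1) N by blast
      then show ?thesis using main[OF v u v1, of N] below by blast
    qed
  qed
qed

section \<open>Pro-\<open>p\<close> groups and \<open>p\<close>-adic powers\<close>

context topological_group
begin

lemma continuous_map_identity: "continuous_map T T (\<lambda>x. x)"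
  using continuous_map_id[of T] by (simp add: id_def)

lemma continuous_map_mult:
  assumes "continuous_map X T f" "continuous_map X T g"
  shows "continuous_map X T (\<lambda>x. f x \<otimes> g x)"
  using continuous_map_compose[OF continuous_map_pairedI[OF assms] continuous_mult]
  by (simp add: o_def)

lemma continuous_map_inv:
  "continuous_map X T f \<Longrightarrow> continuous_map X T (\<lambda>x. inv f x)"
  using continuous_map_compose[OF _ continuous_inv, of X f] by (simp add: o_def)

lemma continuous_map_const_carrier: "g \<in> carrier G \<Longrightarrow> continuous_map X T (\<lambda>x. g)"
  by (simp add: topspace_eq)

lemma continuous_map_nat_pow:
  assumes "continuous_map X T f"
  shows "continuous_map X T (\<lambda>x. f x [^] (n::nat))"
proof (induction n)
  case (Suc n)
  then show ?case using continuous_map_mult[OF Suc assms] by simp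
qed (simp add: topspace_eq)

lemma openin_translate:
  assumes "g \<in> carrier G" "openin T U"
  shows "openin T {u \<in> carrier G. u \<otimes> g \<in> U}" "openin T {u \<in> carrier G. g \<otimes> u \<in> U}"
proof -
  have "continuous_map T T (\<lambda>u. u \<otimes> g)" "continuous_map T T (\<lambda>u. g \<otimes> u)"
    using assms by (auto intro!: continuous_map_mult continuous_map_const_carrier continuous_map_identity)
  from this[THEN openin_continuous_map_preimage, OF assms(2)] show
    "openin T {u \<in> carrier G. u \<otimes> g \<in> U}" "openin T {u \<in> carrier G. g \<otimes> u \<in> U}"
    by (simp_all add: topspace_eq)
qed

lemma compactin_set_mult:
  assumes "compactin T A" "compactin T B"
  shows "compactin T (A <#> B)"
proof -
  have "compactin (prod_topology T T) (A \<times> B)" using assms by (simp add: compactin_Times)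
  then have "compactin T ((\<lambda>(x, y). x \<otimes> y) ` (A \<times> B))" using continuous_mult by (rule image_compactin)
  moreover have "(\<lambda>(x, y). x \<otimes> y) ` (A \<times> B) = A <#> B" by (auto simp: set_mult_def)
  ultimately show ?thesis by simp
qed

lemma compactin_pow_image:
  assumes "compactin T A"
  shows "compactin T ((\<lambda>x. x [^] (n::nat)) ` A)"
  using assms by (rule image_compactin) (auto intro: continuous_map_nat_pow continuous_map_identity)

lemma closure_of_subgroup:
  assumes "subgroup H G"
  shows "subgroup (T closure_of H) G"
proof
  have sub: "H \<subseteq> T closure_of H"
    using assms subgroup.subset closure_of_subset topspace_eq by metis
  show "T closure_of H \<subseteq> carrier G" using closure_of_subset_topspace topspace_eq by metis
  show "\<one> \<in> T closure_of H" using sub assms subgroup.one_closed by blast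
  show "inv x \<in> T closure_of H" if "x \<in> T closure_of H" for x
  proof -
    have "(\<lambda>x. inv x) ` (T closure_of H) \<subseteq> T closure_of ((\<lambda>x. inv x) ` H)"
      using continuous_inv by (rule continuous_map_image_closure_subset)
    moreover have "(\<lambda>x. inv x) ` H \<subseteq> H" using assms subgroup.m_inv_closed by fastforce
    ultimately show ?thesis using that closure_of_mono by blast
  qed
  show "x \<otimes> y \<in> T closure_of H" if "x \<in> T closure_of H" "y \<in> T closure_of H" for x y
  proof -
    have "(\<lambda>(x,y). x \<otimes> y) ` (prod_topology T T closure_of (H \<times> H)) \<subseteq> T closure_of ((\<lambda>(x,y). x \<otimes> y) ` (H \<times> H))"
      using continuous_mult by (rule continuous_map_image_closure_subset)
    moreover have "(\<lambda>(x,y). x \<otimes> y) ` (H \<times> H) \<subseteq> H" using assms subgroup.m_closed by fastforce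
    moreover have "(x, y) \<in> prod_topology T T closure_of (H \<times> H)" using that by (simp add: closure_of_Times)
    ultimately show ?thesis using closure_of_mono by (smt (verit) case_prod_conv image_subset_iff subset_iff)
  qed
qed

lemma closed_generate_subgroup:
  assumes "S \<subseteq> carrier G"
  shows "subgroup (closed_generate G T S) G" "closedin T (closed_generate G T S)" "S \<subseteq> closed_generate G T S"
proof -
  show "subgroup (closed_generate G T S) G"
    unfolding closed_generate_def by (intro closure_of_subgroup generate_is_subgroup assms)
  show "closedin T (closed_generate G T S)" by (simp add: closed_generate_def)
  have "S \<subseteq> generate G S" using generate.incl by fast
  also have "\<dots> \<subseteq> closed_generate G T S"
    unfolding closed_generate_def using generate_incl[OF assms] by (intro closure_of_subset) (simp add: topspace_eq)
  finally show "S \<subseteq> closed_generate G T S" .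
qed

lemma closed_generate_minimal:
  assumes "subgroup H G" "closedin T H" "S \<subseteq> H"
  shows "closed_generate G T S \<subseteq> H"
  unfolding closed_generate_def
  using generate_subgroup_incl[OF assms(3,1)] assms(2) by (rule closure_of_minimal)

end

section \<open>Open normal subgroups and the definition of p-adic powers\<close>

locale pro_p_group_prime = pro_p_group p G T
  for p :: nat and G :: "('a, 'b) monoid_scheme" (structure) and T :: "'a topology" +
  assumes prime: "prime p"
begin

definition open_normal :: "'a set \<Rightarrow> bool" where
  "open_normal N \<longleftrightarrow> N \<lhd> G \<and> openin T N"

lemma open_normal_normal: "open_normal N \<Longrightarrow> N \<lhd> G"
  by (simp add: open_normal_def)

text \<open>The subgroup wanted is the normal core of an open subgroup. By compactness finitely many
  cosets cover the group, so finitely many conjugates suffice in the intersection and the core is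
  open.\<close>

lemma ex_open_normal_subset:
  assumes "openin T U" "\<one> \<in> U"
  shows "\<exists>N. open_normal N \<and> N \<subseteq> U"
proof -
  obtain H where H: "subgroup H G" "openin T H" "H \<subseteq> U" using open_subgroup_base assms by blast
  interpret H: subgroup H G by fact
  define N where "N = {x \<in> carrier G. \<forall>g\<in>carrier G. g \<otimes> x \<otimes> inv g \<in> H}"
  let ?C = "\<lambda>g. {u \<in> carrier G. u \<otimes> inv g \<in> H}"
  have "\<exists>\<F>. finite \<F> \<and> \<F> \<subseteq> ?C ` carrier G \<and> topspace T \<subseteq> \<Union>\<F>"
  proof (rule compactinD)
    show "compactin T (topspace T)" using compact by (simp add: compact_space_def)
    show "\<And>U. U \<in> ?C ` carrier G \<Longrightarrow> openin T U" using openin_translate(1) H(2) by auto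
    show "topspace T \<subseteq> \<Union>(?C ` carrier G)" by (auto simp: topspace_eq intro!: bexI)
  qed
  then obtain R where R: "finite R" "R \<subseteq> carrier G" "carrier G \<subseteq> (\<Union>g\<in>R. ?C g)"
    by (metis (no_types, lifting) finite_subset_image topspace_eq)
  have N_R: "N = carrier G \<inter> (\<Inter>g\<in>R. {x \<in> carrier G. g \<otimes> x \<otimes> inv g \<in> H})"
  proof (intro equalityI subsetI)
    fix x assume x: "x \<in> carrier G \<inter> (\<Inter>g\<in>R. {x \<in> carrier G. g \<otimes> x \<otimes> inv g \<in> H})"
    have "g \<otimes> x \<otimes> inv g \<in> H" if g: "g \<in> carrier G" for g
    proof -
      obtain r where r: "r \<in> R" "g \<otimes> inv r \<in> H" using R(3) g by blast
      have rc: "r \<in> carrier G" using r R by auto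
      have "g \<otimes> x \<otimes> inv g = (g \<otimes> inv r) \<otimes> (r \<otimes> x \<otimes> inv r) \<otimes> inv (g \<otimes> inv r)"
        using g rc x by (simp add: word_simps)
      moreover have "r \<otimes> x \<otimes> inv r \<in> H" using x r by auto
      ultimately show ?thesis using r by simp
    qed
    then show "x \<in> N" using x by (simp add: N_def)
  qed (use R(2) in \<open>auto simp: N_def\<close>)
  have "openin T N"
  proof -
    have "openin T {x \<in> carrier G. g \<otimes> x \<otimes> inv g \<in> H}" if "g \<in> carrier G" for g
    proof -
      have "continuous_map T T (\<lambda>x. g \<otimes> x \<otimes> inv g)"
        using that by (intro continuous_map_mult continuous_map_const_carrier continuous_map_identity) auto
      from openin_continuous_map_preimage[OF this H(2)] show ?thesis by (simp add: topspace_eq)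
    qed
    then have "openin T (topspace T \<inter> (\<Inter>g\<in>R. {x \<in> carrier G. g \<otimes> x \<otimes> inv g \<in> H}))"
      using R by (cases "R = {}") (auto intro!: openin_Int openin_INT2)
    then show ?thesis using N_R topspace_eq by simp
  qed
  moreover have "N \<lhd> G"
    unfolding normal_iff_conj
  proof (intro conjI ballI)
    show "subgroup N G"
    proof
      fix x y assume "x \<in> N" "y \<in> N"
      then show "x \<otimes> y \<in> N" by (auto simp: N_def conj_mult simp del: m_assoc)
    next
      fix x assume "x \<in> N"
      then show "inv x \<in> N" by (auto simp: N_def conj_inv)
    qed (auto simp: N_def)
    fix g x assume "g \<in> carrier G" "x \<in> N"
    then show "g \<otimes> x \<otimes> inv g \<in> N" by (auto simp: N_def conj_conj)
  qed
  moreover have "N \<subseteq> U"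
  proof
    fix x assume "x \<in> N"
    then have "\<one> \<otimes> x \<otimes> inv \<one> \<in> H" "x \<in> carrier G" unfolding N_def by blast+
    then show "x \<in> U" using H by auto
  qed
  ultimately show ?thesis by (auto simp: open_normal_def)
qed

lemma open_normal_order: "open_normal N \<Longrightarrow> \<exists>k. order (G Mod N) = p ^ k"
  using open_normal_index by (auto simp: open_normal_def order_def FactGroup_def)

text \<open>The precision needed modulo \<open>N\<close>: integers congruent modulo
  \<open>p^k\<close> give powers in the same coset of \<open>N\<close>.\<close>

definition exponent_mod :: "'a set \<Rightarrow> nat \<Rightarrow> bool" where
  "exponent_mod N k \<longleftrightarrow> (\<forall>x\<in>carrier G. x [^] (p ^ k) \<in> N)"

lemma ex_exponent_mod:
  assumes "open_normal N"
  shows "\<exists>k. exponent_mod N k"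
proof -
  interpret N: normal N G using assms by (rule open_normal_normal)
  interpret Q: group "G Mod N" by (rule N.factorgroup_is_group)
  obtain k where k: "order (G Mod N) = p ^ k" using open_normal_order assms by blast
  have "x [^] (p ^ k) \<in> N" if x: "x \<in> carrier G" for x
  proof -
    have "(N #> x) [^]\<^bsub>G Mod N\<^esub> (p ^ k) = \<one>\<^bsub>G Mod N\<^esub>"
      using Q.pow_order_eq_1[OF N.coset_in_Mod[OF x]] k by simp
    then have "N #> x [^] (p ^ k) = N" using N.coset_nat_pow[OF x] by simp
    then show ?thesis using coset_join1 N.subgroup_axioms N.subset x by (metis nat_pow_closed)
  qed
  then show ?thesis by (auto simp: exponent_mod_def)
qed

lemma coset_int_pow_cong:
  assumes N: "open_normal N" and k: "exponent_mod N k" and x: "x \<in> carrier G"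
    and ij: "[i = j] (mod int p ^ k)"
  shows "N #> x [^] i = N #> x [^] j"
proof -
  interpret N: normal N G using N by (rule open_normal_normal)
  obtain r where r: "i = j + int p ^ k * r" using ij by (auto simp: cong_iff_dvd_diff dvd_def algebra_simps)
  have "x [^] (int (p ^ k) * r) \<in> N"
    using k x subgroup_int_pow_closed[OF N.subgroup_axioms, of "x [^] (p ^ k)" r]
    by (simp add: exponent_mod_def int_pow_int[symmetric] int_pow_pow)
  then have "x [^] i = x [^] j \<otimes> x [^] (int (p ^ k) * r)" "x [^] (int (p ^ k) * r) \<in> N"
    using r x by (simp_all add: int_pow_mult)
  then show ?thesis using N.coset_eq_iff x by blast
qed

lemma eq_if_cosets_eq:
  assumes x: "x \<in> carrier G" and y: "y \<in> carrier G" and eq: "\<And>N. open_normal N \<Longrightarrow> N #> x = N #> y"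
  shows "x = y"
proof (rule ccontr)
  assume "x \<noteq> y"
  then obtain U where U: "openin T U" "x \<notin> U" "y \<in> U"
    using Hausdorff x y topspace_eq unfolding Hausdorff_space_def disjnt_def by blast
  have "openin T {u \<in> carrier G. y \<otimes> u \<in> U}" using openin_translate(2) y U by blast
  then obtain N where N: "open_normal N" "N \<subseteq> {u \<in> carrier G. y \<otimes> u \<in> U}"
    using ex_open_normal_subset[of "{u \<in> carrier G. y \<otimes> u \<in> U}"] y U by auto
  interpret N: normal N G using N(1) by (rule open_normal_normal)
  obtain z where "z \<in> N" "x = y \<otimes> z" using N.coset_eq_iff[OF x y] eq[OF N(1)] by blast
  then show False using N U by auto
qed

text \<open>A closed set is determined by its images modulo open normal subgroups. The approximant
  \<open>y\<close> may change with \<open>N\<close>, so solutions found in finite quotients need not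
  be arranged into a convergent sequence.\<close>

lemma closed_memI:
  assumes K: "closedin T K" and x: "x \<in> carrier G"
    and ap: "\<And>N. open_normal N \<Longrightarrow> \<exists>y\<in>K. N #> x = N #> y"
  shows "x \<in> K"
proof (rule ccontr)
  assume "x \<notin> K"
  have Kc: "K \<subseteq> carrier G" using closedin_subset[OF K] topspace_eq by simp
  have "openin T (carrier G - K)" using K topspace_eq by (metis openin_diff openin_topspace)
  then have "openin T {u \<in> carrier G. x \<otimes> u \<in> carrier G - K}" using openin_translate(2) x by blast
  then obtain N where N: "open_normal N" "N \<subseteq> {u \<in> carrier G. x \<otimes> u \<in> carrier G - K}"
    using ex_open_normal_subset[of "{u \<in> carrier G. x \<otimes> u \<in> carrier G - K}"] x \<open>x \<notin> K\<close> by auto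
  interpret N: normal N G using N(1) by (rule open_normal_normal)
  obtain y where y: "y \<in> K" "N #> x = N #> y" using ap N by blast
  then obtain z where "z \<in> N" "y = x \<otimes> z" using N.coset_eq_iff[of y x] x Kc by auto
  then show False using N y by auto
qed

lemma closure_approx:
  assumes x: "x \<in> T closure_of S" and N: "open_normal N"
  shows "\<exists>y\<in>S. N #> x = N #> y"
proof -
  interpret N: normal N G using N by (rule open_normal_normal)
  have xc: "x \<in> carrier G" using x topspace_eq in_closure_of by metis
  define U where "U = {u \<in> carrier G. inv x \<otimes> u \<in> N}"
  have "openin T U"
    unfolding U_def using openin_translate(2)[of "inv x" N] xc N by (simp add: open_normal_def)
  moreover have "x \<in> U" using xc by (simp add: U_def)
  moreover have "\<And>V. x \<in> V \<and> openin T V \<Longrightarrow> \<exists>y. y \<in> S \<and> y \<in> V" using x in_closure_of by metis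
  ultimately obtain y where "y \<in> S" "y \<in> U" by blast
  then have y: "y \<in> S" "y \<in> carrier G" "inv x \<otimes> y \<in> N" by (auto simp: U_def)
  have "y = x \<otimes> (inv x \<otimes> y)" using xc y by simp
  then have "N #> y = N #> x" using N.coset_eq_iff[OF y(2) xc] y by blast
  then show ?thesis using y by auto
qed

lemma closedin_open_normal:
  assumes "open_normal N" shows "closedin T N"
proof -
  interpret N: normal N G using assms by (rule open_normal_normal)
  have "T closure_of N \<subseteq> N"
  proof
    fix x assume x: "x \<in> T closure_of N"
    then obtain y where y: "y \<in> N" "N #> x = N #> y" using closure_approx assms by blast
    have "x \<in> carrier G" using x topspace_eq in_closure_of by metis
    then show "x \<in> N" using y N.coset_eq_iff[of x y] N.subset by auto
  qed
  then show ?thesis using N.subset topspace_eq by (metis closure_of_subset_eq)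
qed

text \<open>The cosets prescribed for \<open>y\<close> are closed, and any finitely many of them
  contain the single power \<open>x^(a K)\<close> with \<open>K\<close> large. Compactness yields a
  common point.\<close>

lemma ex_padic_pow:
  assumes x: "x \<in> carrier G" and a: "coherent p a"
  shows "\<exists>y\<in>carrier G. \<forall>N k. open_normal N \<longrightarrow> exponent_mod N k \<longrightarrow> N #> y = N #> x [^] a k"
proof -
  let ?F = "\<lambda>(N, k). {y \<in> carrier G. N #> y = N #> x [^] a k}"
  let ?I = "{(N, k). open_normal N \<and> exponent_mod N k}"
  have cl: "closedin T (?F i)" if i: "i \<in> ?I" for i
  proof -
    obtain N k where Nk: "i = (N, k)" "open_normal N" using i by auto
    interpret N: normal N G using Nk(2) by (rule open_normal_normal)
    have "continuous_map T T (\<lambda>y. inv (x [^] a k) \<otimes> y)"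
      using x by (intro continuous_map_mult continuous_map_const_carrier continuous_map_identity) auto
    from closedin_continuous_map_preimage[OF this closedin_open_normal[OF Nk(2)]]
    have "closedin T {y \<in> carrier G. inv (x [^] a k) \<otimes> y \<in> N}" by (simp add: topspace_eq)
    moreover have "N #> y = N #> x [^] a k \<longleftrightarrow> inv (x [^] a k) \<otimes> y \<in> N" if y: "y \<in> carrier G" for y
    proof -
      have "y = x [^] a k \<otimes> z \<longleftrightarrow> inv (x [^] a k) \<otimes> y = z" if "z \<in> N" for z
        using that N.subset x y by (metis in_mono int_pow_closed inv_solve_left')
      then show ?thesis using N.coset_eq_iff[OF y, of "x [^] a k"] x by auto
    qed
    ultimately show ?thesis using Nk by (simp cong: conj_cong)
  qed
  have fin: "\<Inter>(?F ` J) \<noteq> {}" if J: "finite J" "J \<subseteq> ?I" for J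
  proof -
    define K where "K = Max (insert 0 (snd ` J))"
    have "x [^] a K \<in> ?F i" if i: "i \<in> J" for i
    proof -
      obtain N k where Nk: "i = (N, k)" "open_normal N" "exponent_mod N k" using i J by auto
      have "k \<le> K" using J i Nk unfolding K_def by (intro Max_ge) force+
      then have "N #> x [^] a K = N #> x [^] a k"
        by (intro coset_int_pow_cong[OF Nk(2,3) x] coherent_le[OF a])
      then show ?thesis using Nk x by simp
    qed
    then show ?thesis by blast
  qed
  have "\<Inter>(?F ` ?I) \<noteq> {}"
  proof -
    have 1: "\<forall>C\<in>?F ` ?I. closedin T C"
    proof
      fix C assume "C \<in> ?F ` ?I"
      then obtain i where i: "i \<in> ?I" "C = ?F i" by (rule imageE)
      show "closedin T C" unfolding i(2) by (rule cl[OF i(1)])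
    qed
    have 2: "\<forall>\<F>. finite \<F> \<and> \<F> \<subseteq> ?F ` ?I \<longrightarrow> \<Inter>\<F> \<noteq> {}"
    proof (intro allI impI, elim conjE)
      fix \<F> assume F: "finite \<F>" "\<F> \<subseteq> ?F ` ?I"
      then obtain J where J: "J \<subseteq> ?I" "finite J" "\<F> = ?F ` J"
        using finite_subset_image[OF F] by (elim exE conjE) (rule that)
      show "\<Inter>\<F> \<noteq> {}" unfolding J(3) by (rule fin[OF J(2,1)])
    qed
    show ?thesis
      by (rule mp[OF spec[OF iffD1[OF compact_space_fip compact]] conjI[OF 1 2]])
  qed
  then obtain y where "y \<in> \<Inter>(?F ` ?I)" by auto
  then have y: "y \<in> ?F i" if "i \<in> ?I" for i using that by (rule INT_D)
  have "open_normal (carrier G)"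
    using normal_self topspace_eq openin_topspace[of T] by (simp add: open_normal_def)
  moreover then obtain k where "exponent_mod (carrier G) k" using ex_exponent_mod by blast
  ultimately have "y \<in> carrier G" using y[of "(carrier G, k)"] by simp
  then show ?thesis using y by auto
qed

abbreviation ppow :: "'a \<Rightarrow> (nat \<Rightarrow> int) \<Rightarrow> 'a" where
  "ppow x a \<equiv> padic_pow G T x a"

text \<open>The limit in \<open>padic_pow\<close> exists, and its cosets are those of integer
  powers. The power laws below all follow by calculating with integer exponents modulo each open
  normal subgroup.\<close>

lemma ppow_properties:
  assumes x: "x \<in> carrier G" and a: "coherent p a"
  shows "ppow x a \<in> carrier G \<and>
    (\<forall>N k. open_normal N \<longrightarrow> exponent_mod N k \<longrightarrow> N #> ppow x a = N #> x [^] a k)"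
proof -
  obtain y where y: "y \<in> carrier G" "\<And>N k. open_normal N \<Longrightarrow> exponent_mod N k \<Longrightarrow> N #> y = N #> x [^] a k"
    using ex_padic_pow[OF assms] by blast
  have lim: "limitin T (\<lambda>n. x [^] a n) y sequentially"
    unfolding limitin_def
  proof (intro conjI allI impI)
    show "y \<in> topspace T" using y topspace_eq by simp
    fix U assume U: "openin T U \<and> y \<in> U"
    then have "openin T {u \<in> carrier G. y \<otimes> u \<in> U}" using openin_translate(2) y by blast
    then obtain N where N: "open_normal N" "N \<subseteq> {u \<in> carrier G. y \<otimes> u \<in> U}"
      using ex_open_normal_subset[of "{u \<in> carrier G. y \<otimes> u \<in> U}"] y U by auto
    interpret N: normal N G using N(1) by (rule open_normal_normal)
    obtain k where k: "exponent_mod N k" using ex_exponent_mod N by blast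
    have "x [^] a n \<in> U" if "n \<ge> k" for n
    proof -
      have "N #> x [^] a n = N #> y"
        using coset_int_pow_cong[OF N(1) k x coherent_le[OF a that]] y(2)[OF N(1) k] by simp
      then obtain z where "z \<in> N" "x [^] a n = y \<otimes> z" using N.coset_eq_iff[of "x [^] a n" y] x y by auto
      then show ?thesis using N by auto
    qed
    then show "\<forall>\<^sub>F n in sequentially. x [^] a n \<in> U" using eventually_sequentially by blast
  qed
  have "ppow x a = y"
    unfolding padic_pow_def
  proof (rule the_equality, rule lim)
    fix z assume "limitin T (\<lambda>n. x [^] a n) z sequentially"
    then show "z = y" using limitin_Hausdorff_unique[OF _ lim _ Hausdorff] by simp
  qed
  then show ?thesis using y by simp
qed

lemma ppow_closed [simp, intro]: "x \<in> carrier G \<Longrightarrow> coherent p a \<Longrightarrow> ppow x a \<in> carrier G"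
  using ppow_properties by blast

lemma ppow_coset:
  "\<lbrakk>x \<in> carrier G; coherent p a; open_normal N; exponent_mod N k\<rbrakk> \<Longrightarrow> N #> ppow x a = N #> x [^] a k"
  using ppow_properties by blast

lemma ppow_cong:
  assumes "x \<in> carrier G" "coherent p a" "coherent p b" "padic_eq p a b"
  shows "ppow x a = ppow x b"
proof (rule eq_if_cosets_eq)
  fix N assume N: "open_normal N"
  then obtain k where k: "exponent_mod N k" using ex_exponent_mod[OF N] by blast
  show "N #> ppow x a = N #> ppow x b"
    using assms N k coset_int_pow_cong[OF N k assms(1), of "a k" "b k"] by (simp add: ppow_coset padic_eq_def)
qed (use assms in auto)

lemma ppow_const [simp]:
  assumes "x \<in> carrier G" shows "ppow x (\<lambda>_. k) = x [^] k"
proof (rule eq_if_cosets_eq)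
  fix N assume N: "open_normal N"
  then obtain k' where k: "exponent_mod N k'" using ex_exponent_mod by blast
  show "N #> ppow x (\<lambda>_. k) = N #> x [^] k"
    using ppow_coset[OF assms coherent_const N k] by simp
qed (use assms in auto)

lemma ppow_add:
  assumes x: "x \<in> carrier G" and ab: "coherent p a" "coherent p b"
  shows "ppow x (\<lambda>n. a n + b n) = ppow x a \<otimes> ppow x b"
proof (rule eq_if_cosets_eq)
  fix N assume N: "open_normal N"
  then obtain k where k: "exponent_mod N k" using ex_exponent_mod[OF N] by blast
  interpret N: normal N G using N by (rule open_normal_normal)
  have "N #> (ppow x a \<otimes> ppow x b) = (N #> ppow x a) \<otimes>\<^bsub>G Mod N\<^esub> (N #> ppow x b)"
    using assms by (simp add: N.coset_mult del: mult_FactGroup)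
  also have "\<dots> = N #> (x [^] a k \<otimes> x [^] b k)"
    using assms N k by (simp add: ppow_coset N.coset_mult del: mult_FactGroup)
  finally show "N #> ppow x (\<lambda>n. a n + b n) = N #> (ppow x a \<otimes> ppow x b)"
    using assms N k by (simp add: ppow_coset int_pow_mult)
qed (use assms in auto)

lemma ppow_ppow:
  assumes x: "x \<in> carrier G" and ab: "coherent p a" "coherent p b"
  shows "ppow (ppow x a) b = ppow x (\<lambda>n. a n * b n)"
proof (rule eq_if_cosets_eq)
  fix N assume N: "open_normal N"
  then obtain k where k: "exponent_mod N k" using ex_exponent_mod[OF N] by blast
  interpret N: normal N G using N by (rule open_normal_normal)
  have "N #> ppow (ppow x a) b = (N #> ppow x a) [^]\<^bsub>G Mod N\<^esub> b k"
    by (simp only: ppow_coset[OF ppow_closed[OF x ab(1)] ab(2) N k] N.coset_int_pow[OF ppow_closed[OF x ab(1)]])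
  also have "\<dots> = N #> (x [^] a k) [^] b k"
    by (simp only: ppow_coset[OF x ab(1) N k] N.coset_int_pow[OF int_pow_closed[OF x]])
  finally show "N #> ppow (ppow x a) b = N #> ppow x (\<lambda>n. a n * b n)"
    using assms N k by (simp add: ppow_coset int_pow_pow)
qed (use assms in auto)

lemma ppow_conj:
  assumes g: "g \<in> carrier G" and x: "x \<in> carrier G" and a: "coherent p a"
  shows "g \<otimes> ppow x a \<otimes> inv g = ppow (g \<otimes> x \<otimes> inv g) a"
proof (rule eq_if_cosets_eq)
  fix N assume N: "open_normal N"
  then obtain k where k: "exponent_mod N k" using ex_exponent_mod[OF N] by blast
  interpret N: normal N G using N by (rule open_normal_normal)
  have "N #> (g \<otimes> ppow x a \<otimes> inv g) = (N #> g) \<otimes>\<^bsub>G Mod N\<^esub> (N #> ppow x a) \<otimes>\<^bsub>G Mod N\<^esub> (N #> inv g)"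
    using assms by (simp add: N.coset_mult del: mult_FactGroup)
  also have "\<dots> = N #> (g \<otimes> x [^] a k \<otimes> inv g)"
    using assms N k by (simp add: ppow_coset N.coset_mult del: mult_FactGroup)
  finally show "N #> (g \<otimes> ppow x a \<otimes> inv g) = N #> ppow (g \<otimes> x \<otimes> inv g) a"
    using assms N k by (simp add: ppow_coset conj_int_pow)
qed (use assms in auto)

lemma ppow_mult:
  assumes x: "x \<in> carrier G" and y: "y \<in> carrier G" and c: "x \<otimes> y = y \<otimes> x" and a: "coherent p a"
  shows "ppow (x \<otimes> y) a = ppow x a \<otimes> ppow y a"
proof (rule eq_if_cosets_eq)
  fix N assume N: "open_normal N"
  then obtain k where k: "exponent_mod N k" using ex_exponent_mod[OF N] by blast
  interpret N: normal N G using N by (rule open_normal_normal)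
  have "N #> (ppow x a \<otimes> ppow y a) = (N #> ppow x a) \<otimes>\<^bsub>G Mod N\<^esub> (N #> ppow y a)"
    using assms by (simp add: N.coset_mult del: mult_FactGroup)
  also have "\<dots> = N #> (x [^] a k \<otimes> y [^] a k)"
    using assms N k by (simp add: ppow_coset N.coset_mult del: mult_FactGroup)
  finally show "N #> ppow (x \<otimes> y) a = N #> (ppow x a \<otimes> ppow y a)"
    using assms(1,2,4) N k by (simp add: ppow_coset int_pow_mult_distrib[OF c])
qed (use assms in auto)

lemma ppow_one [simp]: "coherent p a \<Longrightarrow> ppow \<one> a = \<one>"
proof (rule eq_if_cosets_eq)
  fix N assume a: "coherent p a" and N: "open_normal N"
  then obtain k where k: "exponent_mod N k" using ex_exponent_mod[OF N] by blast
  then show "N #> ppow \<one> a = N #> \<one>" using a N by (simp add: ppow_coset)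
qed auto

lemma ppow_mem:
  assumes H: "subgroup H G" "closedin T H" and x: "x \<in> H" and a: "coherent p a"
  shows "ppow x a \<in> H"
proof (rule closed_memI[OF H(2)])
  have xc: "x \<in> carrier G" using H x subgroup.subset by blast
  then show "ppow x a \<in> carrier G" using a by simp
  fix N assume N: "open_normal N"
  then obtain k where k: "exponent_mod N k" using ex_exponent_mod[OF N] by blast
  have "x [^] a k \<in> H" using subgroup_int_pow_closed[OF H(1) x] .
  then show "\<exists>y\<in>H. N #> ppow x a = N #> y" using ppow_coset[OF xc a N k] by blast
qed

end

section \<open>Topology of the p-adic integers and continuity of exponentiation\<close>

lemma padic_carrier_iff:
  "a \<in> carrier (padic_int p) \<longleftrightarrow> (\<forall>n. a n \<in> {0..<int p ^ n} \<and> a (Suc n) mod int p ^ n = a n)"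
  by (simp add: padic_int_def)

lemma padic_carrier_coherent: "a \<in> carrier (padic_int p) \<Longrightarrow> coherent p a"
  unfolding padic_carrier_iff coherent_def cong_def by (metis atLeastLessThan_iff mod_pos_pos_trivial)

text \<open>Returns from arbitrary coherent sequences to the reduced representatives demanded by
  \<open>padic_int\<close>.\<close>

definition padic_normal_form :: "nat \<Rightarrow> (nat \<Rightarrow> int) \<Rightarrow> nat \<Rightarrow> int" where
  "padic_normal_form p a = (\<lambda>n. a n mod int p ^ n)"

lemma padic_normal_form:
  assumes "p > 0" "coherent p a"
  shows "padic_normal_form p a \<in> carrier (padic_int p)" "padic_eq p (padic_normal_form p a) a"
proof -
  have "(a (Suc n) mod int p ^ Suc n) mod int p ^ n = a n mod int p ^ n" for n
  proof -
    have "(a (Suc n) mod int p ^ Suc n) mod int p ^ n = a (Suc n) mod int p ^ n"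
      by (rule mod_mod_cancel) (simp add: le_imp_power_dvd)
    then show ?thesis using assms(2) by (simp add: coherent_def cong_def)
  qed
  then show "padic_normal_form p a \<in> carrier (padic_int p)"
    using assms(1) by (simp add: padic_carrier_iff padic_normal_form_def)
  show "padic_eq p (padic_normal_form p a) a"
    by (simp add: padic_eq_def padic_normal_form_def cong_def)
qed

lemma padic_carrier_eqI:
  assumes "a \<in> carrier (padic_int p)" "b \<in> carrier (padic_int p)" "padic_eq p a b"
  shows "a = b"
proof
  fix n
  have "a n mod int p ^ n = b n mod int p ^ n" using assms(3) by (simp add: padic_eq_def cong_def)
  then show "a n = b n" using assms(1,2) by (simp add: padic_carrier_iff)
qed

lemma topspace_padic [simp]: "topspace (padic_topology p) = carrier (padic_int p)"
  by (simp add: padic_topology_def)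

lemma openin_padic_cylinder: "openin (padic_topology p) {a \<in> carrier (padic_int p). a n = i}"
proof -
  let ?X = "product_topology (\<lambda>_. discrete_topology (UNIV :: int set)) (UNIV :: nat set)"
  have "continuous_map ?X (discrete_topology UNIV) (\<lambda>a. a n)"
    by (rule continuous_map_product_projection) simp
  then have "openin ?X {a \<in> topspace ?X. a n \<in> {i}}"
    by (rule openin_continuous_map_preimage) simp
  then have "openin ?X {a. a n = i}" by simp
  moreover have "{a \<in> carrier (padic_int p). a n = i} = {a. a n = i} \<inter> carrier (padic_int p)" by blast
  ultimately show ?thesis unfolding padic_topology_def openin_subtopology by blast
qed

text \<open>The space lies in a product of finite sets, which is compact by Tychonoff. It is closed
  there because each coherence condition involves only two coordinates.\<close>

lemma compact_space_padic: "compact_space (padic_topology p)"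
proof -
  let ?X = "product_topology (\<lambda>_. discrete_topology (UNIV :: int set)) (UNIV :: nat set)"
  have "compactin ?X (PiE UNIV (\<lambda>n. {0..<int p ^ n}))"
    by (simp add: compactin_PiE compactin_discrete_topology)
  moreover have "carrier (padic_int p) \<subseteq> PiE UNIV (\<lambda>n. {0..<int p ^ n})"
    by (auto simp: padic_carrier_iff)
  moreover have "closedin ?X (carrier (padic_int p))"
  proof -
    have cyl: "openin ?X {a. a n = i}" for n i
    proof -
      have "continuous_map ?X (discrete_topology UNIV) (\<lambda>a. a n)"
        by (rule continuous_map_product_projection) simp
      then have "openin ?X {a \<in> topspace ?X. a n \<in> {i}}"
        by (rule openin_continuous_map_preimage) simp
      then show ?thesis by simp
    qed
    have "openin ?X (- carrier (padic_int p))"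
    proof (subst openin_subopen, intro ballI)
      fix a assume "a \<in> - carrier (padic_int p)"
      then obtain n where n: "\<not> (a n \<in> {0..<int p ^ n} \<and> a (Suc n) mod int p ^ n = a n)"
        by (auto simp: padic_carrier_iff)
      have "openin ?X ({b. b n = a n} \<inter> {b. b (Suc n) = a (Suc n)})" using cyl by (intro openin_Int)
      moreover have "{b. b n = a n} \<inter> {b. b (Suc n) = a (Suc n)} \<subseteq> - carrier (padic_int p)"
      proof (intro subsetI ComplI)
        fix b assume b: "b \<in> {b. b n = a n} \<inter> {b. b (Suc n) = a (Suc n)}" "b \<in> carrier (padic_int p)"
        then have "b n \<in> {0..<int p ^ n} \<and> b (Suc n) mod int p ^ n = b n" unfolding padic_carrier_iff by blast
        then show False using b(1) n by simp
      qed
      ultimately show "\<exists>U. openin ?X U \<and> a \<in> U \<and> U \<subseteq> - carrier (padic_int p)" by blast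
    qed
    then show ?thesis by (simp add: closedin_def Compl_eq_Diff_UNIV)
  qed
  ultimately have "compactin ?X (carrier (padic_int p))" using closed_compactin by blast
  then show ?thesis unfolding padic_topology_def by (simp add: compact_space_subtopology)
qed

lemma set_mult_memI: "u \<in> A \<Longrightarrow> v \<in> B \<Longrightarrow> u \<otimes>\<^bsub>G\<^esub> v \<in> A <#>\<^bsub>G\<^esub> B"
  by (auto simp: set_mult_def)

lemma set_mult_image_memD:
  "w \<in> f ` A <#>\<^bsub>G\<^esub> B \<Longrightarrow> \<exists>u\<in>A. \<exists>v\<in>B. w = f u \<otimes>\<^bsub>G\<^esub> v"
  by (auto simp: set_mult_def)

lemma set_mult_triple_memD:
  "w \<in> A <#>\<^bsub>G\<^esub> B <#>\<^bsub>G\<^esub> C \<Longrightarrow> \<exists>u\<in>A. \<exists>v\<in>B. \<exists>z\<in>C. w = u \<otimes>\<^bsub>G\<^esub> v \<otimes>\<^bsub>G\<^esub> z"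
  by (auto simp: set_mult_def)

context topological_group
begin

lemma closed_generate_restrict:
  assumes H: "subgroup H G" "closedin T H" and S: "S \<subseteq> H"
  shows "closed_generate (G\<lparr>carrier := H\<rparr>) (subtopology T H) S = closed_generate G T S"
proof -
  have g: "generate (G\<lparr>carrier := H\<rparr>) S = generate G S" using generate_consistent S H by blast
  have sub: "generate G S \<subseteq> H" using generate_subgroup_incl S H by blast
  have "T closure_of (generate G S) \<subseteq> H" using sub H(2) by (rule closure_of_minimal)
  then show ?thesis
    using sub by (simp add: closed_generate_def g closure_of_subtopology Int_absorb1)
qed

text \<open>Generated subgroups and closures of subsets of a closed subgroup \<open>H\<close> are
  the same in \<open>H\<close> and in \<open>G\<close>, so powerfulness of \<open>H\<close> can be
  tested without the restricted structure.\<close>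

lemma powerful_restrict_iff:
  assumes H: "subgroup H G" "closedin T H"
  shows "powerful p (G\<lparr>carrier := H\<rparr>) (subtopology T H) \<longleftrightarrow>
    (\<forall>h\<in>H. \<forall>k\<in>H. \<lbrakk>h,k\<rbrakk> \<in> closed_generate G T {h [^] (if p = 2 then 4 else p) | h. h \<in> H})"
proof -
  let ?GH = "G\<lparr>carrier := H\<rparr>" and ?TH = "subtopology T H" and ?q = "if p = 2 then 4 else p"
  have Hc: "H \<subseteq> carrier G" using H subgroup.subset by blast
  have inv: "inv\<^bsub>?GH\<^esub> h = inv h" if "h \<in> H" for h using m_inv_consistent[OF H(1) that] .
  have pw: "h [^]\<^bsub>?GH\<^esub> (n::nat) = h [^] n" for h n by (rule nat_pow_consistent[symmetric])
  let ?C = "{h \<otimes> k \<otimes> inv h \<otimes> inv k | h k. h \<in> H \<and> k \<in> H}" and ?P = "{h [^] ?q | h. h \<in> H}"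
  have C: "?C \<subseteq> H" using H by (auto intro!: subgroup.m_closed subgroup.m_inv_closed)
  have P: "?P \<subseteq> H" using subgroup_nat_pow_closed[OF H(1)] by blast
  have "closed_commutator ?GH ?TH (carrier ?GH) (carrier ?GH) = closed_generate ?GH ?TH ?C"
    unfolding closed_commutator_def
  proof (intro arg_cong[of _ _ "closed_generate ?GH ?TH"] Collect_cong)
    fix z
    show "(\<exists>h k. z = h \<otimes>\<^bsub>?GH\<^esub> k \<otimes>\<^bsub>?GH\<^esub> inv\<^bsub>?GH\<^esub> h \<otimes>\<^bsub>?GH\<^esub> inv\<^bsub>?GH\<^esub> k \<and> h \<in> carrier ?GH \<and> k \<in> carrier ?GH)
      \<longleftrightarrow> (\<exists>h k. z = h \<otimes> k \<otimes> inv h \<otimes> inv k \<and> h \<in> H \<and> k \<in> H)"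
      using inv by simp metis
  qed
  then have 1: "closed_commutator ?GH ?TH (carrier ?GH) (carrier ?GH) = closed_generate G T ?C"
    using closed_generate_restrict[OF H C] by simp
  have 2: "closed_power ?GH ?TH (carrier ?GH) ?q = closed_generate G T ?P"
    unfolding closed_power_def using closed_generate_restrict[OF H P] pw by simp
  have Pc: "?P \<subseteq> carrier G" and Cc: "?C \<subseteq> carrier G" using P C Hc by blast+
  have "closed_generate G T ?C \<subseteq> closed_generate G T ?P \<longleftrightarrow> ?C \<subseteq> closed_generate G T ?P"
    using closed_generate_minimal[OF closed_generate_subgroup(1,2)[OF Pc]] closed_generate_subgroup(3)[OF Cc] by blast
  also have "\<dots> \<longleftrightarrow> (\<forall>h\<in>H. \<forall>k\<in>H. \<lbrakk>h,k\<rbrakk> \<in> closed_generate G T ?P)"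
    unfolding group_commutator_def by blast
  finally show ?thesis unfolding powerful_def 1 2 .
qed

end

context pro_p_group_prime
begin

lemma p_pos: "p > 0"
  using prime by (rule prime_gt_0_nat)

lemma ppow_normal_form:
  assumes "x \<in> carrier G" "coherent p a"
  shows "ppow x (padic_normal_form p a) = ppow x a"
  using assms padic_normal_form[OF p_pos assms(2)] padic_carrier_coherent by (intro ppow_cong) auto

lemma continuous_map_ppow:
  assumes x: "x \<in> carrier G"
  shows "continuous_map (padic_topology p) T (\<lambda>a. ppow x a)"
  unfolding continuous_map_def
proof (intro conjI allI impI)
  show "(\<lambda>a. ppow x a) \<in> topspace (padic_topology p) \<rightarrow> topspace T"
    using x padic_carrier_coherent by (auto simp: topspace_eq)
  fix U assume U: "openin T U"
  show "openin (padic_topology p) {a \<in> topspace (padic_topology p). ppow x a \<in> U}"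
  proof (subst openin_subopen, intro ballI)
    fix a assume "a \<in> {a \<in> topspace (padic_topology p). ppow x a \<in> U}"
    then have a: "a \<in> carrier (padic_int p)" "ppow x a \<in> U" by auto
    then have ac: "coherent p a" using padic_carrier_coherent by blast
    let ?y = "ppow x a"
    have y: "?y \<in> carrier G" using x ac by simp
    have "openin T {u \<in> carrier G. ?y \<otimes> u \<in> U}" using openin_translate(2)[OF y U] .
    then obtain N where N: "open_normal N" "N \<subseteq> {u \<in> carrier G. ?y \<otimes> u \<in> U}"
      using ex_open_normal_subset[of "{u \<in> carrier G. ?y \<otimes> u \<in> U}"] y a(2) by auto
    interpret N: normal N G using N(1) by (rule open_normal_normal)
    obtain k where k: "exponent_mod N k" using ex_exponent_mod[OF N(1)] by blast
    let ?V = "{b \<in> carrier (padic_int p). b k = a k}"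
    have "ppow x b \<in> U" if b: "b \<in> ?V" for b
    proof -
      have bc: "coherent p b" using b padic_carrier_coherent by blast
      have "N #> ppow x b = N #> ?y" using ppow_coset[OF x bc N(1) k] ppow_coset[OF x ac N(1) k] b by simp
      then obtain z where "z \<in> N" "ppow x b = ?y \<otimes> z" using N.coset_eq_iff[of "ppow x b" ?y] x bc y by auto
      then show ?thesis using N by auto
    qed
    then show "\<exists>V. openin (padic_topology p) V \<and> a \<in> V \<and> V \<subseteq> {a \<in> topspace (padic_topology p). ppow x a \<in> U}"
      using openin_padic_cylinder a(1) by (intro exI[of _ ?V]) auto
  qed
qed

lemma ppow_range_eq_image:
  assumes "x \<in> carrier G"
  shows "{ppow x a | a. coherent p a} = (\<lambda>a. ppow x a) ` carrier (padic_int p)"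
proof (intro equalityI subsetI)
  fix u assume "u \<in> {ppow x a | a. coherent p a}"
  then obtain a where "coherent p a" "u = ppow x a" by blast
  then show "u \<in> (\<lambda>a. ppow x a) ` carrier (padic_int p)"
    using ppow_normal_form[OF assms, of a] padic_normal_form(1)[OF p_pos, of a] by (intro image_eqI[of _ _ "padic_normal_form p a"]) auto
qed (use padic_carrier_coherent in auto)

lemma compactin_ppow_range:
  assumes "x \<in> carrier G"
  shows "compactin T {ppow x a | a. coherent p a}"
proof -
  have "compactin (padic_topology p) (carrier (padic_int p))"
    using compact_space_padic[of p] by (simp add: compact_space_def)
  then show ?thesis
    unfolding ppow_range_eq_image[OF assms] using continuous_map_ppow[OF assms] by (rule image_compactin)
qed

text \<open>The set of p-adic powers of \<open>x\<close> is a continuous image of the compact space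
  of p-adic integers, hence closed, and the power laws make it a subgroup.\<close>

lemma closed_generate_singleton:
  assumes x: "x \<in> carrier G"
  shows "closed_generate G T {x} = {ppow x a | a. coherent p a}"
proof
  note cg = closed_generate_subgroup[of "{x}"]
  show "{ppow x a | a. coherent p a} \<subseteq> closed_generate G T {x}"
    using ppow_mem[OF cg(1,2)] cg(3) x by auto
  show "closed_generate G T {x} \<subseteq> {ppow x a | a. coherent p a}"
  proof (rule closed_generate_minimal)
    show "closedin T {ppow x a | a. coherent p a}"
      using compactin_ppow_range[OF x] Hausdorff compactin_imp_closedin by blast
    have x1: "x = ppow x (\<lambda>_. 1)" using x by simp
    then show "{x} \<subseteq> {ppow x a | a. coherent p a}" using coherent_const by blast
    show "subgroup {ppow x a | a. coherent p a} G"
    proof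
      show "{ppow x a | a. coherent p a} \<subseteq> carrier G" using x by auto
      have "\<one> = ppow x (\<lambda>_. 0)" using x by simp
      then show "\<one> \<in> {ppow x a | a. coherent p a}" using coherent_const by blast
    next
      fix u v assume "u \<in> {ppow x a | a. coherent p a}" "v \<in> {ppow x a | a. coherent p a}"
      then obtain a b where "coherent p a" "coherent p b" "u = ppow x a" "v = ppow x b" by blast
      then have "u \<otimes> v = ppow x (\<lambda>n. a n + b n)" "coherent p (\<lambda>n. a n + b n)"
        using ppow_add[OF x] by auto
      then show "u \<otimes> v \<in> {ppow x a | a. coherent p a}" by blast
    next
      fix u assume "u \<in> {ppow x a | a. coherent p a}"
      then obtain a where a: "coherent p a" "u = ppow x a" by blast
      have "u \<otimes> ppow x (\<lambda>n. - a n) = \<one>"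
        using ppow_add[OF x a(1) coherent_uminus[OF a(1)]] a(2) x by simp
      then have "inv u = ppow x (\<lambda>n. - a n)"
        using a x by (metis coherent_uminus inv_comm inv_equality ppow_closed)
      then show "inv u \<in> {ppow x a | a. coherent p a}" using coherent_uminus[OF a(1)] by blast
    qed
  qed
qed

lemma ppow_uminus:
  assumes x: "x \<in> carrier G" and a: "coherent p a"
  shows "ppow x (\<lambda>n. - a n) = inv (ppow x a)"
proof -
  have "ppow x (\<lambda>n. - a n) \<otimes> ppow x a = \<one>"
    using ppow_add[OF x coherent_uminus[OF a] a] x by simp
  then show ?thesis using x a by (metis coherent_uminus inv_equality ppow_closed)
qed

lemma ppow_diff:
  assumes x: "x \<in> carrier G" and ab: "coherent p a" "coherent p b"
  shows "ppow x (\<lambda>n. a n - b n) = ppow x a \<otimes> inv (ppow x b)"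
  using ppow_add[OF x ab(1) coherent_uminus[OF ab(2)]] ppow_uminus[OF x ab(2)] by simp

section \<open>From finite quotients to two-generator closed subgroups\<close>

definition powerful_exponent :: nat where
  "powerful_exponent = (if p = 2 then 4 else p)"

text \<open>The image of \<open>H\<close> modulo \<open>N\<close> is a finite p-group generated by
  the images of \<open>x\<close> and \<open>y\<close>. It inherits the powerfulness condition
  because a closure meets no new cosets of an open normal subgroup.\<close>

lemma powerful_two_generator_mod:
  assumes xy: "x \<in> carrier G" "y \<in> carrier G" and c: "c = \<lbrakk>x,y\<rbrakk>"
    and H: "H = closed_generate G T {x, y}"
    and pow: "powerful p (G\<lparr>carrier := H\<rparr>) (subtopology T H)"
    and N: "open_normal N"
  shows "\<And>u v. u \<in> H \<Longrightarrow> v \<in> H \<Longrightarrow> \<exists>k::int. N #> \<lbrakk>u,v\<rbrakk> = N #> c [^] k"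
    and "\<And>g. g \<in> H \<Longrightarrow> \<exists>i::int. N #> (g \<otimes> c \<otimes> inv g) = N #> c [^] (1 + int powerful_exponent * i)"
    and "\<exists>(i::int) (j::int) (k::int) (l::int).
      N #> c = N #> ((x [^] i \<otimes> y [^] j \<otimes> c [^] k) [^] powerful_exponent \<otimes> c [^] (int p * l))"
proof -
  let ?q = powerful_exponent
  interpret N: normal N G using N by (rule open_normal_normal)
  let ?Q = "G Mod N"
  interpret Q: group ?Q by (rule N.factorgroup_is_group)
  let ?\<phi> = "\<lambda>a. N #> a"
  interpret \<phi>: group_hom G ?Q ?\<phi>
    using N.r_coset_hom_Mod by (simp add: group_hom_def group_hom_axioms_def is_group Q.is_group)
  note Hs = closed_generate_subgroup[of "{x,y}", folded H]
  have Hsub: "subgroup H G" "closedin T H" "{x,y} \<subseteq> H" using Hs xy by auto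
  have Hc: "H \<subseteq> carrier G" using Hsub subgroup.subset by blast
  have cc: "c \<in> carrier G" using xy c by simp
  let ?B = "?\<phi> ` H"
  let ?P = "?Q\<lparr>carrier := ?B\<rparr>"
  have B: "subgroup ?B ?Q" using \<phi>.subgroup_img_is_subgroup[OF Hsub(1)] .
  interpret P: group ?P using Q.subgroup_imp_group[OF B] .
  have xyP: "?\<phi> x \<in> carrier ?P" "?\<phi> y \<in> carrier ?P" using Hsub by auto
  obtain k where k: "order ?Q = p ^ k" using open_normal_order[OF N] by blast
  then have "finite (carrier ?Q)" using p_pos by (metis Q.order_gt_0_iff_finite zero_less_power)
  then have "card ?B dvd order ?Q" using Q.lagrange[OF B] by (metis dvd_triv_right)
  then obtain j where j: "order ?P = p ^ j"
    using k divides_primepow_nat[OF prime] by (auto simp: order_def)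
  have inv: "inv\<^bsub>?P\<^esub> X = inv\<^bsub>?Q\<^esub> X" if "X \<in> ?B" for X using Q.m_inv_consistent[OF B that] .
  have npow: "Z [^]\<^bsub>?P\<^esub> (n::nat) = Z [^]\<^bsub>?Q\<^esub> n" for Z n by (rule Q.nat_pow_consistent[symmetric])
  have com: "\<lbrakk>?\<phi> u, ?\<phi> v\<rbrakk>\<^bsub>?P\<^esub> = ?\<phi> \<lbrakk>u,v\<rbrakk>" if "u \<in> H" "v \<in> H" for u v
  proof -
    have "\<lbrakk>?\<phi> u, ?\<phi> v\<rbrakk>\<^bsub>?P\<^esub> = \<lbrakk>?\<phi> u, ?\<phi> v\<rbrakk>\<^bsub>?Q\<^esub>" using that inv by (simp add: group_commutator_def)
    then show ?thesis using that Hc N.coset_commutator by (simp add: subset_iff)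
  qed
  have approx: "?\<phi> ` closed_generate G T S \<subseteq> generate ?Q (?\<phi> ` S)" if "S \<subseteq> carrier G" for S
  proof
    fix Y assume "Y \<in> ?\<phi> ` closed_generate G T S"
    then obtain u where u: "u \<in> T closure_of (generate G S)" "Y = ?\<phi> u"
      unfolding closed_generate_def by blast
    then obtain v where "v \<in> generate G S" "Y = ?\<phi> v" using closure_approx[OF u(1) N] by auto
    then show "Y \<in> generate ?Q (?\<phi> ` S)" using \<phi>.generate_img[OF that] by simp
  qed
  have gen: "generate ?P {?\<phi> x, ?\<phi> y} = carrier ?P"
  proof
    show "generate ?P {?\<phi> x, ?\<phi> y} \<subseteq> carrier ?P" using P.generate_incl xyP by simp
    have "generate ?P {?\<phi> x, ?\<phi> y} = generate ?Q {?\<phi> x, ?\<phi> y}"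
      using Q.generate_consistent[OF _ B] xyP by simp
    then show "carrier ?P \<subseteq> generate ?P {?\<phi> x, ?\<phi> y}" using approx[of "{x,y}"] xy H by simp
  qed
  have pw: "\<lbrakk>U,V\<rbrakk>\<^bsub>?P\<^esub> \<in> generate ?P {h [^]\<^bsub>?P\<^esub> ?q | h. h \<in> carrier ?P}"
    if UV: "U \<in> carrier ?P" "V \<in> carrier ?P" for U V
  proof -
    obtain u v where uv: "u \<in> H" "v \<in> H" "U = ?\<phi> u" "V = ?\<phi> v" using UV by auto
    let ?S = "{h [^] ?q | h. h \<in> H}"
    have S: "?S \<subseteq> carrier G" using Hc by auto
    have "\<lbrakk>u,v\<rbrakk> \<in> closed_generate G T ?S"
      using pow uv unfolding powerful_restrict_iff[OF Hsub(1,2)] powerful_exponent_def by blast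
    then have "?\<phi> \<lbrakk>u,v\<rbrakk> \<in> generate ?Q (?\<phi> ` ?S)" using approx[OF S] by blast
    moreover have "?\<phi> ` ?S = {h [^]\<^bsub>?P\<^esub> ?q | h. h \<in> carrier ?P}"
    proof -
      have "?\<phi> (h [^] ?q) = ?\<phi> h [^]\<^bsub>?P\<^esub> ?q" if "h \<in> H" for h
        using N.coset_nat_pow[of h ?q] that Hc npow by auto
      then have "?\<phi> ` ?S = {?\<phi> h [^]\<^bsub>?P\<^esub> ?q | h. h \<in> H}" by (auto simp: image_iff)
      also have "\<dots> = {h [^]\<^bsub>?P\<^esub> ?q | h. h \<in> carrier ?P}" by auto
      finally show ?thesis .
    qed
    moreover have "generate ?P {h [^]\<^bsub>?P\<^esub> ?q | h. h \<in> carrier ?P} = generate ?Q {h [^]\<^bsub>?P\<^esub> ?q | h. h \<in> carrier ?P}"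
    proof (rule Q.generate_consistent[OF _ B])
      show "{h [^]\<^bsub>?P\<^esub> ?q | h. h \<in> carrier ?P} \<subseteq> ?B" using P.nat_pow_closed by auto
    qed
    ultimately show ?thesis using com uv by simp
  qed
  have cP: "?\<phi> c = \<lbrakk>?\<phi> x, ?\<phi> y\<rbrakk>\<^bsub>?P\<^esub>" using c com Hsub(3) by simp
  have ipow: "?\<phi> c [^]\<^bsub>?P\<^esub> (i::int) = ?\<phi> (c [^] i)" for i
    using N.coset_int_pow[OF cc] Q.int_pow_consistent[OF B, of "?\<phi> c"] cP xyP P.commutator_closed by fastforce
  note fin = P.powerful_p_group_two_generators[OF prime j powerful_exponent_def xyP cP gen pw]
  show "\<exists>k::int. N #> \<lbrakk>u,v\<rbrakk> = N #> c [^] k" if "u \<in> H" "v \<in> H" for u v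
    using fin(1)[of "?\<phi> u" "?\<phi> v"] that com ipow by auto
  show "\<exists>i::int. N #> (g \<otimes> c \<otimes> inv g) = N #> c [^] (1 + int ?q * i)" if g: "g \<in> H" for g
  proof -
    have gc: "g \<in> carrier G" using g Hc by blast
    obtain i :: int where "?\<phi> g \<otimes>\<^bsub>?P\<^esub> ?\<phi> c \<otimes>\<^bsub>?P\<^esub> inv\<^bsub>?P\<^esub> ?\<phi> g = ?\<phi> c [^]\<^bsub>?P\<^esub> (1 + int ?q * i)"
      using fin(2)[of "?\<phi> g"] g by auto
    then have "?\<phi> g \<otimes>\<^bsub>?Q\<^esub> ?\<phi> c \<otimes>\<^bsub>?Q\<^esub> inv\<^bsub>?Q\<^esub> ?\<phi> g = ?\<phi> (c [^] (1 + int ?q * i))"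
      using inv[of "?\<phi> g"] g unfolding ipow by simp
    moreover have "?\<phi> g \<otimes>\<^bsub>?Q\<^esub> ?\<phi> c \<otimes>\<^bsub>?Q\<^esub> inv\<^bsub>?Q\<^esub> ?\<phi> g = N #> (g \<otimes> c \<otimes> inv g)"
      using gc cc by (simp only: N.coset_inv N.coset_mult m_closed inv_closed)
    ultimately show ?thesis by metis
  qed
  have "\<exists>(i::int) (j::int) (k::int) (l::int). ?\<phi> c = (?\<phi> x [^]\<^bsub>?P\<^esub> i \<otimes>\<^bsub>?P\<^esub> ?\<phi> y [^]\<^bsub>?P\<^esub> j \<otimes>\<^bsub>?P\<^esub> ?\<phi> c [^]\<^bsub>?P\<^esub> k) [^]\<^bsub>?P\<^esub> ?q \<otimes>\<^bsub>?P\<^esub> ?\<phi> c [^]\<^bsub>?P\<^esub> (int p * l)"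
    by (rule fin(3))
  then obtain i j k l :: int where ijkl: "?\<phi> c = (?\<phi> x [^]\<^bsub>?P\<^esub> i \<otimes>\<^bsub>?P\<^esub> ?\<phi> y [^]\<^bsub>?P\<^esub> j \<otimes>\<^bsub>?P\<^esub> ?\<phi> c [^]\<^bsub>?P\<^esub> k) [^]\<^bsub>?P\<^esub> ?q \<otimes>\<^bsub>?P\<^esub> ?\<phi> c [^]\<^bsub>?P\<^esub> (int p * l)"
    by (elim exE) (rule that)
  have "?\<phi> x [^]\<^bsub>?P\<^esub> i = ?\<phi> (x [^] i)" "?\<phi> y [^]\<^bsub>?P\<^esub> j = ?\<phi> (y [^] j)"
    using N.coset_int_pow xy xyP Q.int_pow_consistent[OF B, symmetric] by auto
  then have "?\<phi> c = (?\<phi> (x [^] i) \<otimes>\<^bsub>?Q\<^esub> ?\<phi> (y [^] j) \<otimes>\<^bsub>?Q\<^esub> ?\<phi> (c [^] k)) [^]\<^bsub>?Q\<^esub> ?q \<otimes>\<^bsub>?Q\<^esub> ?\<phi> (c [^] (int p * l))"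
    using ijkl ipow npow by simp
  also have "\<dots> = N #> ((x [^] i \<otimes> y [^] j \<otimes> c [^] k) [^] ?q \<otimes> c [^] (int p * l))"
    using xy cc by (simp only: N.coset_mult N.coset_nat_pow m_closed int_pow_closed nat_pow_closed)
  finally show "\<exists>(i::int) (j::int) (k::int) (l::int).
      N #> c = N #> ((x [^] i \<otimes> y [^] j \<otimes> c [^] k) [^] ?q \<otimes> c [^] (int p * l))" by blast
qed

text \<open>The integer exponents found modulo \<open>N\<close> depend on \<open>N\<close>. They
  assemble to p-adic exponents because each conclusion is membership in a closed set: a procyclic
  subgroup, or a product of compact sets of powers.\<close>

proposition locally_powerful_two_generators:
  assumes lp: "locally_powerful p G T"
    and xy: "x \<in> carrier G" "y \<in> carrier G" and c: "c = \<lbrakk>x,y\<rbrakk>"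
    and H: "H = closed_generate G T {x, y}"
  shows "\<And>u v. u \<in> H \<Longrightarrow> v \<in> H \<Longrightarrow> \<exists>a. coherent p a \<and> \<lbrakk>u,v\<rbrakk> = ppow c a"
    and "\<And>g. g \<in> H \<Longrightarrow> \<exists>a. coherent p a \<and> g \<otimes> c \<otimes> inv g = ppow c (\<lambda>n. 1 + int powerful_exponent * a n)"
    and "\<exists>a b e l. coherent p a \<and> coherent p b \<and> coherent p e \<and> coherent p l \<and>
      c = (ppow x a \<otimes> ppow y b \<otimes> ppow c e) [^] powerful_exponent \<otimes> ppow c (\<lambda>n. int p * l n)"
proof -
  let ?q = powerful_exponent
  have Hsub: "subgroup H G" "closedin T H" "{x,y} \<subseteq> H"
    using closed_generate_subgroup[of "{x,y}", folded H] xy by auto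
  have Hc: "H \<subseteq> carrier G" using Hsub subgroup.subset by blast
  have cc: "c \<in> carrier G" using xy c by simp
  have "closed_generate (G\<lparr>carrier := H\<rparr>) (subtopology T H) {x,y} = H"
    using closed_generate_restrict[OF Hsub] H by simp
  then have "topologically_fg (G\<lparr>carrier := H\<rparr>) (subtopology T H)"
    unfolding topologically_fg_def using Hsub(3) by (intro exI[of _ "{x,y}"]) simp
  then have pow: "powerful p (G\<lparr>carrier := H\<rparr>) (subtopology T H)"
    using lp Hsub unfolding locally_powerful_def by blast
  note md = powerful_two_generator_mod[OF xy c H pow]
  note cg = closed_generate_subgroup[of "{c}"]
  show "\<exists>a. coherent p a \<and> \<lbrakk>u,v\<rbrakk> = ppow c a" if uv: "u \<in> H" "v \<in> H" for u v
  proof -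
    have "\<lbrakk>u,v\<rbrakk> \<in> closed_generate G T {c}"
    proof (rule closed_memI)
      show "\<lbrakk>u,v\<rbrakk> \<in> carrier G" using uv Hc by blast
      fix N assume N: "open_normal N"
      obtain k :: int where "N #> \<lbrakk>u,v\<rbrakk> = N #> c [^] k" using md(1)[OF N uv] by blast
      moreover have "c [^] k \<in> closed_generate G T {c}"
        using subgroup_int_pow_closed[OF cg(1)] cg(3) cc by simp
      ultimately show "\<exists>y\<in>closed_generate G T {c}. N #> \<lbrakk>u,v\<rbrakk> = N #> y" by blast
    qed (use cg cc in simp)
    then show ?thesis unfolding closed_generate_singleton[OF cc] by blast
  qed
  show "\<exists>a. coherent p a \<and> g \<otimes> c \<otimes> inv g = ppow c (\<lambda>n. 1 + int ?q * a n)" if g: "g \<in> H" for g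
  proof -
    have gc: "g \<in> carrier G" using g Hc by blast
    note cg' = closed_generate_subgroup[of "{c [^] ?q}"]
    \<comment> \<open>Dividing by \<open>c\<close> turns the condition on the exponent, to be 1
      modulo \<open>q\<close>, into membership in the closed subgroup generated by
      \<open>c^q\<close>.\<close>
    have "inv c \<otimes> (g \<otimes> c \<otimes> inv g) \<in> closed_generate G T {c [^] ?q}"
    proof (rule closed_memI)
      show "inv c \<otimes> (g \<otimes> c \<otimes> inv g) \<in> carrier G" using gc cc by blast
      fix N assume N: "open_normal N"
      interpret N: normal N G using N by (rule open_normal_normal)
      obtain i :: int where i: "N #> (g \<otimes> c \<otimes> inv g) = N #> c [^] (1 + int ?q * i)"
        using md(2)[OF N g] by blast
      have "N #> (inv c \<otimes> (g \<otimes> c \<otimes> inv g)) = (N #> inv c) \<otimes>\<^bsub>G Mod N\<^esub> (N #> (g \<otimes> c \<otimes> inv g))"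
        using gc cc by (simp add: N.coset_mult del: mult_FactGroup)
      also have "\<dots> = N #> (inv c \<otimes> c [^] (1 + int ?q * i))"
        unfolding i using cc by (simp add: N.coset_mult del: mult_FactGroup)
      also have "inv c \<otimes> c [^] (1 + int ?q * i) = (c [^] ?q) [^] i"
        using cc by (simp add: int_pow_mult int_pow_pow int_pow_int[symmetric])
      finally show "\<exists>y\<in>closed_generate G T {c [^] ?q}. N #> (inv c \<otimes> (g \<otimes> c \<otimes> inv g)) = N #> y"
        using subgroup_int_pow_closed[OF cg'(1), of "c [^] ?q" i] cg'(3) cc by auto
    qed (use cg' cc in simp)
    then obtain a where a: "coherent p a" "inv c \<otimes> (g \<otimes> c \<otimes> inv g) = ppow (c [^] ?q) a"
      unfolding closed_generate_singleton[OF nat_pow_closed[OF cc]] by blast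
    have "ppow (c [^] ?q) a = ppow (ppow c (\<lambda>_. int ?q)) a" using cc by (simp add: int_pow_int)
    also have "\<dots> = ppow c (\<lambda>n. int ?q * a n)" using ppow_ppow[OF cc coherent_const a(1)] .
    finally have "g \<otimes> c \<otimes> inv g = c \<otimes> ppow c (\<lambda>n. int ?q * a n)"
      using a(2) cc gc by (metis conj_closed inv_cancel_left(2))
    also have "\<dots> = ppow c (\<lambda>_. 1) \<otimes> ppow c (\<lambda>n. int ?q * a n)" using cc by simp
    also have "\<dots> = ppow c (\<lambda>n. 1 + int ?q * a n)"
      using ppow_add[OF cc coherent_const coherent_mult[OF coherent_const a(1)]] by simp
    finally show ?thesis using a(1) by blast
  qed
  let ?R = "\<lambda>x. {ppow x a | a. coherent p a}"
  \<comment> \<open>All elements of the shape required in the third conclusion. The set is compact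
    because exponents range over a compact space, so membership of \<open>c\<close> can be checked
    modulo each \<open>N\<close>.\<close>
  let ?K = "((\<lambda>z. z [^] ?q) ` (?R x <#> ?R y <#> ?R c)) <#> ?R (c [^] p)"
  have "compactin T ?K"
    using xy cc by (intro compactin_set_mult compactin_pow_image compactin_ppow_range) auto
  then have K: "closedin T ?K" using Hausdorff compactin_imp_closedin by blast
  have "c \<in> ?K"
  proof (rule closed_memI[OF K cc])
    fix N assume N: "open_normal N"
    obtain i j k l :: int where ijkl:
      "N #> c = N #> ((x [^] i \<otimes> y [^] j \<otimes> c [^] k) [^] ?q \<otimes> c [^] (int p * l))"
      using md(3)[OF N] by blast
    have mem: "u [^] (i::int) \<in> ?R u" if "u \<in> carrier G" for u i
    proof -
      have "u [^] i = ppow u (\<lambda>_. i)" using that by simp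
      then show ?thesis using coherent_const by blast
    qed
    have "c [^] (int p * l) = (c [^] p) [^] l" using cc by (simp add: int_pow_pow int_pow_int[symmetric])
    then have m1: "c [^] (int p * l) \<in> ?R (c [^] p)" using mem cc by simp
    have m2: "x [^] i \<otimes> y [^] j \<otimes> c [^] k \<in> ?R x <#> ?R y <#> ?R c"
      by (intro set_mult_memI mem xy cc)
    have "(x [^] i \<otimes> y [^] j \<otimes> c [^] k) [^] ?q \<otimes> c [^] (int p * l) \<in> ?K"
      by (rule set_mult_memI[OF imageI[OF m2] m1])
    then show "\<exists>y\<in>?K. N #> c = N #> y" using ijkl by blast
  qed
  then have "\<exists>w\<in>?R x <#> ?R y <#> ?R c. \<exists>z\<in>?R (c [^] p). c = w [^] ?q \<otimes> z"
    by (rule set_mult_image_memD)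
  then obtain w z where wz: "w \<in> ?R x <#> ?R y <#> ?R c" "z \<in> ?R (c [^] p)" "c = w [^] ?q \<otimes> z"
    by (elim bexE) (rule that)
  obtain w1 w2 w3 where w: "w1 \<in> ?R x" "w2 \<in> ?R y" "w3 \<in> ?R c" "w = w1 \<otimes> w2 \<otimes> w3"
    using set_mult_triple_memD[OF wz(1)] by (elim bexE) (rule that)
  obtain a b e l where abel: "coherent p a" "coherent p b" "coherent p e" "coherent p l"
    "c = (ppow x a \<otimes> ppow y b \<otimes> ppow c e) [^] ?q \<otimes> ppow (c [^] p) l"
  proof -
    obtain a where a: "w1 = ppow x a" "coherent p a" using w(1) by (elim CollectE exE conjE) (rule that)
    obtain b where b: "w2 = ppow y b" "coherent p b" using w(2) by (elim CollectE exE conjE) (rule that)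
    obtain e where e: "w3 = ppow c e" "coherent p e" using w(3) by (elim CollectE exE conjE) (rule that)
    obtain l where l: "z = ppow (c [^] p) l" "coherent p l" using wz(2) by (elim CollectE exE conjE) (rule that)
    show thesis
      by (rule that[OF a(2) b(2) e(2) l(2)]) (use wz(3) w(4) a(1) b(1) e(1) l(1) in argo)
  qed
  have "ppow (c [^] p) l = ppow (ppow c (\<lambda>_. int p)) l" using cc by (simp add: int_pow_int)
  also have "\<dots> = ppow c (\<lambda>n. int p * l n)" using ppow_ppow[OF cc coherent_const abel(4)] .
  finally show "\<exists>a b e l. coherent p a \<and> coherent p b \<and> coherent p e \<and> coherent p l \<and>
      c = (ppow x a \<otimes> ppow y b \<otimes> ppow c e) [^] ?q \<otimes> ppow c (\<lambda>n. int p * l n)"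
    using abel by metis
qed

end

section \<open>The lower \<open>p\<close>-series of a uniform group\<close>

text \<open>Each further generator contributes at most \<open>p\<close> powers and commutes with the
  rest.\<close>

lemma (in comm_group) finite_generate_exponent:
  assumes "finite S" "S \<subseteq> carrier G" and p: "(p::nat) > 0" and exp: "\<And>x. x \<in> carrier G \<Longrightarrow> x [^] p = \<one>"
  shows "finite (generate G S)"
  using assms(1,2)
proof (induction S rule: finite_induct)
  case empty
  have "generate G {} \<subseteq> {\<one>}" by (rule generate_subgroup_incl) (use triv_subgroup in auto)
  then show ?case by (rule finite_subset) simp
next
  case (insert s S)
  have s: "s \<in> carrier G" and S: "S \<subseteq> carrier G" using insert.prems by auto
  have gc: "g \<in> carrier G" if "g \<in> generate G S" for g using generate_in_carrier[OF S that] .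
  have red: "s [^] i = s [^] (i mod p)" for i :: nat
  proof -
    have "s [^] i = s [^] (i div p * p + i mod p)" by simp
    also have "\<dots> = (s [^] (i div p)) [^] p \<otimes> s [^] (i mod p)"
      using nat_pow_mult[OF s, of "i div p * p" "i mod p"] nat_pow_pow[OF s, of "i div p" p] by simp
    finally show ?thesis using exp s by simp
  qed
  have form: "\<exists>i g. g \<in> generate G S \<and> x = s [^] (i::nat) \<otimes> g" if "x \<in> generate G (insert s S)" for x
    using that
  proof (induction x rule: generate.induct)
    case one
    show ?case using generate.one[of G S] by (intro exI[of _ "0::nat"] exI[of _ "\<one>"]) simp
  next
    case (incl h)
    show ?case
    proof (cases "h = s")
      case True
      have "s = s [^] (1::nat) \<otimes> \<one>" using s by simp
      then show ?thesis using generate.one[of G S] True by metis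
    next
      case False
      then have h: "h \<in> generate G S" using incl generate.incl by (metis insertE)
      have "h = s [^] (0::nat) \<otimes> h" using gc[OF h] by simp
      then show ?thesis using h by metis
    qed
  next
    case (inv h)
    show ?case
    proof (cases "h = s")
      case True
      have "s \<otimes> s [^] (p - 1) = \<one>" using exp[OF s] s p by (metis Suc_pred' nat_pow_Suc2)
      then have "inv s = s [^] (p - 1) \<otimes> \<one>" using s by (metis inv_equality m_comm nat_pow_closed r_one)
      then show ?thesis using generate.one[of G S] True by metis
    next
      case False
      then have h: "inv h \<in> generate G S" using inv generate.inv by (metis insertE)
      have "inv h = s [^] (0::nat) \<otimes> inv h" using gc[OF h] by simp
      then show ?thesis using h by metis
    qed
  next
    case (eng h1 h2)
    then obtain i g j g' where ij: "g \<in> generate G S" "h1 = s [^] (i::nat) \<otimes> g" "g' \<in> generate G S" "h2 = s [^] (j::nat) \<otimes> g'"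
      by metis
    have "h1 \<otimes> h2 = s [^] i \<otimes> (g \<otimes> s [^] j) \<otimes> g'" using ij gc s by (simp add: m_assoc)
    also have "g \<otimes> s [^] j = s [^] j \<otimes> g" using gc[OF ij(1)] s by (simp add: m_comm)
    also have "s [^] i \<otimes> (s [^] j \<otimes> g) \<otimes> g' = s [^] (i + j) \<otimes> (g \<otimes> g')"
      using gc[OF ij(1)] gc[OF ij(3)] s nat_pow_mult[OF s, of i j] by (simp add: m_assoc[symmetric])
    finally show ?case using generate.eng[OF ij(1,3)] by metis
  qed
  have "generate G (insert s S) \<subseteq> (\<lambda>(i, g). s [^] i \<otimes> g) ` ({..<p} \<times> generate G S)"
  proof
    fix x assume "x \<in> generate G (insert s S)"
    then obtain i :: nat and g where "g \<in> generate G S" "x = s [^] i \<otimes> g" using form by metis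
    then show "x \<in> (\<lambda>(i, g). s [^] i \<otimes> g) ` ({..<p} \<times> generate G S)"
      using red[of i] p by (intro image_eqI[of _ _ "(i mod p, g)"]) auto
  qed
  then show ?case by (rule finite_subset) (use insert.IH[OF S] in simp)
qed

context group
begin

lemma normal_set_mult:
  assumes A: "A \<lhd> G" and B: "B \<lhd> G"
  shows "A <#> B \<lhd> G"
proof -
  interpret A: normal A G by fact
  interpret B: normal B G by fact
  show ?thesis
    unfolding normal_iff_conj
  proof (intro conjI ballI)
    have mult: "(a \<otimes> b) \<otimes> (a' \<otimes> b') \<in> A <#> B" if "a \<in> A" "b \<in> B" "a' \<in> A" "b' \<in> B" for a b a' b'
    proof -
      have car: "a \<in> carrier G" "b \<in> carrier G" "a' \<in> carrier G" "b' \<in> carrier G" using that A.subset B.subset by auto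
      have "(a \<otimes> b) \<otimes> (a' \<otimes> b') = (a \<otimes> a') \<otimes> ((inv a' \<otimes> b \<otimes> a') \<otimes> b')"
        using car by (simp add: word_simps)
      moreover have "inv a' \<otimes> b \<otimes> a' \<in> B" using that car B.inv_op_closed1 by simp
      ultimately show ?thesis using that by (auto intro!: set_mult_memI)
    qed
    show "subgroup (A <#> B) G"
    proof
      show "A <#> B \<subseteq> carrier G" using A.subset B.subset by (rule set_mult_closed)
      show "\<one> \<in> A <#> B" using set_mult_memI[of \<one> A \<one> B G] A.one_closed B.one_closed by simp
      show "x \<otimes> y \<in> A <#> B" if "x \<in> A <#> B" "y \<in> A <#> B" for x y
        using that mult by (auto simp: set_mult_def)
      show "inv x \<in> A <#> B" if x: "x \<in> A <#> B" for x
      proof -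
        obtain a b where ab: "a \<in> A" "b \<in> B" "x = a \<otimes> b" using x by (auto simp: set_mult_def)
        have car: "a \<in> carrier G" "b \<in> carrier G" using ab A.subset B.subset by auto
        have "inv x = inv a \<otimes> (a \<otimes> inv b \<otimes> inv a)" using ab(3) car by (simp add: word_simps)
        moreover have "a \<otimes> inv b \<otimes> inv a \<in> B" using ab car B.inv_op_closed2 by simp
        ultimately show ?thesis using ab by (auto intro!: set_mult_memI)
      qed
    qed
    fix g x assume g: "g \<in> carrier G" and "x \<in> A <#> B"
    then obtain a b where ab: "a \<in> A" "b \<in> B" "x = a \<otimes> b" by (auto simp: set_mult_def)
    have car: "a \<in> carrier G" "b \<in> carrier G" using ab A.subset B.subset by auto
    show "g \<otimes> x \<otimes> inv g \<in> A <#> B"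
      unfolding ab(3) conj_mult[OF g car]
      using ab g A.inv_op_closed2 B.inv_op_closed2 by (intro set_mult_memI) auto
  qed
qed

end

context topological_group
begin

lemma continuous_map_conj: "g \<in> carrier G \<Longrightarrow> continuous_map T T (\<lambda>x. g \<otimes> x \<otimes> inv g)"
  by (intro continuous_map_mult continuous_map_const_carrier continuous_map_identity) auto

lemma closed_generate_normal:
  assumes S: "S \<subseteq> carrier G" and conj: "\<And>g x. g \<in> carrier G \<Longrightarrow> x \<in> S \<Longrightarrow> g \<otimes> x \<otimes> inv g \<in> S"
  shows "closed_generate G T S \<lhd> G"
  unfolding normal_iff_conj
proof (intro conjI ballI)
  show "subgroup (closed_generate G T S) G" using closed_generate_subgroup(1)[OF S] .
  fix g x assume g: "g \<in> carrier G" and x: "x \<in> closed_generate G T S"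
  have n: "generate G S \<lhd> G" using normal_generateI[OF S conj] .
  have "(\<lambda>x. g \<otimes> x \<otimes> inv g) ` (T closure_of generate G S) \<subseteq> T closure_of ((\<lambda>x. g \<otimes> x \<otimes> inv g) ` generate G S)"
    using continuous_map_conj[OF g] by (rule continuous_map_image_closure_subset)
  moreover have "(\<lambda>x. g \<otimes> x \<otimes> inv g) ` generate G S \<subseteq> generate G S"
    using n g unfolding normal_iff_conj by auto
  then have "T closure_of ((\<lambda>x. g \<otimes> x \<otimes> inv g) ` generate G S) \<subseteq> T closure_of generate G S"
    by (rule closure_of_mono)
  ultimately show "g \<otimes> x \<otimes> inv g \<in> closed_generate G T S"
    using x unfolding closed_generate_def by auto
qed

lemma closedin_centralizer_mod:
  assumes N: "closedin T N"
  shows "closedin T {u \<in> carrier G. \<forall>v\<in>carrier G. \<lbrakk>u,v\<rbrakk> \<in> N}"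
proof -
  have 1: "closedin T {u \<in> carrier G. \<lbrakk>u,v\<rbrakk> \<in> N}" if v: "v \<in> carrier G" for v
  proof -
    have "continuous_map T T (\<lambda>u. \<lbrakk>u,v\<rbrakk>)"
      unfolding group_commutator_def using v
      by (intro continuous_map_mult continuous_map_inv continuous_map_const_carrier continuous_map_identity) auto
    from closedin_continuous_map_preimage[OF this N] show ?thesis by (simp add: topspace_eq)
  qed
  have "{u \<in> carrier G. \<forall>v\<in>carrier G. \<lbrakk>u,v\<rbrakk> \<in> N} = (\<Inter>v\<in>carrier G. {u \<in> carrier G. \<lbrakk>u,v\<rbrakk> \<in> N})"
    using one_closed by blast
  moreover have "closedin T (\<Inter>v\<in>carrier G. {u \<in> carrier G. \<lbrakk>u,v\<rbrakk> \<in> N})"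
    using 1 one_closed by (intro closedin_INT) auto
  ultimately show ?thesis by simp
qed

lemma closedin_r_coset:
  assumes N: "closedin T N" "N \<subseteq> carrier G" and a: "a \<in> carrier G"
  shows "closedin T (N #> a)"
proof -
  have "continuous_map T T (\<lambda>u. u \<otimes> inv a)"
    using a by (intro continuous_map_mult continuous_map_const_carrier continuous_map_identity) auto
  from closedin_continuous_map_preimage[OF this N(1)]
  have "closedin T {u \<in> carrier G. u \<otimes> inv a \<in> N}" by (simp add: topspace_eq)
  moreover have "{u \<in> carrier G. u \<otimes> inv a \<in> N} = N #> a"
  proof (intro equalityI subsetI)
    fix u assume u: "u \<in> {u \<in> carrier G. u \<otimes> inv a \<in> N}"
    then have "u = (u \<otimes> inv a) \<otimes> a" using a by (simp add: m_assoc)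
    then show "u \<in> N #> a" using u unfolding r_coset_def by blast
  next
    fix u assume "u \<in> N #> a"
    then obtain z where "z \<in> N" "u = z \<otimes> a" by (auto simp: r_coset_def)
    then show "u \<in> {u \<in> carrier G. u \<otimes> inv a \<in> N}" using N(2) a by (auto simp: m_assoc)
  qed
  ultimately show ?thesis by simp
qed

end

context pro_p_group_prime
begin

abbreviation series :: "nat \<Rightarrow> 'a set" where
  "series \<equiv> lower_p_series p G T"

lemma compactin_closedin: "closedin T A \<Longrightarrow> compactin T A"
  using compact closedin_compact_space by blast

text \<open>The series is defined by a product of two closed subgroups; compactness keeps this
  product closed. Normality holds because the generating sets of both factors are stable under
  conjugation.\<close>

lemma series_normal_closed: "series i \<lhd> G \<and> closedin T (series i)"
proof (induction i)
  case 0
  show ?case using normal_self topspace_eq closedin_topspace[of T] by simp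
next
  case (Suc i)
  then interpret L: normal "series i" G by blast
  let ?P = "{h [^] p | h. h \<in> series i}"
  let ?C = "{h \<otimes> k \<otimes> inv h \<otimes> inv k | h k. h \<in> series i \<and> k \<in> carrier G}"
  have Lc: "x \<in> carrier G" if "x \<in> series i" for x using L.subset that by blast
  have Pc: "?P \<subseteq> carrier G" and Cc: "?C \<subseteq> carrier G" using Lc by auto
  have "closed_power G T (series i) p \<lhd> G"
    unfolding closed_power_def
  proof (rule closed_generate_normal[OF Pc])
    fix g x assume g: "g \<in> carrier G" and "x \<in> ?P"
    then obtain y where y: "y \<in> series i" "x = y [^] p" by blast
    then have "g \<otimes> x \<otimes> inv g = (g \<otimes> y \<otimes> inv g) [^] p" using conj_nat_pow[OF g Lc[OF y(1)]] by simp
    moreover have "g \<otimes> y \<otimes> inv g \<in> series i" using L.inv_op_closed2[OF g y(1)] .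
    ultimately show "g \<otimes> x \<otimes> inv g \<in> ?P" by blast
  qed
  moreover have "closed_commutator G T (series i) (carrier G) \<lhd> G"
    unfolding closed_commutator_def
  proof (rule closed_generate_normal[OF Cc])
    fix g x assume g: "g \<in> carrier G" and "x \<in> ?C"
    then obtain y z where y: "y \<in> series i" "z \<in> carrier G" "x = \<lbrakk>y,z\<rbrakk>" unfolding group_commutator_def by blast
    have "g \<otimes> x \<otimes> inv g = \<lbrakk>g \<otimes> y \<otimes> inv g, g \<otimes> z \<otimes> inv g\<rbrakk>"
      unfolding y(3) using g Lc[OF y(1)] y(2) by (simp add: group_commutator_def word_simps)
    moreover have "g \<otimes> y \<otimes> inv g \<in> series i" using L.inv_op_closed2[OF g y(1)] .
    moreover have "g \<otimes> z \<otimes> inv g \<in> carrier G" using g y(2) by simp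
    ultimately show "g \<otimes> x \<otimes> inv g \<in> ?C" unfolding group_commutator_def by blast
  qed
  moreover have "closedin T (closed_power G T (series i) p)" "closedin T (closed_commutator G T (series i) (carrier G))"
    by (simp_all add: closed_power_def closed_commutator_def closed_generate_def)
  then have "compactin T (closed_power G T (series i) p <#> closed_commutator G T (series i) (carrier G))"
    by (intro compactin_set_mult compactin_closedin)
  then have "closedin T (series (Suc i))" using Hausdorff compactin_imp_closedin by auto
  ultimately show ?case using normal_set_mult by simp
qed

lemma series_normal: "series i \<lhd> G" and series_closed: "closedin T (series i)"
  using series_normal_closed by auto

lemma series_subset: "series i \<subseteq> carrier G"
  using series_normal normal_imp_subgroup subgroup.subset by blast

lemma series_pow:
  assumes x: "x \<in> series i" shows "x [^] p \<in> series (Suc i)"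
proof -
  let ?P = "{h [^] p | h. h \<in> series i}"
  have Pc: "?P \<subseteq> carrier G" using series_subset by auto
  have "x [^] p \<in> closed_power G T (series i) p"
    unfolding closed_power_def using closed_generate_subgroup(3)[OF Pc] x by blast
  moreover have "\<one> \<in> closed_commutator G T (series i) (carrier G)"
  proof -
    have "{h \<otimes> k \<otimes> inv h \<otimes> inv k | h k. h \<in> series i \<and> k \<in> carrier G} \<subseteq> carrier G" using series_subset by auto
    then show ?thesis unfolding closed_commutator_def using closed_generate_subgroup(1) subgroup.one_closed by blast
  qed
  ultimately have "x [^] p \<otimes> \<one> \<in> series (Suc i)" by (simp add: set_mult_memI)
  moreover have "x \<in> carrier G" using x series_subset[of i] by blast
  ultimately show ?thesis by (simp del: lower_p_series.simps)
qed

lemma series_commutator: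
  assumes x: "x \<in> series i" and g: "g \<in> carrier G" shows "\<lbrakk>x,g\<rbrakk> \<in> series (Suc i)" "\<lbrakk>g,x\<rbrakk> \<in> series (Suc i)"
proof -
  let ?C = "{h \<otimes> k \<otimes> inv h \<otimes> inv k | h k. h \<in> series i \<and> k \<in> carrier G}"
  have xc: "x \<in> carrier G" using x series_subset[of i] by blast
  have Cc: "?C \<subseteq> carrier G" using series_subset by auto
  have "\<lbrakk>x,g\<rbrakk> \<in> ?C" unfolding group_commutator_def using x g by blast
  then have "\<lbrakk>x,g\<rbrakk> \<in> closed_commutator G T (series i) (carrier G)"
    unfolding closed_commutator_def using closed_generate_subgroup(3)[OF Cc] by blast
  moreover have "\<one> \<in> closed_power G T (series i) p"
  proof -
    have "{h [^] p | h. h \<in> series i} \<subseteq> carrier G" using series_subset by auto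
    then show ?thesis unfolding closed_power_def using closed_generate_subgroup(1) subgroup.one_closed by blast
  qed
  ultimately have "\<one> \<otimes> \<lbrakk>x,g\<rbrakk> \<in> series (Suc i)" by (simp add: set_mult_memI)
  then show 1: "\<lbrakk>x,g\<rbrakk> \<in> series (Suc i)" using xc g by (simp del: lower_p_series.simps)
  show "\<lbrakk>g,x\<rbrakk> \<in> series (Suc i)"
    using normal.commutator_swap_in[OF series_normal xc g 1] .
qed

text \<open>Inductions along the series use this to reduce a claim about the next term to
  \<open>p\<close>-th powers and commutators, provided the target is a closed subgroup.\<close>

lemma series_Suc_minimal:
  assumes M: "subgroup M G" "closedin T M"
    and pw: "\<And>x. x \<in> series i \<Longrightarrow> x [^] p \<in> M"
    and com: "\<And>x g. x \<in> series i \<Longrightarrow> g \<in> carrier G \<Longrightarrow> \<lbrakk>x,g\<rbrakk> \<in> M"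
  shows "series (Suc i) \<subseteq> M"
proof
  fix u assume "u \<in> series (Suc i)"
  then obtain a b where ab: "a \<in> closed_power G T (series i) p" "b \<in> closed_commutator G T (series i) (carrier G)" "u = a \<otimes> b"
    by (auto simp: set_mult_def)
  have "a \<in> M" using ab(1) closed_generate_minimal[OF M, of "{h [^] p | h. h \<in> series i}"] pw
    unfolding closed_power_def by blast
  moreover have "b \<in> M"
    using ab(2) closed_generate_minimal[OF M, of "{h \<otimes> k \<otimes> inv h \<otimes> inv k | h k. h \<in> series i \<and> k \<in> carrier G}"] com
    unfolding closed_commutator_def group_commutator_def by blast
  ultimately show "u \<in> M" using ab(3) subgroup.m_closed[OF M(1)] by simp
qed

declare lower_p_series.simps(2) [simp del]

lemma series_Suc_subset: "series (Suc i) \<subseteq> series i"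
proof (rule series_Suc_minimal)
  interpret L: normal "series i" G by (rule series_normal)
  show "subgroup (series i) G" by (rule L.subgroup_axioms)
  show "x [^] p \<in> series i" if "x \<in> series i" for x
    using subgroup_nat_pow_closed[OF L.subgroup_axioms that] .
  show "\<lbrakk>x,g\<rbrakk> \<in> series i" if "x \<in> series i" "g \<in> carrier G" for x g
    using L.commutator_in(2)[OF that(2,1)] .
qed (rule series_closed)

text \<open>Descent in the finite p-group \<open>G Mod N\<close>: once a term of the series maps
  into \<open>omega_mod p M\<close>, the next one maps into \<open>M\<close>, as it is generated by
  \<open>p\<close>-th powers and commutators.\<close>

lemma series_eventually_subset:
  assumes N: "open_normal N"
  shows "\<exists>i. series i \<subseteq> N"
proof -
  interpret N: normal N G using N by (rule open_normal_normal)
  interpret Q: group "G Mod N" by (rule N.factorgroup_is_group)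
  obtain k where k: "order (G Mod N) = p ^ k" using open_normal_order[OF N] by blast
  have "\<exists>i. \<forall>x\<in>series i. N #> x \<in> {\<one>\<^bsub>G Mod N\<^esub>}"
  proof (rule Q.p_group_descent[OF prime k, of "\<lambda>M. \<exists>i. \<forall>x\<in>series i. N #> x \<in> M"])
    show "\<exists>i. \<forall>x\<in>series i. N #> x \<in> carrier (G Mod N)"
      using N.coset_in_Mod by (intro exI[of _ 0]) auto
    show "{\<one>\<^bsub>G Mod N\<^esub>} \<lhd> G Mod N" by (rule Q.one_is_normal)
    fix M assume M: "M \<lhd> G Mod N" and "\<exists>i. \<forall>x\<in>series i. N #> x \<in> Q.omega_mod p M"
    then obtain i where i: "\<And>x. x \<in> series i \<Longrightarrow> N #> x \<in> Q.omega_mod p M" by blast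
    interpret M: normal M "G Mod N" by fact
    let ?M = "{x \<in> carrier G. N #> x \<in> M}"
    have "series (Suc i) \<subseteq> ?M"
    proof (rule series_Suc_minimal)
      show "subgroup ?M G"
      proof
        fix x y assume "x \<in> ?M" "y \<in> ?M"
        then show "x \<otimes> y \<in> ?M" using M.m_closed[of "N #> x" "N #> y"] N.coset_mult[of x y] by simp
      next
        fix x assume "x \<in> ?M"
        then show "inv x \<in> ?M" using M.m_inv_closed[of "N #> x"] N.coset_inv[of x] by simp
      next
        have "N #> \<one> = \<one>\<^bsub>G Mod N\<^esub>" using coset_mult_one[OF N.subset] by simp
        then show "\<one> \<in> ?M" using M.one_closed by simp
      qed auto
      show "closedin T ?M"
      proof -
        have "T closure_of ?M \<subseteq> ?M"
        proof
          fix x assume x: "x \<in> T closure_of ?M"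
          then obtain y where "y \<in> ?M" "N #> x = N #> y" using closure_approx[OF x N] by blast
          moreover have "x \<in> carrier G" using x topspace_eq in_closure_of by metis
          ultimately show "x \<in> ?M" by simp
        qed
        moreover have "?M \<subseteq> topspace T" using topspace_eq by auto
        ultimately show ?thesis using closure_of_subset_eq by blast
      qed
      fix x assume x: "x \<in> series i"
      then have xc: "x \<in> carrier G" using series_subset by blast
      have O: "(N #> x) [^]\<^bsub>G Mod N\<^esub> p \<in> M" "\<And>h. h \<in> carrier (G Mod N) \<Longrightarrow> \<lbrakk>h, N #> x\<rbrakk>\<^bsub>G Mod N\<^esub> \<in> M"
        using i[OF x] by (auto simp: Q.omega_mod_def)
      show "x [^] p \<in> ?M" using O(1) N.coset_nat_pow[OF xc] xc by simp
      fix g assume g: "g \<in> carrier G"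
      have "\<lbrakk>N #> x, N #> g\<rbrakk>\<^bsub>G Mod N\<^esub> \<in> M"
        by (rule M.commutator_swap_in[OF N.coset_in_Mod[OF g] N.coset_in_Mod[OF xc] O(2)[OF N.coset_in_Mod[OF g]]])
      then show "\<lbrakk>x,g\<rbrakk> \<in> ?M" using N.coset_commutator[OF xc g] xc g by simp
    qed
    then show "\<exists>i. \<forall>x\<in>series i. N #> x \<in> M" by blast
  qed
  then obtain i where "\<And>x. x \<in> series i \<Longrightarrow> N #> x = N" by auto
  then have "series i \<subseteq> N" using coset_join1 N.subgroup_axioms N.subset series_subset by blast
  then show ?thesis by blast
qed

text \<open>The quotient is abelian of exponent \<open>p\<close>, and the finitely many cosets met
  by a dense finitely generated subgroup form a closed set, hence everything. Finiteness matters
  because \<open>card\<close> is 0 on infinite sets, so only then do the equalities in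
  \<open>uniform\<close> compare sizes.\<close>

lemma finite_frattini_quotient:
  assumes fg: "topologically_fg G T"
  shows "finite (rcosets (series 1))"
proof -
  let ?F = "series 1"
  interpret F: normal ?F G by (rule series_normal)
  interpret Q: group "G Mod ?F" by (rule F.factorgroup_is_group)
  have lift: "\<exists>u\<in>carrier G. U = ?F #> u" if "U \<in> carrier (G Mod ?F)" for U
    using that by (auto simp: carrier_FactGroup)
  have one: "?F #> m = \<one>\<^bsub>G Mod ?F\<^esub>" if "m \<in> ?F" for m
    using that F.subset coset_join2[OF _ F.subgroup_axioms that] by auto
  interpret Q: comm_group "G Mod ?F"
  proof (rule Q.group_comm_groupI)
    fix X Y assume XY: "X \<in> carrier (G Mod ?F)" "Y \<in> carrier (G Mod ?F)"
    obtain x y where xy: "x \<in> carrier G" "X = ?F #> x" "y \<in> carrier G" "Y = ?F #> y" using lift XY by metis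
    have "\<lbrakk>x,y\<rbrakk> \<in> ?F" using series_commutator(1)[of x 0 y] xy by simp
    then have "\<lbrakk>X,Y\<rbrakk>\<^bsub>G Mod ?F\<^esub> = \<one>\<^bsub>G Mod ?F\<^esub>" using F.coset_commutator[OF xy(1,3)] one xy by simp
    then show "X \<otimes>\<^bsub>G Mod ?F\<^esub> Y = Y \<otimes>\<^bsub>G Mod ?F\<^esub> X" using Q.commutator_eq_one_iff[OF XY] by simp
  qed
  obtain S where S: "finite S" "S \<subseteq> carrier G" "closed_generate G T S = carrier G"
    using fg unfolding topologically_fg_def by blast
  let ?\<phi> = "\<lambda>a. ?F #> a"
  let ?W = "generate (G Mod ?F) (?\<phi> ` S)"
  have Sc: "?\<phi> ` S \<subseteq> carrier (G Mod ?F)" using S(2) F.coset_in_Mod by auto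
  have fin: "finite ?W"
  proof (rule Q.finite_generate_exponent[OF finite_imageI[OF S(1)] Sc p_pos])
    fix X assume "X \<in> carrier (G Mod ?F)"
    then obtain x where x: "x \<in> carrier G" "X = ?F #> x" using lift by blast
    have "x [^] p \<in> ?F" using series_pow[of x 0] x by simp
    then show "X [^]\<^bsub>G Mod ?F\<^esub> p = \<one>\<^bsub>G Mod ?F\<^esub>" using F.coset_nat_pow[OF x(1)] one x(2) by simp
  qed
  let ?K = "\<Union>?W"
  have WQ: "?W \<subseteq> carrier (G Mod ?F)" using Q.generate_incl[OF Sc] .
  have "closedin T ?K"
  proof (rule closedin_Union[OF fin])
    fix X assume "X \<in> ?W"
    then obtain x where "x \<in> carrier G" "X = ?F #> x" using lift WQ by blast
    then show "closedin T X" using closedin_r_coset[OF series_closed F.subset] by simp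
  qed
  moreover have "generate G S \<subseteq> ?K"
  proof
    fix g assume g: "g \<in> generate G S"
    interpret \<phi>: group_hom G "G Mod ?F" ?\<phi>
      by (intro group_hom.intro group_hom_axioms.intro is_group F.factorgroup_is_group F.r_coset_hom_Mod)
    have "?\<phi> g \<in> ?W" using \<phi>.generate_img[OF S(2)] g by simp
    moreover have "g \<in> ?\<phi> g" using rcos_self[OF generate_in_carrier[OF S(2) g] F.subgroup_axioms] .
    ultimately show "g \<in> ?K" by blast
  qed
  ultimately have K: "carrier G \<subseteq> ?K" using S(3) closure_of_minimal unfolding closed_generate_def by metis
  have "rcosets ?F \<subseteq> ?W"
  proof
    fix X assume "X \<in> rcosets ?F"
    then obtain x where x: "x \<in> carrier G" "X = ?F #> x" by (auto simp: RCOSETS_def)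
    obtain Y where Y: "Y \<in> ?W" "x \<in> Y" using K x(1) by blast
    obtain y where y: "y \<in> carrier G" "Y = ?F #> y" using lift WQ Y(1) by blast
    have "?F #> y = ?F #> x" using repr_independence[OF _ y(1) F.subgroup_axioms] Y(2) y(2) by simp
    then show "X \<in> ?W" using x y Y by simp
  qed
  then show ?thesis using fin by (rule finite_subset)
qed

text \<open>For \<open>p = 2\<close> powerfulness makes \<open>[L\<^sub>i, G]\<close> drop by two steps of the lower \<open>2\<close>-series; this is what makes
  squaring a homomorphism \<open>L\<^sub>i / L\<^sub>i\<^sub>+\<^sub>1 \<rightarrow> L\<^sub>i\<^sub>+\<^sub>1 / L\<^sub>i\<^sub>+\<^sub>2\<close>. For odd \<open>p\<close> the collection formula suffices.\<close>

lemma powerful_commutator: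
  assumes pw: "powerful p G T" and xy: "x \<in> carrier G" "y \<in> carrier G"
  shows "\<lbrakk>x,y\<rbrakk> \<in> closed_generate G T {h [^] powerful_exponent | h. h \<in> carrier G}"
proof -
  let ?C = "{h \<otimes> k \<otimes> inv h \<otimes> inv k | h k. h \<in> carrier G \<and> k \<in> carrier G}"
  have "?C \<subseteq> carrier G" by auto
  then have "?C \<subseteq> closed_generate G T ?C" by (rule closed_generate_subgroup(3))
  moreover have "\<lbrakk>x,y\<rbrakk> \<in> ?C" unfolding group_commutator_def using xy by blast
  ultimately show ?thesis
    using pw unfolding powerful_def closed_commutator_def closed_power_def powerful_exponent_def by blast
qed

lemma series_commutator_two:
  assumes pw: "powerful p G T" and p2: "p = 2" and x: "x \<in> series i" and g: "g \<in> carrier G"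
  shows "\<lbrakk>x,g\<rbrakk> \<in> series (i + 2)"
  using x g
proof (induction i arbitrary: x g)
  case 0
  \<comment> \<open>A fourth power is the square of a square, so it lies two steps down the
    series.\<close>
  have "closed_generate G T {h [^] powerful_exponent | h. h \<in> carrier G} \<subseteq> series 2"
  proof (rule closed_generate_minimal)
    show "subgroup (series 2) G" using series_normal normal_imp_subgroup by blast
    show "{h [^] powerful_exponent | h. h \<in> carrier G} \<subseteq> series 2"
    proof clarify
      fix h assume h: "h \<in> carrier G"
      have "(h [^] p) [^] p \<in> series (Suc (Suc 0))"
        using series_pow[of "h [^] p" "Suc 0"] series_pow[of h 0] h by simp
      moreover have "(h [^] p) [^] p = h [^] powerful_exponent"
      proof -
        have "powerful_exponent = p * p" unfolding powerful_exponent_def using p2 by simp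
        then show ?thesis using nat_pow_pow[OF h, of p p] by (simp only:)
      qed
      ultimately show "h [^] powerful_exponent \<in> series 2" by (simp add: numeral_2_eq_2)
    qed
  qed (rule series_closed)
  then have "\<lbrakk>x,g\<rbrakk> \<in> series 2" using powerful_commutator[OF pw, of x g] 0 by auto
  then show ?case by (simp add: numeral_2_eq_2)
next
  case (Suc i)
  let ?N = "series (i + 3)"
  interpret N: normal ?N G by (rule series_normal)
  have "series (Suc i) \<subseteq> {u \<in> carrier G. \<forall>v\<in>carrier G. \<lbrakk>u,v\<rbrakk> \<in> ?N}"
  proof (rule series_Suc_minimal)
    show "subgroup {u \<in> carrier G. \<forall>v\<in>carrier G. \<lbrakk>u,v\<rbrakk> \<in> ?N} G" by (rule N.centralizer_mod_subgroup) simp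
    show "closedin T {u \<in> carrier G. \<forall>v\<in>carrier G. \<lbrakk>u,v\<rbrakk> \<in> ?N}"
      by (rule closedin_centralizer_mod[OF series_closed])
    fix x assume x: "x \<in> series i"
    have xc: "x \<in> carrier G" using x series_subset by blast
    show "\<lbrakk>x,g\<rbrakk> \<in> {u \<in> carrier G. \<forall>v\<in>carrier G. \<lbrakk>u,v\<rbrakk> \<in> ?N}" if g: "g \<in> carrier G" for g
    proof -
      have "\<lbrakk>x,g\<rbrakk> \<in> series (i + 2)" by (rule Suc.IH[OF x g])
      then have "\<lbrakk>\<lbrakk>x,g\<rbrakk>,v\<rbrakk> \<in> ?N" if "v \<in> carrier G" for v
        using series_commutator(1)[of "\<lbrakk>x,g\<rbrakk>" "i + 2" v] that by (simp add: eval_nat_numeral)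
      then show ?thesis using xc g by simp
    qed
    \<comment> \<open>For \<open>p = 2\<close> one has \<open>[x^2,v] = [x,c] c^2\<close> with
      \<open>c = [x,v]\<close>. By induction \<open>c\<close> is already two steps down, and both
      factors gain one more.\<close>
    have "\<lbrakk>x [^] p, v\<rbrakk> \<in> ?N" if v: "v \<in> carrier G" for v
    proof -
      let ?c = "\<lbrakk>x,v\<rbrakk>"
      have c: "?c \<in> series (i + 2)" by (rule Suc.IH[OF x v])
      have cc: "?c \<in> carrier G" using xc v by simp
      have "\<lbrakk>x [^] p, v\<rbrakk> = x \<otimes> ?c \<otimes> inv x \<otimes> ?c"
        using commutator_mult_left[OF xc xc v] xc p2 by (simp add: numeral_2_eq_2)
      also have "\<dots> = \<lbrakk>x,?c\<rbrakk> \<otimes> ?c [^] p"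
        using conj_eq_commutator_mult[OF xc cc] xc cc p2 by (simp add: numeral_2_eq_2 m_assoc)
      finally have e: "\<lbrakk>x [^] p, v\<rbrakk> = \<lbrakk>x,?c\<rbrakk> \<otimes> ?c [^] p" .
      have "\<lbrakk>x,?c\<rbrakk> \<in> ?N" "?c [^] p \<in> ?N"
        using series_commutator(2)[OF c xc] series_pow[OF c] by (simp_all add: eval_nat_numeral)
      then show ?thesis unfolding e by (rule N.m_closed)
    qed
    then show "x [^] p \<in> {u \<in> carrier G. \<forall>v\<in>carrier G. \<lbrakk>u,v\<rbrakk> \<in> ?N}" using xc by simp
  qed
  then show ?case using Suc.prems by (auto simp: eval_nat_numeral)
qed

lemma odd_prime_dvd_sum: "p \<noteq> 2 \<Longrightarrow> p dvd (\<Sum>i<p. i)"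
  using dvd_sum_lessThan[OF prime] by simp

text \<open>The commutator \<open>[y,x]\<close> lies in the next term and is therefore central
  modulo \<open>series (i + 2)\<close>. The class-two formula leaves the power of it with exponent
  \<open>p(p-1)/2\<close>: for odd \<open>p\<close> this is a multiple of \<open>p\<close>, for
  \<open>p = 2\<close> the commutator itself is deep enough.\<close>

lemma series_pow_mult:
  assumes pw: "powerful p G T" and x: "x \<in> series i" and y: "y \<in> series i"
  shows "\<exists>z\<in>series (i + 2). (x \<otimes> y) [^] p = x [^] p \<otimes> y [^] p \<otimes> z"
proof -
  interpret N: normal "series (i + 2)" G by (rule series_normal)
  have xc: "x \<in> carrier G" and yc: "y \<in> carrier G" using x y series_subset by blast+
  let ?e = "\<lbrakk>y,x\<rbrakk>" and ?s = "\<Sum>i<p. i"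
  have e1: "?e \<in> series (Suc i)" by (rule series_commutator(1)[OF y xc])
  have "\<exists>z\<in>series (i + 2). (x \<otimes> y) [^] p = x [^] p \<otimes> y [^] p \<otimes> ?e [^] ?s \<otimes> z"
    using series_commutator(2)[OF e1] by (intro N.pow_mult_class_two_mod[OF xc yc]) simp
  then obtain z where z: "z \<in> series (i + 2)" "(x \<otimes> y) [^] p = x [^] p \<otimes> y [^] p \<otimes> ?e [^] ?s \<otimes> z" by blast
  have "?e [^] ?s \<in> series (i + 2)"
  proof (cases "p = 2")
    case True
    then show ?thesis
      using subgroup_nat_pow_closed[OF N.subgroup_axioms series_commutator_two[OF pw True y xc]] by blast
  next
    case False
    then obtain s where s: "?s = p * s" using odd_prime_dvd_sum by (metis dvdE)
    have "?e [^] p \<in> series (i + 2)" using series_pow[OF e1] by simp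
    then have "(?e [^] p) [^] s \<in> series (i + 2)" by (rule subgroup_nat_pow_closed[OF N.subgroup_axioms])
    then show ?thesis using s xc yc by (simp add: nat_pow_pow)
  qed
  then have "?e [^] ?s \<otimes> z \<in> series (i + 2)" using z(1) by (rule N.m_closed)
  moreover have "z \<in> carrier G" using z(1) N.subset by blast
  then have "(x \<otimes> y) [^] p = x [^] p \<otimes> y [^] p \<otimes> (?e [^] ?s \<otimes> z)"
    using z(2) xc yc by (simp add: m_assoc)
  ultimately show ?thesis by blast
qed

section \<open>The p-th power map between successive factors\<close>

definition pow_series :: "nat \<Rightarrow> 'a set" where
  "pow_series i = (\<lambda>x. x [^] p) ` series i <#> series (i + 2)"

lemma pow_seriesI: "y \<in> series i \<Longrightarrow> z \<in> series (i + 2) \<Longrightarrow> y [^] p \<otimes> z \<in> pow_series i"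
  unfolding pow_series_def by (intro set_mult_memI imageI)

lemma pow_seriesE:
  assumes "x \<in> pow_series i"
  obtains y z where "y \<in> series i" "z \<in> series (i + 2)" "x = y [^] p \<otimes> z"
  using set_mult_image_memD[of x G "\<lambda>x. x [^] p" "series i" "series (i + 2)"] assms
  unfolding pow_series_def by blast

lemma pow_series_subgroup:
  assumes pw: "powerful p G T"
  shows "subgroup (pow_series i) G" "closedin T (pow_series i)"
proof -
  interpret L: normal "series i" G by (rule series_normal)
  interpret N: normal "series (i + 2)" G by (rule series_normal)
  show "subgroup (pow_series i) G"
  proof
    show "pow_series i \<subseteq> carrier G"
      using L.subset N.subset by (auto simp: pow_series_def set_mult_def)
    show "\<one> \<in> pow_series i" using pow_seriesI[OF L.one_closed N.one_closed] by simp
    fix u assume "u \<in> pow_series i"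
    then obtain y z where u: "y \<in> series i" "z \<in> series (i + 2)" "u = y [^] p \<otimes> z" by (rule pow_seriesE)
    have uc: "y \<in> carrier G" "z \<in> carrier G" using u L.subset N.subset by auto
    have yp: "y [^] p \<in> carrier G" using uc by simp
    have "inv u = inv y [^] p \<otimes> (y [^] p \<otimes> inv z \<otimes> inv (y [^] p))"
      using u(3) uc by (simp add: nat_pow_inv inv_mult_group m_assoc)
    moreover have "y [^] p \<otimes> inv z \<otimes> inv (y [^] p) \<in> series (i + 2)"
      by (rule N.inv_op_closed2[OF yp N.m_inv_closed[OF u(2)]])
    ultimately show "inv u \<in> pow_series i" using pow_seriesI u(1) by simp
    fix v assume "v \<in> pow_series i"
    then obtain y' z' where v: "y' \<in> series i" "z' \<in> series (i + 2)" "v = y' [^] p \<otimes> z'" by (rule pow_seriesE)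
    have vc: "y' \<in> carrier G" "z' \<in> carrier G" using v L.subset N.subset by auto
    have yp': "y' [^] p \<in> carrier G" using vc by simp
    obtain w where w: "w \<in> series (i + 2)" "(y \<otimes> y') [^] p = y [^] p \<otimes> y' [^] p \<otimes> w"
      using series_pow_mult[OF pw u(1) v(1)] by blast
    have wc: "w \<in> carrier G" using w(1) N.subset by blast
    have "u \<otimes> v = (y \<otimes> y') [^] p \<otimes> (inv w \<otimes> (inv (y' [^] p) \<otimes> z \<otimes> y' [^] p) \<otimes> z')"
      unfolding w(2) u(3) v(3) using uc vc wc by (simp add: m_assoc)
    moreover have "inv w \<otimes> (inv (y' [^] p) \<otimes> z \<otimes> y' [^] p) \<otimes> z' \<in> series (i + 2)"
      by (intro N.m_closed N.m_inv_closed N.inv_op_closed1[OF yp' u(2)] w(1) v(2))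
    ultimately show "u \<otimes> v \<in> pow_series i" using pow_seriesI u(1) v(1) by simp
  qed
  have "compactin T (pow_series i)"
    unfolding pow_series_def
    by (intro compactin_set_mult compactin_pow_image compactin_closedin series_closed)
  then show "closedin T (pow_series i)" using Hausdorff compactin_imp_closedin by blast
qed

lemma pow_series_absorb: "z \<in> series (i + 2) \<Longrightarrow> z \<in> pow_series i"
  using pow_seriesI[of \<one> i z] normal_imp_subgroup[OF series_normal, THEN subgroup.one_closed, of i]
    series_subset[of "i + 2"] by auto

lemma pow_in_pow_series: "y \<in> series i \<Longrightarrow> y [^] p \<in> pow_series i"
  using pow_seriesI[of y i \<one>] normal_imp_subgroup[OF series_normal, THEN subgroup.one_closed, of "i + 2"]
    series_subset[of i] by auto

text \<open>This is surjectivity of the \<open>p\<close>-th power map from one factor of the series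
  onto the next. The work lies in the commutators \<open>[x,g]\<close>: for \<open>p = 2\<close>
  they are two steps down, and for odd \<open>p\<close> powerfulness handles the first term. Further
  down, write \<open>x = y^p z\<close>; then \<open>[g,y^p] = ([g,y] y)^p y^(-p)\<close> is
  \<open>[g,y]^p\<close> up to deeper terms.\<close>

lemma series_Suc_subset_pow_series:
  assumes pw: "powerful p G T"
  shows "series (Suc i) \<subseteq> pow_series i"
proof (induction i)
  case 0
  show ?case
  proof (rule series_Suc_minimal[OF pow_series_subgroup[OF pw] pow_in_pow_series])
    fix x g assume x: "x \<in> series 0" and g: "g \<in> carrier G"
    show "\<lbrakk>x,g\<rbrakk> \<in> pow_series 0"
    proof (cases "p = 2")
      case True
      then show ?thesis using pow_series_absorb[of "\<lbrakk>x,g\<rbrakk>" 0] series_commutator_two[OF pw True x g] by simp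
    next
      case False
      have "closed_generate G T {h [^] powerful_exponent | h. h \<in> carrier G} \<subseteq> pow_series 0"
        by (rule closed_generate_minimal[OF pow_series_subgroup[OF pw]])
          (use False pow_in_pow_series[of _ 0] in \<open>auto simp: powerful_exponent_def\<close>)
      then show ?thesis using powerful_commutator[OF pw _ g, of x] x by auto
    qed
  qed
next
  case (Suc i)
  let ?R = "pow_series (Suc i)"
  note R = pow_series_subgroup[OF pw, of "Suc i"]
  show ?case
  proof (rule series_Suc_minimal[OF R pow_in_pow_series])
    fix x g assume x: "x \<in> series (Suc i)" and g: "g \<in> carrier G"
    show "\<lbrakk>x,g\<rbrakk> \<in> ?R"
    proof (cases "p = 2")
      case True
      then show ?thesis using pow_series_absorb[of "\<lbrakk>x,g\<rbrakk>" "Suc i"] series_commutator_two[OF pw True x g] by simp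
    next
      case False
      interpret N: normal "series (i + 3)" G by (rule series_normal)
      have absorb: "u \<in> ?R" if "u \<in> series (i + 3)" for u
        using pow_series_absorb[of u "Suc i"] that by (simp add: eval_nat_numeral)
      obtain y z where yz: "y \<in> series i" "z \<in> series (i + 2)" "x = y [^] p \<otimes> z"
        using Suc.IH x by (blast elim: pow_seriesE)
      have car: "y \<in> carrier G" "z \<in> carrier G" using yz series_subset by blast+
      have yp: "y [^] p \<in> carrier G" using car by simp
      have "\<lbrakk>z,g\<rbrakk> \<in> series (i + 3)" using series_commutator(1)[OF yz(2) g] by (simp add: eval_nat_numeral)
      then have 1: "y [^] p \<otimes> \<lbrakk>z,g\<rbrakk> \<otimes> inv (y [^] p) \<in> ?R" by (intro absorb N.inv_op_closed2[OF yp])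
      let ?c = "\<lbrakk>g,y\<rbrakk>"
      have c: "?c \<in> series (Suc i)" by (rule series_commutator(2)[OF yz(1) g])
      have cc: "?c \<in> carrier G" using g car by simp
      let ?e = "\<lbrakk>y,?c\<rbrakk>" and ?s = "\<Sum>i<p. i"
      have e: "?e \<in> series (i + 2)" using series_commutator(2)[OF c car(1)] by simp
      have "\<exists>w\<in>series (i + 3). (?c \<otimes> y) [^] p = ?c [^] p \<otimes> y [^] p \<otimes> ?e [^] ?s \<otimes> w"
        using series_commutator(2)[OF e] by (intro N.pow_mult_class_two_mod[OF cc car(1)]) (simp add: eval_nat_numeral)
      then obtain w where w: "w \<in> series (i + 3)" "(?c \<otimes> y) [^] p = ?c [^] p \<otimes> y [^] p \<otimes> ?e [^] ?s \<otimes> w" by blast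
      obtain s where s: "?s = p * s" using odd_prime_dvd_sum[OF False] by (metis dvdE)
      have ec: "?e \<in> carrier G" using cc car by simp
      have "?e [^] p \<in> series (i + 3)" using series_pow[OF e] by (simp add: eval_nat_numeral)
      then have "(?e [^] p) [^] s \<in> series (i + 3)" by (rule subgroup_nat_pow_closed[OF N.subgroup_axioms])
      then have es: "?e [^] ?s \<in> series (i + 3)" using s ec by (simp add: nat_pow_pow)
      let ?v = "?e [^] ?s \<otimes> w"
      have v: "?v \<in> series (i + 3)" using es w(1) by (rule N.m_closed)
      have vc: "?v \<in> carrier G" using v N.subset by blast
      have wc: "w \<in> carrier G" using w(1) N.subset by blast
      have "\<lbrakk>g, y [^] p\<rbrakk> = (g \<otimes> y \<otimes> inv g) [^] p \<otimes> inv (y [^] p)"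
        unfolding group_commutator_def conj_nat_pow[OF g car(1), symmetric] ..
      also have "\<dots> = ?c [^] p \<otimes> (y [^] p \<otimes> ?v \<otimes> inv (y [^] p))"
        unfolding conj_eq_commutator_mult[OF g car(1)] w(2) using cc car ec wc by (simp add: m_assoc)
      finally have "\<lbrakk>g, y [^] p\<rbrakk> = ?c [^] p \<otimes> (y [^] p \<otimes> ?v \<otimes> inv (y [^] p))" .
      moreover have "?c [^] p \<in> ?R" by (rule pow_in_pow_series[OF c])
      moreover have "y [^] p \<otimes> ?v \<otimes> inv (y [^] p) \<in> ?R" by (intro absorb N.inv_op_closed2[OF yp v])
      ultimately have "\<lbrakk>g, y [^] p\<rbrakk> \<in> ?R" using subgroup.m_closed[OF R(1)] by simp
      then have 2: "\<lbrakk>y [^] p, g\<rbrakk> \<in> ?R" using inv_commutator[OF g yp] subgroup.m_inv_closed[OF R(1)] by metis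
      show ?thesis
        unfolding yz(3) commutator_mult_left[OF yp car(2) g] by (rule subgroup.m_closed[OF R(1) 1 2])
    qed
  qed
qed

text \<open>The power map between successive factors is surjective, and uniformity gives both
  factors the same finite size, so it is also injective.\<close>

lemma uniform_pow_injective:
  assumes un: "uniform p G T" and x: "x \<in> series i" and xp: "x [^] p \<in> series (i + 2)"
  shows "x \<in> series (Suc i)"
proof -
  have pw: "powerful p G T" and fg: "topologically_fg G T" using un by (auto simp: uniform_def)
  interpret L: normal "series i" G by (rule series_normal)
  interpret L1: normal "series (Suc i)" G by (rule series_normal)
  interpret L2: normal "series (i + 2)" G by (rule series_normal)
  define S where "S j = (\<lambda>a. series (Suc j) #> a) ` series j" for j
  have rc: "rcosets\<^bsub>G\<lparr>carrier := series j\<rparr>\<^esub> (series (Suc j)) = S j" for j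
    unfolding RCOSETS_def S_def by auto
  have "card (S j) = card (rcosets (frattini p G T))" for j
    using un unfolding uniform_def rc[symmetric] by blast
  moreover have "frattini p G T = series 1" by (simp add: frattini_def)
  moreover have "card (rcosets (series 1)) > 0"
  proof -
    have "rcosets (series 1) \<noteq> {}" using one_closed by (auto simp: RCOSETS_def)
    then show ?thesis using finite_frattini_quotient[OF fg] by (simp add: card_gt_0_iff)
  qed
  ultimately have cS: "card (S j) = card (rcosets (series 1))" "card (S j) > 0" for j by simp_all
  then have finS: "finite (S j)" for j using card_ge_0_finite by blast
  \<comment> \<open>The map on cosets is set up through chosen representatives; \<open>fa\<close>
    shows that the choice does not matter, by \<open>series_pow_mult\<close>.\<close>
  define r where "r C = (SOME a. a \<in> series i \<and> C = series (Suc i) #> a)" for C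
  define f where "f C = series (i + 2) #> (r C [^] p)" for C
  have r: "r (series (Suc i) #> a) \<in> series i \<and> series (Suc i) #> a = series (Suc i) #> r (series (Suc i) #> a)"
    if "a \<in> series i" for a
    unfolding r_def by (rule someI[of _ a]) (use that in simp)
  have fa: "f (series (Suc i) #> a) = series (i + 2) #> (a [^] p)" if a: "a \<in> series i" for a
  proof -
    let ?b = "r (series (Suc i) #> a)"
    have ac: "a \<in> carrier G" using a L.subset by blast
    have b: "?b \<in> series i" "series (Suc i) #> ?b = series (Suc i) #> a" using r[OF a] by auto
    have bc: "?b \<in> carrier G" using b L.subset by blast
    obtain z where z: "z \<in> series (Suc i)" "?b = a \<otimes> z" using L1.coset_eq_iff[OF bc ac] b(2) by blast
    have zi: "z \<in> series i" using z(1) series_Suc_subset by blast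
    obtain w where w: "w \<in> series (i + 2)" "(a \<otimes> z) [^] p = a [^] p \<otimes> z [^] p \<otimes> w"
      using series_pow_mult[OF pw a zi] by blast
    have zp: "z [^] p \<in> series (i + 2)" using series_pow[OF z(1)] by simp
    have car: "z [^] p \<in> carrier G" "w \<in> carrier G" using zp w(1) L2.subset by blast+
    have "?b [^] p = a [^] p \<otimes> (z [^] p \<otimes> w)" using w(2) z(2) ac car by (simp add: m_assoc)
    moreover have "z [^] p \<otimes> w \<in> series (i + 2)" using zp w(1) by (rule L2.m_closed)
    ultimately have "series (i + 2) #> (?b [^] p) = series (i + 2) #> (a [^] p)"
      using L2.coset_eq_iff[of "?b [^] p" "a [^] p"] ac bc by auto
    then show ?thesis by (simp add: f_def)
  qed
  have "f ` S i = S (Suc i)"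
  proof (intro equalityI subsetI)
    fix Y assume "Y \<in> f ` S i"
    then obtain a where a: "a \<in> series i" "Y = f (series (Suc i) #> a)" unfolding S_def by blast
    then show "Y \<in> S (Suc i)" using fa[OF a(1)] series_pow[OF a(1)] unfolding S_def by auto
  next
    fix Y assume "Y \<in> S (Suc i)"
    then obtain y where y: "y \<in> series (Suc i)" "Y = series (Suc (Suc i)) #> y" unfolding S_def by blast
    then obtain a z where az: "a \<in> series i" "z \<in> series (i + 2)" "y = a [^] p \<otimes> z"
      using series_Suc_subset_pow_series[OF pw, of i] by (blast elim: pow_seriesE)
    have ac: "a \<in> carrier G" using az L.subset by blast
    have yc: "y \<in> carrier G" using y(1) L1.subset by blast
    have "Y = series (i + 2) #> (a [^] p)"
      using L2.coset_eq_iff[of y "a [^] p"] ac yc az y(2) by auto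
    then have "Y = f (series (Suc i) #> a)" using fa[OF az(1)] by simp
    then show "Y \<in> f ` S i" using az(1) unfolding S_def by blast
  qed
  then have inj: "inj_on f (S i)" using eq_card_imp_inj_on[OF finS, of f i] cS by simp
  have xc: "x \<in> carrier G" using x L.subset by blast
  have "f (series (Suc i) #> x) = series (i + 2)"
    using fa[OF x] coset_join2[OF _ L2.subgroup_axioms xp] xc by simp
  also have "\<dots> = f (series (Suc i) #> \<one>)"
    using fa[OF L.one_closed] coset_join2[OF _ L2.subgroup_axioms L2.one_closed] by simp
  finally have "series (Suc i) #> x = series (Suc i) #> \<one>"
    using inj_onD[OF inj] x L.one_closed unfolding S_def by blast
  then obtain z where "z \<in> series (Suc i)" "x = \<one> \<otimes> z" using L1.coset_eq_iff[OF xc one_closed] by blast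
  then show ?thesis using L1.subset by auto
qed

lemma eq_one_if_in_series:
  assumes "x \<in> carrier G" "\<And>i. x \<in> series i"
  shows "x = \<one>"
proof (rule eq_if_cosets_eq[OF assms(1) one_closed])
  fix N assume N: "open_normal N"
  interpret N: normal N G using N by (rule open_normal_normal)
  obtain i where "series i \<subseteq> N" using series_eventually_subset[OF N] by blast
  then have "x \<in> N" using assms(2) by blast
  then show "N #> x = N #> \<one>" using N.coset_eq_iff[OF assms(1) one_closed] assms(1) by auto
qed

text \<open>As \<open>x^p = 1\<close> lies in every term, injectivity pushes \<open>x\<close> down
  the series one step after another, and the terms of the series have trivial intersection.\<close>

lemma uniform_torsion_free:
  assumes un: "uniform p G T" and x: "x \<in> carrier G" and xp: "x [^] p = \<one>"
  shows "x = \<one>"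
proof (rule eq_one_if_in_series[OF x])
  fix i show "x \<in> series i"
  proof (induction i)
    case (Suc i)
    have "x [^] p \<in> series (i + 2)"
      using xp normal_imp_subgroup[OF series_normal, THEN subgroup.one_closed] by simp
    then show ?case by (rule uniform_pow_injective[OF un Suc])
  qed (use x in simp)
qed

end

section \<open>The orientation of a locally powerful group\<close>

lemma padic_const_nonzero:
  assumes "p > 1" "k \<noteq> 0"
  shows "\<not> padic_eq p (\<lambda>_. k) (\<lambda>_. 0)"
proof
  assume "padic_eq p (\<lambda>_. k) (\<lambda>_. 0)"
  then have "int p ^ nat \<bar>k\<bar> dvd k" by (auto simp: padic_eq_def cong_0_iff)
  then have "\<bar>int p ^ nat \<bar>k\<bar>\<bar> \<le> \<bar>k\<bar>" by (rule dvd_imp_le_int[OF assms(2)])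
  moreover have "int (nat \<bar>k\<bar>) < int p ^ nat \<bar>k\<bar>"
  proof -
    have "nat \<bar>k\<bar> < p ^ nat \<bar>k\<bar>" using assms(1) by (intro power_gt_expt) simp
    then show ?thesis by (simp only: of_nat_less_iff of_nat_power[symmetric])
  qed
  ultimately show False by simp
qed

context group
begin

lemma conj_commutator:
  assumes "g \<in> carrier G" "x \<in> carrier G" "y \<in> carrier G"
  shows "g \<otimes> \<lbrakk>x,y\<rbrakk> \<otimes> inv g = \<lbrakk>g \<otimes> x \<otimes> inv g, g \<otimes> y \<otimes> inv g\<rbrakk>"
  using assms by (simp add: group_commutator_def word_simps)

lemma conj_eq_one_iff:
  assumes "g \<in> carrier G" "x \<in> carrier G"
  shows "g \<otimes> x \<otimes> inv g = \<one> \<longleftrightarrow> x = \<one>"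
proof
  assume "g \<otimes> x \<otimes> inv g = \<one>"
  then have "inv g \<otimes> (g \<otimes> x \<otimes> inv g) \<otimes> g = \<one>" using assms by simp
  then show "x = \<one>" using assms by (simp add: m_assoc)
qed (use assms in simp)

lemma commute_mult:
  assumes "g \<in> carrier G" "x \<in> carrier G" "y \<in> carrier G" "g \<otimes> x = x \<otimes> g" "g \<otimes> y = y \<otimes> g"
  shows "g \<otimes> (x \<otimes> y) = x \<otimes> y \<otimes> g"
proof -
  have "g \<otimes> (x \<otimes> y) \<otimes> inv g = x \<otimes> y"
    using assms conj_mult[of g x y] conj_eq_iff_commute[of g x] conj_eq_iff_commute[of g y] by simp
  then show ?thesis using assms conj_eq_iff_commute[of g "x \<otimes> y"] by simp
qed

lemma commute_inv:
  assumes "g \<in> carrier G" "x \<in> carrier G" "g \<otimes> x = x \<otimes> g"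
  shows "g \<otimes> inv x = inv x \<otimes> g"
proof -
  have "g \<otimes> inv x \<otimes> inv g = inv x"
    using assms conj_inv[of g x] conj_eq_iff_commute[of g x] by simp
  then show ?thesis using assms conj_eq_iff_commute[of g "inv x"] by simp
qed

end

context pro_p_group_prime
begin

lemma commute_ppow:
  assumes "g \<in> carrier G" "x \<in> carrier G" "coherent p a" "g \<otimes> x = x \<otimes> g"
  shows "g \<otimes> ppow x a = ppow x a \<otimes> g"
proof -
  have "g \<otimes> x \<otimes> inv g = x" by (rule iffD2[OF conj_eq_iff_commute[OF assms(1,2)] assms(4)])
  then have "g \<otimes> ppow x a \<otimes> inv g = ppow x a" using ppow_conj[OF assms(1-3)] by simp
  then show ?thesis by (rule iffD1[OF conj_eq_iff_commute[OF assms(1) ppow_closed[OF assms(2,3)]]])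
qed

end

section \<open>Cancellation rules for p-adic exponents\<close>

locale torsion_free_locally_powerful = pro_p_group_prime +
  assumes locally_powerful: "locally_powerful p G T"
    and torsion_free: "\<And>x. x \<in> carrier G \<Longrightarrow> x [^] p = \<one> \<Longrightarrow> x = \<one>"
begin

abbreviation zero_exponent :: "(nat \<Rightarrow> int) \<Rightarrow> bool" where
  "zero_exponent a \<equiv> padic_eq p a (\<lambda>_. 0)"

lemma pow_p_power_eq_one:
  assumes "x \<in> carrier G" "x [^] (p ^ m) = \<one>"
  shows "x = \<one>"
  using assms(2)
proof (induction m)
  case (Suc m)
  have "(x [^] (p ^ m)) [^] p = \<one>" using Suc.prems assms(1) by (simp add: nat_pow_pow mult.commute)
  then have "x [^] (p ^ m) = \<one>" by (rule torsion_free[OF nat_pow_closed[OF assms(1)]])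
  then show ?case by (rule Suc.IH)
qed (use assms(1) in simp)

text \<open>A nonzero \<open>a\<close> has a multiple equal to \<open>p^m\<close>, so
  \<open>x\<close> would be killed by \<open>p^m\<close>.\<close>

lemma ppow_eq_one:
  assumes x: "x \<in> carrier G" and a: "coherent p a" and eq: "ppow x a = \<one>"
  shows "x = \<one> \<or> zero_exponent a"
proof (rule ccontr)
  assume n: "\<not> ?thesis"
  then obtain b m where b: "coherent p b" "padic_eq p (\<lambda>n. a n * b n) (\<lambda>_. int p ^ m)"
    using coherent_nonzero_associate[OF prime a] by blast
  have "x [^] (p ^ m) = ppow x (\<lambda>_. int p ^ m)" using x by (simp add: int_pow_int[symmetric])
  also have "\<dots> = ppow x (\<lambda>n. a n * b n)"
    using ppow_cong[OF x _ _ b(2)] a b(1) by simp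
  also have "\<dots> = \<one>" using ppow_ppow[OF x a b(1)] eq b(1) by simp
  finally show False using pow_p_power_eq_one[OF x] n by blast
qed

lemma ppow_zero:
  assumes "x \<in> carrier G" "coherent p a" "zero_exponent a"
  shows "ppow x a = \<one>"
  using ppow_cong[OF assms(1,2) coherent_const assms(3)] assms(1) by simp

lemma ppow_inject:
  assumes x: "x \<in> carrier G" and ab: "coherent p a" "coherent p b" and eq: "ppow x a = ppow x b"
  shows "x = \<one> \<or> padic_eq p a b"
proof -
  have "ppow x (\<lambda>n. a n - b n) = \<one>" using ppow_diff[OF x ab] eq x ab by simp
  then show ?thesis using ppow_eq_one[OF x coherent_diff[OF ab]] padic_eq_diff_0 by blast
qed

abbreviation pair :: "'a \<Rightarrow> 'a \<Rightarrow> 'a set" where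
  "pair x y \<equiv> closed_generate G T {x, y}"

lemma pair_subgroup:
  assumes "x \<in> carrier G" "y \<in> carrier G"
  shows "subgroup (pair x y) G" "closedin T (pair x y)" "x \<in> pair x y" "y \<in> pair x y"
  using closed_generate_subgroup[of "{x,y}"] assms by auto

lemma commutator_pair:
  assumes "x \<in> carrier G" "y \<in> carrier G" "u \<in> pair x y" "v \<in> pair x y"
  shows "\<exists>a. coherent p a \<and> \<lbrakk>u,v\<rbrakk> = ppow \<lbrakk>x,y\<rbrakk> a"
  by (rule locally_powerful_two_generators(1)[OF locally_powerful assms(1,2) refl refl assms(3,4)])

lemma conj_pair:
  assumes "x \<in> carrier G" "y \<in> carrier G" "g \<in> pair x y"
  shows "\<exists>l. coherent p l \<and> (\<forall>n. [l n = 1] (mod int powerful_exponent)) \<and> g \<otimes> \<lbrakk>x,y\<rbrakk> \<otimes> inv g = ppow \<lbrakk>x,y\<rbrakk> l"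
proof -
  obtain a where a: "coherent p a" "g \<otimes> \<lbrakk>x,y\<rbrakk> \<otimes> inv g = ppow \<lbrakk>x,y\<rbrakk> (\<lambda>n. 1 + int powerful_exponent * a n)"
    using locally_powerful_two_generators(2)[OF locally_powerful assms(1,2) refl refl assms(3)] by metis
  have "coherent p (\<lambda>n. 1 + int powerful_exponent * a n)"
    using a(1) by (intro coherent_add coherent_mult coherent_const)
  then show ?thesis using a(2) by (intro exI[of _ "\<lambda>n. 1 + int powerful_exponent * a n"]) (auto simp: cong_iff_dvd_diff)
qed

lemma commutator_root:
  assumes "x \<in> carrier G" "y \<in> carrier G"
  shows "\<exists>a b e l. coherent p a \<and> coherent p b \<and> coherent p e \<and> coherent p l \<and>
      \<lbrakk>x,y\<rbrakk> = (ppow x a \<otimes> ppow y b \<otimes> ppow \<lbrakk>x,y\<rbrakk> e) [^] powerful_exponent \<otimes> ppow \<lbrakk>x,y\<rbrakk> (\<lambda>n. int p * l n)"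
  by (rule locally_powerful_two_generators(3)[OF locally_powerful assms refl refl])

text \<open>Every further factor \<open>x\<close> conjugates the previous commutator, which
  multiplies its exponent by \<open>l\<close>, and contributes one more
  \<open>[x,y]\<close>.\<close>

lemma commutator_nat_pow:
  assumes x: "x \<in> carrier G" and y: "y \<in> carrier G" and l: "coherent p l"
    and c: "x \<otimes> \<lbrakk>x,y\<rbrakk> \<otimes> inv x = ppow \<lbrakk>x,y\<rbrakk> l"
  shows "\<lbrakk>x [^] (n::nat), y\<rbrakk> = ppow \<lbrakk>x,y\<rbrakk> (\<lambda>k. \<Sum>i<n. l k ^ i)"
proof (induction n)
  case 0
  show ?case using x y by (simp add: group_commutator_def)
next
  case (Suc n)
  let ?c = "\<lbrakk>x,y\<rbrakk>" and ?s = "\<lambda>k. \<Sum>i<n. l k ^ i"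
  have cc: "?c \<in> carrier G" and s: "coherent p ?s" using x y l by auto
  have "\<lbrakk>x [^] Suc n, y\<rbrakk> = \<lbrakk>x \<otimes> x [^] n, y\<rbrakk>" using x by (metis nat_pow_Suc2)
  also have "\<dots> = x \<otimes> ppow ?c ?s \<otimes> inv x \<otimes> ?c" using x y commutator_mult_left Suc by simp
  also have "x \<otimes> ppow ?c ?s \<otimes> inv x = ppow ?c (\<lambda>k. l k * ?s k)"
    using ppow_conj[OF x cc s] ppow_ppow[OF cc l s] c by simp
  also have "\<dots> \<otimes> ?c = ppow ?c (\<lambda>k. l k * ?s k) \<otimes> ppow ?c (\<lambda>_. 1)" using cc by simp
  also have "\<dots> = ppow ?c (\<lambda>k. l k * ?s k + 1)"
    using ppow_add[OF cc coherent_mult[OF l s] coherent_const] by simp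
  also have "(\<lambda>k. l k * ?s k + 1) = (\<lambda>k. \<Sum>i<Suc n. l k ^ i)"
    by (subst sum.lessThan_Suc_shift) (simp add: sum_distrib_left add.commute)
  finally show ?case .
qed

text \<open>The multiplier \<open>1 + \<lambda> + \<dots> + \<lambda>\<^bsup>p-1\<^esup>\<close> by which \<open>[x\<^sup>p,y]\<close> differs from \<open>[x,y]\<close> is \<open>p\<close> times a unit.\<close>

lemma commute_of_pow_commute:
  assumes x: "x \<in> carrier G" and y: "y \<in> carrier G" and c: "x [^] p \<otimes> y = y \<otimes> x [^] p"
  shows "x \<otimes> y = y \<otimes> x"
proof -
  let ?c = "\<lbrakk>x,y\<rbrakk>"
  have cc: "?c \<in> carrier G" using x y by simp
  obtain l where l: "coherent p l" "\<And>n. [l n = 1] (mod int powerful_exponent)" "x \<otimes> ?c \<otimes> inv x = ppow ?c l"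
    using conj_pair[OF x y pair_subgroup(3)[OF x y]] by blast
  have "ppow ?c (\<lambda>k. \<Sum>i<p. l k ^ i) = \<lbrakk>x [^] p, y\<rbrakk>" using commutator_nat_pow[OF x y l(1,3)] by simp
  also have "\<dots> = \<one>" using commutator_eq_one_iff x y c by simp
  finally have z: "ppow ?c (\<lambda>k. \<Sum>i<p. l k ^ i) = \<one>" .
  have "coherent p (\<lambda>k. \<Sum>i<p. l k ^ i)" using l(1) by (intro coherent_sum coherent_power)
  then have "?c = \<one> \<or> zero_exponent (\<lambda>k. \<Sum>i<p. l k ^ i)" using z by (rule ppow_eq_one[OF cc])
  moreover have "\<not> zero_exponent (\<lambda>k. \<Sum>i<p. l k ^ i)"
  proof
    assume "zero_exponent (\<lambda>k. \<Sum>i<p. l k ^ i)"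
    \<comment> \<open>Level 2 already shows that the multiplier is nonzero, as its valuation is
      exactly 1.\<close>
    then have "int p ^ 2 dvd (\<Sum>i<p. l 2 ^ i)" by (simp add: padic_eq_def cong_0_iff)
    moreover obtain t where "(\<Sum>i<p. l 2 ^ i) = int p * t" "\<not> int p dvd t"
      using sum_powers_factor[OF prime l(2)[of 2, unfolded powerful_exponent_def]] by blast
    ultimately show False using p_pos by (simp add: power2_eq_square)
  qed
  ultimately show ?thesis using commutator_eq_one_iff x y by simp
qed

text \<open>The exponent divides some \<open>p^m\<close>, so \<open>x^(p^m)\<close> commutes with
  \<open>y\<close>; the factors \<open>p\<close> are then removed one at a time.\<close>

lemma commute_of_ppow_commute:
  assumes x: "x \<in> carrier G" and y: "y \<in> carrier G" and a: "coherent p a" "\<not> zero_exponent a"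
    and c: "ppow x a \<otimes> y = y \<otimes> ppow x a"
  shows "x \<otimes> y = y \<otimes> x"
proof -
  obtain b m where b: "coherent p b" "padic_eq p (\<lambda>n. a n * b n) (\<lambda>_. int p ^ m)"
    using coherent_nonzero_associate[OF prime a] by blast
  have "x [^] (p ^ m) = ppow x (\<lambda>_. int p ^ m)" using x by (simp add: int_pow_int[symmetric])
  also have "\<dots> = ppow (ppow x a) b"
    using ppow_cong[OF x _ _ b(2)] ppow_ppow[OF x a(1) b(1)] a b(1) by simp
  finally have "y \<otimes> x [^] (p ^ m) = x [^] (p ^ m) \<otimes> y"
    using commute_ppow[OF y ppow_closed[OF x a(1)] b(1)] c by simp
  then show ?thesis
  proof (induction m)
    case (Suc m)
    have "x [^] (p ^ Suc m) = (x [^] (p ^ m)) [^] p" using x by (simp add: nat_pow_pow mult.commute)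
    then show ?case using Suc commute_of_pow_commute[of "x [^] (p ^ m)" y] x y by simp
  qed (use x in simp)
qed

text \<open>Since \<open>y\<close> commutes with \<open>y^a = x^a\<close>, it commutes with
  \<open>x\<close>. Then \<open>x y^(-1)\<close> has trivial \<open>a\<close>-th power and is itself
  trivial.\<close>

lemma ppow_root_unique:
  assumes x: "x \<in> carrier G" and y: "y \<in> carrier G" and a: "coherent p a" "\<not> zero_exponent a"
    and eq: "ppow x a = ppow y a"
  shows "x = y"
proof -
  have "ppow x a \<otimes> y = y \<otimes> ppow x a" unfolding eq using commute_ppow[OF y y a(1)] by simp
  then have c: "x \<otimes> y = y \<otimes> x" by (rule commute_of_ppow_commute[OF x y a])
  then have c': "x \<otimes> inv y = inv y \<otimes> x" using commute_inv x y by simp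
  have "ppow (x \<otimes> inv y) a = ppow x a \<otimes> ppow (inv y) a"
    using ppow_mult[OF x inv_closed[OF y] c' a(1)] .
  also have "ppow (inv y) a = ppow (ppow y (\<lambda>_. -1)) a" using y by (simp add: int_pow_neg)
  also have "\<dots> = inv (ppow y a)" using ppow_ppow[OF y coherent_const a(1)] ppow_uminus[OF y a(1)] by simp
  finally have "ppow (x \<otimes> inv y) a = \<one>" using eq y a(1) by simp
  then have "x \<otimes> inv y = \<one>"
    using ppow_eq_one[OF m_closed[OF x inv_closed[OF y]] a(1)] a(2) by simp
  then show ?thesis using x y inv_equality[of x "inv y"] by simp
qed

text \<open>Both sides have the same \<open>a\<close>-th power, and roots are unique. By this rule
  the scaling of a commutator passes to the element of which it is a power.\<close>

lemma conj_root:
  assumes g: "g \<in> carrier G" and x: "x \<in> carrier G" and a: "coherent p a" "\<not> zero_exponent a"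
    and l: "coherent p l" and eq: "g \<otimes> ppow x a \<otimes> inv g = ppow (ppow x a) l"
  shows "g \<otimes> x \<otimes> inv g = ppow x l"
proof (rule ppow_root_unique[OF _ _ a])
  have "ppow (g \<otimes> x \<otimes> inv g) a = ppow x (\<lambda>n. a n * l n)"
    using ppow_conj[OF g x a(1)] eq ppow_ppow[OF x a(1) l] by simp
  also have "\<dots> = ppow (ppow x l) a" using ppow_ppow[OF x l a(1)] by (simp add: mult.commute)
  finally show "ppow (g \<otimes> x \<otimes> inv g) a = ppow (ppow x l) a" .
qed (simp_all add: g x l)

lemma commutator_of_eigen:
  assumes h: "h \<in> carrier G" and k: "k \<in> carrier G" and m: "coherent p m" and e: "h \<otimes> k \<otimes> inv h = ppow k m"
  shows "\<lbrakk>h,k\<rbrakk> = ppow k (\<lambda>n. m n - 1)"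
proof -
  have "ppow k (\<lambda>n. m n - 1) = ppow k m \<otimes> inv (ppow k (\<lambda>_. 1))"
    by (rule ppow_diff[OF k m coherent_const])
  also have "\<dots> = \<lbrakk>h,k\<rbrakk>" unfolding group_commutator_def e[symmetric] using k by simp
  finally show ?thesis by (rule sym)
qed

text \<open>There is no Heisenberg group inside \<open>G\<close>: if \<open>[x,y]\<close> commutes with \<open>x\<close>, then its root
  \<open>x\<^sup>a y\<^sup>b c\<^sup>e\<close> commutes with \<open>x\<close> too, which forces \<open>b = 0\<close>.\<close>

lemma commutator_eq_ppow:
  assumes x: "x \<in> carrier G" and y: "y \<in> carrier G" and comm: "x \<otimes> \<lbrakk>x,y\<rbrakk> = \<lbrakk>x,y\<rbrakk> \<otimes> x"
  shows "\<exists>a. coherent p a \<and> \<lbrakk>x,y\<rbrakk> = ppow x a"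
proof (cases "\<lbrakk>x,y\<rbrakk> = \<one>")
  case True
  have "\<lbrakk>x,y\<rbrakk> = ppow x (\<lambda>_. 0)" using x True by simp
  then show ?thesis using coherent_const by blast
next
  case ne: False
  let ?c = "\<lbrakk>x,y\<rbrakk>" and ?q = "powerful_exponent"
  have cc: "?c \<in> carrier G" using x y by simp
  obtain a b e l where abel: "coherent p a" "coherent p b" "coherent p e" "coherent p l"
    and root: "?c = (ppow x a \<otimes> ppow y b \<otimes> ppow ?c e) [^] ?q \<otimes> ppow ?c (\<lambda>n. int p * l n)"
    using commutator_root[OF x y] by (elim exE conjE) (rule that)
  define k where "k = ppow x a \<otimes> ppow y b \<otimes> ppow ?c e"
  have k: "k \<in> carrier G" using x y cc abel by (simp add: k_def)
  have pl: "coherent p (\<lambda>n. int p * l n)" using abel by simp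
  have q0: "?q \<noteq> 0" using p_pos by (simp add: powerful_exponent_def)
  have kq: "k [^] ?q = ppow ?c (\<lambda>n. 1 - int p * l n)"
  proof -
    have "k [^] ?q = ?c \<otimes> inv (ppow ?c (\<lambda>n. int p * l n))"
      using root[folded k_def] k cc ppow_closed[OF cc pl] by (metis inv_solve_right nat_pow_closed)
    also have "\<dots> = ppow ?c (\<lambda>_. 1) \<otimes> inv (ppow ?c (\<lambda>n. int p * l n))" using cc by simp
    also have "\<dots> = ppow ?c (\<lambda>n. 1 - int p * l n)" by (rule ppow_diff[OF cc coherent_const pl, symmetric])
    finally show ?thesis .
  qed
  have "x \<otimes> k [^] ?q = k [^] ?q \<otimes> x"
    unfolding kq using commute_ppow[OF x cc _ comm] pl by simp
  then have "ppow k (\<lambda>_. int ?q) \<otimes> x = x \<otimes> ppow k (\<lambda>_. int ?q)"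
    using k by (simp add: int_pow_int)
  moreover have "\<not> zero_exponent (\<lambda>_. int ?q)"
    using q0 prime_gt_1_nat[OF prime] by (intro padic_const_nonzero) auto
  ultimately have kx: "k \<otimes> x = x \<otimes> k"
    using commute_of_ppow_commute[OF k x coherent_const] by simp
  have xa: "ppow x a \<in> carrier G" and yb: "ppow y b \<in> carrier G" and ce: "ppow ?c e \<in> carrier G"
    using x y cc abel by auto
  have "x \<otimes> ppow y b = ppow y b \<otimes> x"
  proof -
    have "ppow y b = inv (ppow x a) \<otimes> (k \<otimes> inv (ppow ?c e))"
      unfolding k_def using xa yb ce by (simp add: m_assoc)
    moreover have "x \<otimes> inv (ppow x a) = inv (ppow x a) \<otimes> x"
      using commute_inv[OF x xa] commute_ppow[OF x x abel(1)] by simp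
    moreover have "x \<otimes> inv (ppow ?c e) = inv (ppow ?c e) \<otimes> x"
      using commute_inv[OF x ce] commute_ppow[OF x cc abel(3) comm] by simp
    ultimately show ?thesis
      using commute_mult[OF x inv_closed[OF xa] m_closed[OF k inv_closed[OF ce]]]
        commute_mult[OF x k inv_closed[OF ce]] kx by simp
  qed
  then have "zero_exponent b"
    using commute_of_ppow_commute[OF y x abel(2)] commutator_eq_one_iff[OF x y] ne by metis
  then have "ppow y b = \<one>" using ppow_zero y abel by simp
  then have k2: "k = ppow x a \<otimes> ppow ?c e" unfolding k_def using xa by simp
  have "ppow x a \<otimes> ppow ?c e = ppow ?c e \<otimes> ppow x a"
    using commute_ppow[OF ce x abel(1)] commute_ppow[OF x cc abel(3) comm] by simp
  then have "ppow k (\<lambda>_. int ?q) = ppow (ppow x a) (\<lambda>_. int ?q) \<otimes> ppow (ppow ?c e) (\<lambda>_. int ?q)"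
    unfolding k2 using ppow_mult[OF xa ce _ coherent_const] by simp
  then have "ppow ?c (\<lambda>n. 1 - int p * l n) = ppow x (\<lambda>n. a n * int ?q) \<otimes> ppow ?c (\<lambda>n. e n * int ?q)"
    using kq k ppow_ppow[OF x abel(1) coherent_const] ppow_ppow[OF cc abel(3) coherent_const] by (simp add: int_pow_int)
  moreover have eq: "coherent p (\<lambda>n. e n * int ?q)" "coherent p (\<lambda>n. 1 - int p * l n)" "coherent p (\<lambda>n. a n * int ?q)"
    using abel by auto
  ultimately have "ppow ?c (\<lambda>n. 1 - int p * l n) \<otimes> inv (ppow ?c (\<lambda>n. e n * int ?q)) = ppow x (\<lambda>n. a n * int ?q)"
    using cc x by (metis inv_solve_right' ppow_closed)
  \<comment> \<open>Both \<open>p l\<close> and \<open>e q\<close> are divisible by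
    \<open>p\<close>, so the exponent of \<open>c\<close> on the left is a unit, and
    \<open>c\<close> can be isolated as a power of \<open>x\<close>.\<close>
  then have main: "ppow ?c (\<lambda>n. 1 - int p * l n - e n * int ?q) = ppow x (\<lambda>n. a n * int ?q)"
    using ppow_diff[OF cc eq(2,1)] by simp
  have "int p dvd int ?q" by (auto simp: powerful_exponent_def)
  then have pd: "int p dvd int p * l 1 + e 1 * int ?q" by simp
  have "\<not> int p dvd 1 - int p * l 1 - e 1 * int ?q"
  proof
    assume "int p dvd 1 - int p * l 1 - e 1 * int ?q"
    from dvd_add[OF this pd] have "int p dvd 1" by simp
    then show False using prime_gt_1_nat[OF prime] by simp
  qed
  then obtain u where u: "coherent p u" "padic_eq p (\<lambda>n. (1 - int p * l n - e n * int ?q) * u n) (\<lambda>_. 1)"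
    using coherent_inverse[OF prime coherent_diff[OF eq(2,1)]] by blast
  have "?c = ppow ?c (\<lambda>_. 1)" using cc by simp
  also have "\<dots> = ppow ?c (\<lambda>n. (1 - int p * l n - e n * int ?q) * u n)"
    using ppow_cong[OF cc _ _ u(2)] u(1) coherent_mult[OF coherent_diff[OF eq(2,1)] u(1)] by simp
  also have "\<dots> = ppow (ppow x (\<lambda>n. a n * int ?q)) u"
    using ppow_ppow[OF cc coherent_diff[OF eq(2,1)] u(1)] main by simp
  also have "\<dots> = ppow x (\<lambda>n. a n * int ?q * u n)" using ppow_ppow[OF x eq(3) u(1)] .
  finally show ?thesis using coherent_mult[OF eq(3) u(1)] by blast
qed

end

lemma (in group) mult_eq_rearrange:
  assumes "a \<in> carrier G" "a' \<in> carrier G" "g \<in> carrier G" "g' \<in> carrier G" "a \<otimes> g = a' \<otimes> g'"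
  shows "inv a' \<otimes> a = g' \<otimes> inv g"
proof -
  have "inv a' \<otimes> a = inv a' \<otimes> (a \<otimes> g) \<otimes> inv g" using assms(1-4) by (simp add: m_assoc)
  also have "\<dots> = g' \<otimes> inv g" unfolding assms(5) using assms(1-4) by simp
  finally show ?thesis .
qed

section \<open>Eigenvectors of a conjugation\<close>

context torsion_free_locally_powerful
begin

text \<open>Conjugation by \<open>h\<close> keeps \<open>k\<close> and \<open>k'\<close> in their
  closed span, so \<open>h\<close> scales \<open>e = [k,k']\<close>, and so does \<open>k\<close>.
  Scalars commute, hence \<open>[h,k]\<close> fixes a nonzero power of \<open>e\<close> and commutes
  with \<open>e\<close>. As \<open>[h,k]\<close> is a nonzero power of \<open>k\<close>, so does
  \<open>k\<close>.\<close>

lemma eigenvectors_commute_aux: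
  assumes h: "h \<in> carrier G" and k: "k \<in> carrier G" and k': "k' \<in> carrier G"
    and m: "coherent p m" "h \<otimes> k \<otimes> inv h = ppow k m" and m': "coherent p m'" "h \<otimes> k' \<otimes> inv h = ppow k' m'"
    and nk: "\<lbrakk>h,k\<rbrakk> \<noteq> \<one>"
  shows "k \<otimes> \<lbrakk>k,k'\<rbrakk> = \<lbrakk>k,k'\<rbrakk> \<otimes> k"
proof (cases "\<lbrakk>k,k'\<rbrakk> = \<one>")
  case True
  then show ?thesis using k by simp
next
  case ne: False
  let ?e = "\<lbrakk>k,k'\<rbrakk>"
  have e: "?e \<in> carrier G" using k k' by simp
  note P = pair_subgroup[OF k k']
  have "h \<otimes> ?e \<otimes> inv h = \<lbrakk>ppow k m, ppow k' m'\<rbrakk>" using conj_commutator[OF h k k'] m m' by simp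
  then obtain v where v: "coherent p v" "h \<otimes> ?e \<otimes> inv h = ppow ?e v"
    using commutator_pair[OF k k' ppow_mem[OF P(1,2,3) m(1)] ppow_mem[OF P(1,2,4) m'(1)]] by auto
  obtain s where s: "coherent p s" "k \<otimes> ?e \<otimes> inv k = ppow ?e s"
    using conj_pair[OF k k' P(3)] by blast
  have 1: "(h \<otimes> k) \<otimes> ?e \<otimes> inv (h \<otimes> k) = ppow ?e (\<lambda>n. v n * s n)"
    using conj_conj[OF h k e] s v ppow_conj[OF h e s(1)] ppow_ppow[OF e v(1) s(1)] by simp
  have 2: "(k \<otimes> h) \<otimes> ?e \<otimes> inv (k \<otimes> h) = ppow ?e (\<lambda>n. v n * s n)"
    using conj_conj[OF k h e] s v ppow_conj[OF k e v(1)] ppow_ppow[OF e s(1) v(1)] by (simp add: mult.commute)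
  let ?e' = "ppow ?e (\<lambda>n. v n * s n)"
  have vs: "coherent p (\<lambda>n. v n * s n)" using v s by simp
  have hk: "h \<otimes> k = \<lbrakk>h,k\<rbrakk> \<otimes> (k \<otimes> h)" using mult_eq_commutator_mult[OF h k] h k by (simp add: m_assoc)
  have "\<lbrakk>h,k\<rbrakk> \<otimes> ?e' \<otimes> inv \<lbrakk>h,k\<rbrakk> = ?e'"
    using conj_conj[of "\<lbrakk>h,k\<rbrakk>" "k \<otimes> h" ?e] 1 2 h k e unfolding hk by simp
  then have "?e' \<otimes> \<lbrakk>h,k\<rbrakk> = \<lbrakk>h,k\<rbrakk> \<otimes> ?e'"
    using conj_eq_iff_commute[of "\<lbrakk>h,k\<rbrakk>" ?e'] h k e vs by simp
  moreover have "\<not> zero_exponent (\<lambda>n. v n * s n)"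
    using ppow_zero[OF e vs] 1 conj_eq_one_iff[of "h \<otimes> k" ?e] h k e ne by auto
  ultimately have "?e \<otimes> \<lbrakk>h,k\<rbrakk> = \<lbrakk>h,k\<rbrakk> \<otimes> ?e"
    using commute_of_ppow_commute[OF e commutator_closed[OF h k] vs] by blast
  moreover have hk': "\<lbrakk>h,k\<rbrakk> = ppow k (\<lambda>n. m n - 1)" by (rule commutator_of_eigen[OF h k m])
  moreover have "\<not> zero_exponent (\<lambda>n. m n - 1)" using nk hk' ppow_zero[OF k] m(1) by auto
  moreover have "coherent p (\<lambda>n. m n - 1)" using m(1) by simp
  ultimately show ?thesis using commute_of_ppow_commute[OF k e, of "\<lambda>n. m n - 1"] by simp
qed

text \<open>By symmetry \<open>[k,k']\<close> commutes with both \<open>k\<close> and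
  \<open>k'\<close>, so it is a power of \<open>k\<close>. If that power is nonzero, commutation
  with \<open>k'\<close> passes to \<open>k\<close>.\<close>

lemma eigenvectors_commute:
  assumes h: "h \<in> carrier G" and k: "k \<in> carrier G" and k': "k' \<in> carrier G"
    and m: "coherent p m" "h \<otimes> k \<otimes> inv h = ppow k m" and m': "coherent p m'" "h \<otimes> k' \<otimes> inv h = ppow k' m'"
    and nk: "\<lbrakk>h,k\<rbrakk> \<noteq> \<one>" and nk': "\<lbrakk>h,k'\<rbrakk> \<noteq> \<one>"
  shows "k \<otimes> k' = k' \<otimes> k"
proof -
  have 1: "k \<otimes> \<lbrakk>k,k'\<rbrakk> = \<lbrakk>k,k'\<rbrakk> \<otimes> k" by (rule eigenvectors_commute_aux[OF h k k' m m' nk])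
  have "k' \<otimes> \<lbrakk>k',k\<rbrakk> = \<lbrakk>k',k\<rbrakk> \<otimes> k'" by (rule eigenvectors_commute_aux[OF h k' k m' m nk'])
  then have 2: "k' \<otimes> \<lbrakk>k,k'\<rbrakk> = \<lbrakk>k,k'\<rbrakk> \<otimes> k'"
    using commute_inv[of k' "\<lbrakk>k',k\<rbrakk>"] inv_commutator[OF k' k] k k' by simp
  obtain a where a: "coherent p a" "\<lbrakk>k,k'\<rbrakk> = ppow k a" using commutator_eq_ppow[OF k k' 1] by blast
  show ?thesis
  proof (cases "zero_exponent a")
    case True
    then show ?thesis using ppow_zero[OF k a(1)] a(2) commutator_eq_one_iff[OF k k'] by simp
  next
    case False
    then show ?thesis using commute_of_ppow_commute[OF k k' a(1)] 2 a(2) by simp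
  qed
qed

text \<open>The element \<open>[h, a g] = a^(m-1) g^(m'-1)\<close> has an eigenvalue
  \<open>t\<close> of its own. Comparing both descriptions of its conjugate produces a common power
  of \<open>a\<close> and \<open>g\<close>: if it is nontrivial, it has eigenvalues \<open>m\<close>
  and \<open>m'\<close> at once; if it is trivial, then \<open>m = t = m'\<close>.\<close>

lemma eigenvalue_unique:
  assumes h: "h \<in> carrier G" and a: "a \<in> carrier G" and g: "g \<in> carrier G"
    and m: "coherent p m" "h \<otimes> a \<otimes> inv h = ppow a m" and m': "coherent p m'" "h \<otimes> g \<otimes> inv h = ppow g m'"
    and na: "\<lbrakk>h,a\<rbrakk> \<noteq> \<one>" and ng: "\<lbrakk>h,g\<rbrakk> \<noteq> \<one>"
  shows "h \<otimes> g \<otimes> inv h = ppow g m"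
proof -
  have c: "a \<otimes> g = g \<otimes> a" by (rule eigenvectors_commute[OF h a g m m' na ng])
  let ?w = "\<lbrakk>h, a \<otimes> g\<rbrakk>"
  have ag: "a \<otimes> g \<in> carrier G" using a g by simp
  have m1: "coherent p (\<lambda>n. m n - 1)" "coherent p (\<lambda>n. m' n - 1)" using m m' by auto
  let ?A = "ppow a (\<lambda>n. m n - 1)" and ?G = "ppow g (\<lambda>n. m' n - 1)"
  have A: "?A \<in> carrier G" and Gc: "?G \<in> carrier G" using a g m1 by auto
  have hA: "\<lbrakk>h,a\<rbrakk> = ?A" and hG: "\<lbrakk>h,g\<rbrakk> = ?G" using commutator_of_eigen h a g m m' by auto
  have aG: "a \<otimes> ?G = ?G \<otimes> a" using commute_ppow[OF a g m1(2) c] .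
  have AG: "?A \<otimes> ?G = ?G \<otimes> ?A" using commute_ppow[OF Gc a m1(1)] aG by simp
  have w: "?w = ?A \<otimes> ?G"
  proof -
    have "?w = \<lbrakk>h,a\<rbrakk> \<otimes> (a \<otimes> \<lbrakk>h,g\<rbrakk> \<otimes> inv a)" by (rule commutator_mult_right[OF h g a])
    also have "a \<otimes> \<lbrakk>h,g\<rbrakk> \<otimes> inv a = ?G" unfolding hG using conj_eq_iff_commute[OF a Gc] aG by simp
    finally show ?thesis using hA by simp
  qed
  obtain t where t: "coherent p t" "h \<otimes> ?w \<otimes> inv h = ppow ?w t"
    using conj_pair[OF h ag pair_subgroup(3)[OF h ag]] by blast
  have conjA: "h \<otimes> ppow a i \<otimes> inv h = ppow a (\<lambda>n. i n * m n)" if "coherent p i" for i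
    using ppow_conj[OF h a that] m ppow_ppow[OF a m(1) that] by (simp add: mult.commute)
  have conjG: "h \<otimes> ppow g i \<otimes> inv h = ppow g (\<lambda>n. i n * m' n)" if "coherent p i" for i
    using ppow_conj[OF h g that] m' ppow_ppow[OF g m'(1) that] by (simp add: mult.commute)
  have "ppow a (\<lambda>n. (m n - 1) * m n) \<otimes> ppow g (\<lambda>n. (m' n - 1) * m' n) = h \<otimes> ?w \<otimes> inv h"
    unfolding w using conj_mult[OF h A Gc] conjA[OF m1(1)] conjG[OF m1(2)] by simp
  also have "\<dots> = ppow ?A t \<otimes> ppow ?G t" using t w ppow_mult[OF A Gc AG t(1)] by simp
  also have "\<dots> = ppow a (\<lambda>n. (m n - 1) * t n) \<otimes> ppow g (\<lambda>n. (m' n - 1) * t n)"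
    using ppow_ppow[OF a m1(1) t(1)] ppow_ppow[OF g m1(2) t(1)] by simp
  finally have eq: "ppow a (\<lambda>n. (m n - 1) * m n) \<otimes> ppow g (\<lambda>n. (m' n - 1) * m' n)
    = ppow a (\<lambda>n. (m n - 1) * t n) \<otimes> ppow g (\<lambda>n. (m' n - 1) * t n)" .
  let ?i = "\<lambda>n. (m n - 1) * m n - (m n - 1) * t n" and ?j = "\<lambda>n. (m' n - 1) * t n - (m' n - 1) * m' n"
  have cs: "coherent p (\<lambda>n. (m n - 1) * m n)" "coherent p (\<lambda>n. (m n - 1) * t n)"
    "coherent p (\<lambda>n. (m' n - 1) * m' n)" "coherent p (\<lambda>n. (m' n - 1) * t n)"
    using m1 m m' t by auto
  have ij: "coherent p ?i" "coherent p ?j" using cs by (auto intro: coherent_diff)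
  have u: "ppow a ?i = ppow g ?j"
  proof -
    let ?a1 = "ppow a (\<lambda>n. (m n - 1) * m n)" and ?a2 = "ppow a (\<lambda>n. (m n - 1) * t n)"
    let ?g1 = "ppow g (\<lambda>n. (m' n - 1) * m' n)" and ?g2 = "ppow g (\<lambda>n. (m' n - 1) * t n)"
    have car: "?a1 \<in> carrier G" "?a2 \<in> carrier G" "?g1 \<in> carrier G" "?g2 \<in> carrier G" using a g cs by auto
    have "ppow a ?i = ppow a (\<lambda>n. - ((m n - 1) * t n) + (m n - 1) * m n)" by simp
    also have "\<dots> = inv ?a2 \<otimes> ?a1"
      using ppow_add[OF a coherent_uminus[OF cs(2)] cs(1)] ppow_uminus[OF a cs(2)] by simp
    also have "\<dots> = ?g2 \<otimes> inv ?g1"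
      by (rule mult_eq_rearrange[OF car(1,2,3,4) eq])
    also have "\<dots> = ppow g ?j" using ppow_diff[OF g cs(4,3)] by simp
    finally show ?thesis .
  qed
  let ?u = "ppow a ?i"
  have uc: "?u \<in> carrier G" using a ij by simp
  have "ppow ?u m = h \<otimes> ?u \<otimes> inv h" using conjA[OF ij(1)] ppow_ppow[OF a ij(1) m(1)] by simp
  also have "\<dots> = ppow ?u m'" unfolding u using conjG[OF ij(2)] ppow_ppow[OF g ij(2) m'(1)] by simp
  finally have "?u = \<one> \<or> padic_eq p m m'" using ppow_inject[OF uc m(1) m'(1)] by blast
  moreover have "padic_eq p m m'" if u1: "?u = \<one>"
  proof -
    have mt: "coherent p (\<lambda>n. m n - t n)" "coherent p (\<lambda>n. t n - m' n)" using m m' t by auto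
    have "ppow ?A (\<lambda>n. m n - t n) = ?u"
      using ppow_ppow[OF a m1(1) mt(1)] by (simp add: right_diff_distrib)
    then have "padic_eq p m t" using ppow_eq_one[OF A mt(1)] u1 na hA padic_eq_diff_0 by auto
    moreover have "ppow ?G (\<lambda>n. t n - m' n) = ppow g ?j"
      using ppow_ppow[OF g m1(2) mt(2)] by (simp add: right_diff_distrib)
    then have "padic_eq p t m'" using ppow_eq_one[OF Gc mt(2)] u1 u ng hG padic_eq_diff_0 by auto
    ultimately show ?thesis by (rule padic_eq_trans)
  qed
  ultimately have "padic_eq p m m'" by blast
  then show ?thesis using ppow_cong[OF g m(1) m'(1)] m'(2) by simp
qed

text \<open>The element \<open>[h,g]\<close> has some eigenvalue under \<open>h\<close>, equal to
  \<open>m\<close> by uniqueness unless \<open>h\<close> fixes it. A nontrivial fixed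
  \<open>[h,g]\<close> would be a power of \<open>h\<close>, so \<open>g h g^(-1) = h^s\<close>.
  Then \<open>h^s\<close> has eigenvalue \<open>m\<close> on the conjugate of \<open>a\<close> by
  \<open>g\<close>, hence also on \<open>a\<close>, and this leads to \<open>s = 1\<close>.\<close>

lemma commutator_eigen:
  assumes h: "h \<in> carrier G" and a: "a \<in> carrier G" and g: "g \<in> carrier G"
    and m: "coherent p m" "h \<otimes> a \<otimes> inv h = ppow a m" and na: "\<lbrakk>h,a\<rbrakk> \<noteq> \<one>"
  shows "h \<otimes> \<lbrakk>h,g\<rbrakk> \<otimes> inv h = ppow \<lbrakk>h,g\<rbrakk> m"
proof -
  let ?c = "\<lbrakk>h,g\<rbrakk>"
  have c: "?c \<in> carrier G" using h g by simp
  obtain v where v: "coherent p v" "h \<otimes> ?c \<otimes> inv h = ppow ?c v"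
    using conj_pair[OF h g pair_subgroup(3)[OF h g]] by blast
  show ?thesis
  proof (cases "\<lbrakk>h,?c\<rbrakk> = \<one>")
    case False
    then show ?thesis by (rule eigenvalue_unique[OF h a c m v na])
  next
    case True
    have "?c = \<one>"
    proof (rule ccontr)
      assume nc: "?c \<noteq> \<one>"
      have "h \<otimes> ?c = ?c \<otimes> h" using True commutator_eq_one_iff[OF h c] by simp
      then obtain i where i: "coherent p i" "?c = ppow h i" using commutator_eq_ppow[OF h g] by blast
      have nzi: "\<not> zero_exponent i" using ppow_zero[OF h i(1)] i(2) nc by auto
      obtain s where s: "coherent p s" "g \<otimes> ?c \<otimes> inv g = ppow ?c s"
        using conj_pair[OF h g pair_subgroup(4)[OF h g]] by blast
      have gh: "g \<otimes> h \<otimes> inv g = ppow h s"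
        by (rule conj_root[OF g h i(1) nzi s(1)]) (use s(2) i(2) in simp)
      let ?h = "ppow h s" and ?b = "g \<otimes> a \<otimes> inv g"
      have hs: "?h \<in> carrier G" and b: "?b \<in> carrier G" using h s g a by simp_all
      have eb: "?h \<otimes> ?b \<otimes> inv ?h = ppow ?b m"
      proof -
        have "?h \<otimes> ?b \<otimes> inv ?h = g \<otimes> (h \<otimes> a \<otimes> inv h) \<otimes> inv g"
          unfolding gh[symmetric] using g h a by (simp add: word_simps)
        also have "\<dots> = ppow ?b m" unfolding m(2) by (rule ppow_conj[OF g a m(1)])
        finally show ?thesis .
      qed
      have m1: "coherent p (\<lambda>n. m n - 1)" using m(1) by simp
      have ha: "\<lbrakk>h,a\<rbrakk> = ppow a (\<lambda>n. m n - 1)" by (rule commutator_of_eigen[OF h a m])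
      have nzm: "\<not> zero_exponent (\<lambda>n. m n - 1)" using ppow_zero[OF a m1] na ha by auto
      note P = pair_subgroup[OF h a]
      obtain v' where v': "coherent p v'" "?h \<otimes> \<lbrakk>h,a\<rbrakk> \<otimes> inv ?h = ppow \<lbrakk>h,a\<rbrakk> v'"
        using conj_pair[OF h a ppow_mem[OF P(1,2,3) s(1)]] by blast
      have ea: "?h \<otimes> a \<otimes> inv ?h = ppow a v'"
        by (rule conj_root[OF hs a m1 nzm v'(1)]) (use v'(2) ha in simp)
      have hne: "h \<noteq> \<one>" using na a by (auto simp: group_commutator_def)
      have nzs: "\<not> zero_exponent s"
        using ppow_zero[OF h s(1)] gh conj_eq_one_iff[OF g h] hne by auto
      have n1: "\<lbrakk>?h,a\<rbrakk> \<noteq> \<one>"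
      proof
        assume "\<lbrakk>?h,a\<rbrakk> = \<one>"
        then have "?h \<otimes> a = a \<otimes> ?h" using commutator_eq_one_iff[OF hs a] by simp
        then have "h \<otimes> a = a \<otimes> h" by (rule commute_of_ppow_commute[OF h a s(1) nzs])
        then show False using commutator_eq_one_iff[OF h a] na by simp
      qed
      have n2: "\<lbrakk>?h,?b\<rbrakk> \<noteq> \<one>"
      proof
        assume "\<lbrakk>?h,?b\<rbrakk> = \<one>"
        then have "g \<otimes> \<lbrakk>h,a\<rbrakk> \<otimes> inv g = \<one>" using conj_commutator[OF g h a] gh by simp
        then show False using conj_eq_one_iff[OF g commutator_closed[OF h a]] na by simp
      qed
      have "?h \<otimes> a \<otimes> inv ?h = ppow a m"
        by (rule eigenvalue_unique[OF hs b a m(1) eb v'(1) ea n2 n1])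
      then have eq: "?h \<otimes> a \<otimes> inv ?h = h \<otimes> a \<otimes> inv h" using m(2) by simp
      \<comment> \<open>Since \<open>h\<close> and \<open>h^s\<close> act alike on \<open>a\<close>,
        the power \<open>h^(s-1)\<close> centralizes \<open>a\<close>; unless \<open>s = 1\<close>,
        so would \<open>h\<close>.\<close>
      let ?t = "\<lambda>n. s n - 1"
      have t: "coherent p ?t" using s(1) by simp
      have ts: "ppow h ?t \<in> carrier G" using h t by simp
      have "?h = h \<otimes> ppow h ?t"
        using ppow_add[OF h coherent_const t, of 1] h by simp
      then have "h \<otimes> (ppow h ?t \<otimes> a \<otimes> inv (ppow h ?t)) \<otimes> inv h = h \<otimes> a \<otimes> inv h"
        using eq conj_conj[OF h ts a] by simp
      then have "ppow h ?t \<otimes> a \<otimes> inv (ppow h ?t) = a" using h a ts by simp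
      then have "ppow h ?t \<otimes> a = a \<otimes> ppow h ?t" using conj_eq_iff_commute[OF ts a] by simp
      then have "zero_exponent ?t"
        using commute_of_ppow_commute[OF h a t] commutator_eq_one_iff[OF h a] na by auto
      then have "padic_eq p s (\<lambda>_. 1)" using padic_eq_diff_0 by simp
      then have "?h = h" using ppow_cong[OF h s(1) coherent_const] h by simp
      then have "g \<otimes> h = h \<otimes> g" using gh conj_eq_iff_commute[OF g h] by simp
      then show False using nc commutator_eq_one_iff[OF h g] by simp
    qed
    then show ?thesis using h m(1) by simp
  qed
qed

text \<open>The commutator \<open>[x,y]\<close> is scaled by \<open>x\<close> and by
  \<open>y\<close>. If both fixed it, it would be a nonzero power of \<open>x\<close> commuting with
  \<open>y\<close>, so \<open>x\<close> and \<open>y\<close> would commute.\<close>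

lemma ex_eigenvector:
  assumes "x \<in> carrier G" "y \<in> carrier G" "x \<otimes> y \<noteq> y \<otimes> x"
  shows "\<exists>h k m. h \<in> carrier G \<and> k \<in> carrier G \<and> coherent p m \<and> h \<otimes> k \<otimes> inv h = ppow k m \<and> \<lbrakk>h,k\<rbrakk> \<noteq> \<one>"
proof -
  let ?c = "\<lbrakk>x,y\<rbrakk>"
  have c: "?c \<in> carrier G" and nc: "?c \<noteq> \<one>" using assms commutator_eq_one_iff by auto
  note P = pair_subgroup[OF assms(1,2)]
  obtain l where l: "coherent p l" "x \<otimes> ?c \<otimes> inv x = ppow ?c l" using conj_pair[OF assms(1,2) P(3)] by blast
  obtain l' where l': "coherent p l'" "y \<otimes> ?c \<otimes> inv y = ppow ?c l'" using conj_pair[OF assms(1,2) P(4)] by blast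
  have "\<lbrakk>x,?c\<rbrakk> \<noteq> \<one> \<or> \<lbrakk>y,?c\<rbrakk> \<noteq> \<one>"
  proof (rule ccontr)
    assume "\<not> ?thesis"
    then have xc: "x \<otimes> ?c = ?c \<otimes> x" and yc: "y \<otimes> ?c = ?c \<otimes> y"
      using commutator_eq_one_iff assms(1,2) c by auto
    obtain a where a: "coherent p a" "?c = ppow x a" using commutator_eq_ppow[OF assms(1,2) xc] by blast
    have "\<not> zero_exponent a" using ppow_zero[OF assms(1) a(1)] a(2) nc by auto
    then have "x \<otimes> y = y \<otimes> x"
      using commute_of_ppow_commute[OF assms(1,2) a(1)] yc a(2) by simp
    then show False using assms(3) by simp
  qed
  then show ?thesis using l l' assms(1,2) c by blast
qed

end

section \<open>The eigenspace as an abelian normal subgroup\<close>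

locale eigenvector = torsion_free_locally_powerful +
  fixes h k :: 'a and m :: "nat \<Rightarrow> int"
  assumes h: "h \<in> carrier G" and k: "k \<in> carrier G" and m: "coherent p m"
    and eigen: "h \<otimes> k \<otimes> inv h = ppow k m" and nontrivial: "\<lbrakk>h,k\<rbrakk> \<noteq> \<one>"
begin

definition eigenspace :: "'a set" where
  "eigenspace = {a \<in> carrier G. h \<otimes> a \<otimes> inv h = ppow a m}"

lemma m1: "coherent p (\<lambda>n. m n - 1)"
  using m by simp

lemma m1_nonzero: "\<not> zero_exponent (\<lambda>n. m n - 1)"
  using ppow_zero[OF k m1] commutator_of_eigen[OF h k m eigen] nontrivial by auto

lemma eigenspaceD:
  assumes "a \<in> eigenspace"
  shows "a \<in> carrier G" "h \<otimes> a \<otimes> inv h = ppow a m" "\<lbrakk>h,a\<rbrakk> = ppow a (\<lambda>n. m n - 1)"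
    "a \<noteq> \<one> \<Longrightarrow> \<lbrakk>h,a\<rbrakk> \<noteq> \<one>"
proof -
  show a: "a \<in> carrier G" "h \<otimes> a \<otimes> inv h = ppow a m" using assms by (auto simp: eigenspace_def)
  show e: "\<lbrakk>h,a\<rbrakk> = ppow a (\<lambda>n. m n - 1)" by (rule commutator_of_eigen[OF h a(1) m a(2)])
  show "a \<noteq> \<one> \<Longrightarrow> \<lbrakk>h,a\<rbrakk> \<noteq> \<one>" using ppow_eq_one[OF a(1) m1] e m1_nonzero by auto
qed

lemma k_eigenspace: "k \<in> eigenspace"
  using k eigen by (simp add: eigenspace_def)

lemma k_nontrivial: "k \<noteq> \<one>"
  using nontrivial h by (auto simp: group_commutator_def)

lemma eigenspace_commute:
  assumes "a \<in> eigenspace" "b \<in> eigenspace"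
  shows "a \<otimes> b = b \<otimes> a"
proof (cases "a = \<one> \<or> b = \<one>")
  case True
  then show ?thesis using eigenspaceD(1)[OF assms(1)] eigenspaceD(1)[OF assms(2)] by auto
next
  case False
  note A = eigenspaceD[OF assms(1)] and B = eigenspaceD[OF assms(2)]
  show ?thesis
    by (rule eigenvectors_commute[OF h A(1) B(1) m A(2) m B(2)]) (use A(4) B(4) False in auto)
qed

lemma eigenspace_ppow:
  assumes "a \<in> eigenspace" "coherent p i"
  shows "ppow a i \<in> eigenspace"
proof -
  note A = eigenspaceD[OF assms(1)]
  have "h \<otimes> ppow a i \<otimes> inv h = ppow (ppow a i) m"
    using ppow_conj[OF h A(1) assms(2)] A(2) ppow_ppow[OF A(1) m assms(2)] ppow_ppow[OF A(1) assms(2) m]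
    by (simp add: mult.commute)
  then show ?thesis using A(1) assms(2) by (simp add: eigenspace_def)
qed

lemma eigenspace_mult:
  assumes "a \<in> eigenspace" "b \<in> eigenspace"
  shows "a \<otimes> b \<in> eigenspace"
proof -
  note A = eigenspaceD[OF assms(1)] and B = eigenspaceD[OF assms(2)]
  have "h \<otimes> (a \<otimes> b) \<otimes> inv h = ppow (a \<otimes> b) m"
    using conj_mult[OF h A(1) B(1)] A(2) B(2) ppow_mult[OF A(1) B(1) eigenspace_commute[OF assms] m] by simp
  then show ?thesis using A(1) B(1) by (simp add: eigenspace_def)
qed

lemma eigenspace_root:
  assumes a: "a \<in> carrier G" and i: "coherent p i" "\<not> zero_exponent i" and e: "ppow a i \<in> eigenspace"
  shows "a \<in> eigenspace"
  using conj_root[OF h a i m eigenspaceD(2)[OF e]] a by (simp add: eigenspace_def)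

lemma commutator_in_eigenspace: "g \<in> carrier G \<Longrightarrow> \<lbrakk>h,g\<rbrakk> \<in> eigenspace"
  using commutator_eigen[OF h k _ m eigen nontrivial, of g] h by (simp add: eigenspace_def)

text \<open>Put \<open>h' = g h g^(-1)\<close> and \<open>c = [h,g]\<close>, so
  \<open>h = c h'\<close>. Both \<open>c\<close> and the conjugate of \<open>a\<close> are
  eigenvectors of \<open>h'\<close> for \<open>m\<close>; they commute, so \<open>h\<close> acts on
  the conjugate of \<open>a\<close> just as \<open>h'\<close> does.\<close>

lemma eigenspace_conj:
  assumes g: "g \<in> carrier G" and a: "a \<in> eigenspace"
  shows "g \<otimes> a \<otimes> inv g \<in> eigenspace"
proof -
  let ?h = "g \<otimes> h \<otimes> inv g" and ?b = "g \<otimes> a \<otimes> inv g" and ?c = "\<lbrakk>h,g\<rbrakk>"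
  note A = eigenspaceD[OF a]
  have hc: "?h \<in> carrier G" and b: "?b \<in> carrier G" using g h A(1) by simp_all
  have cE: "?c \<in> eigenspace" by (rule commutator_in_eigenspace[OF g])
  note C = eigenspaceD[OF cE]
  have hb: "?h \<otimes> ?b \<otimes> inv ?h = ppow ?b m"
  proof -
    have "?h \<otimes> ?b \<otimes> inv ?h = g \<otimes> (h \<otimes> a \<otimes> inv h) \<otimes> inv g"
      using g h A(1) by (simp add: word_simps)
    also have "\<dots> = ppow ?b m" unfolding A(2) by (rule ppow_conj[OF g A(1) m])
    finally show ?thesis .
  qed
  have hch: "h = ?c \<otimes> ?h" using g h by (simp add: group_commutator_def word_simps)
  have hch': "?h = inv ?c \<otimes> h" using g h by (simp add: group_commutator_def word_simps)
  have hcc: "?h \<otimes> ?c \<otimes> inv ?h = ppow ?c m"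
  proof -
    have "?h \<otimes> ?c \<otimes> inv ?h = inv ?c \<otimes> (h \<otimes> ?c \<otimes> inv h) \<otimes> inv (inv ?c)"
      unfolding hch' using C(1) h by (simp add: word_simps)
    also have "\<dots> = inv ?c \<otimes> ppow ?c m \<otimes> inv (inv ?c)" using C(2) by simp
    also have "\<dots> = ppow (inv ?c \<otimes> ?c \<otimes> inv (inv ?c)) m" by (rule ppow_conj[OF inv_closed[OF C(1)] C(1) m])
    also have "\<dots> = ppow ?c m" using C(1) by simp
    finally show ?thesis .
  qed
  have "?c \<otimes> ?b = ?b \<otimes> ?c"
  proof (cases "?c = \<one> \<or> ?b = \<one>")
    case True
    then show ?thesis using C(1) b by auto
  next
    case False
    have "\<lbrakk>?h,x\<rbrakk> \<noteq> \<one>" if x: "x \<in> carrier G" "?h \<otimes> x \<otimes> inv ?h = ppow x m" "x \<noteq> \<one>" for x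
      using commutator_of_eigen[OF hc x(1) m x(2)] ppow_eq_one[OF x(1) m1] m1_nonzero x(3) by auto
    then show ?thesis
      using eigenvectors_commute[OF hc C(1) b m hcc m hb] False C(1) b hcc hb by auto
  qed
  then have "?c \<otimes> ppow ?b m = ppow ?b m \<otimes> ?c" using commute_ppow[OF C(1) b m] by simp
  then have cb: "?c \<otimes> ppow ?b m \<otimes> inv ?c = ppow ?b m"
    using conj_eq_iff_commute[OF C(1) ppow_closed[OF b m]] by simp
  have "h \<otimes> ?b \<otimes> inv h = ?c \<otimes> (?h \<otimes> ?b \<otimes> inv ?h) \<otimes> inv ?c"
    using conj_conj[OF C(1) hc b] hch by simp
  also have "\<dots> = ppow ?b m" using hb cb by simp
  finally show ?thesis using b by (simp add: eigenspace_def)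
qed

end

section \<open>Units in coherent form and scalars on the eigenspace\<close>

lemma padic_mult_eq: "a \<otimes>\<^bsub>padic_int p\<^esub> b = padic_normal_form p (\<lambda>n. a n * b n)"
  by (simp add: padic_int_def padic_normal_form_def)

lemma padic_one_eq: "\<one>\<^bsub>padic_int p\<^esub> = padic_normal_form p (\<lambda>_. 1)"
  by (simp add: padic_int_def padic_normal_form_def)

lemma padic_units_iff:
  "a \<in> carrier (padic_units p) \<longleftrightarrow> a \<in> carrier (padic_int p) \<and>
    (\<exists>b\<in>carrier (padic_int p). a \<otimes>\<^bsub>padic_int p\<^esub> b = \<one>\<^bsub>padic_int p\<^esub>)"
  by (auto simp: padic_units_def units_of_carrier Units_def padic_mult_eq mult.commute)

lemma padic_units_mult: "a \<otimes>\<^bsub>padic_units p\<^esub> b = padic_normal_form p (\<lambda>n. a n * b n)"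
  by (simp add: padic_units_def units_of_mult padic_mult_eq)

lemma padic_units_one: "\<one>\<^bsub>padic_units p\<^esub> = padic_normal_form p (\<lambda>_. 1)"
  by (simp add: padic_units_def units_of_one padic_one_eq)

context pro_p_group_prime
begin

lemma ppow_inv_mult:
  assumes "x \<in> carrier G" "coherent p a" "coherent p b"
  shows "inv (ppow x b) \<otimes> ppow x a = ppow x (\<lambda>n. a n - b n)"
proof -
  have "ppow x (\<lambda>n. a n - b n) = ppow x (\<lambda>n. - b n + a n)" by simp
  also have "\<dots> = inv (ppow x b) \<otimes> ppow x a"
    using ppow_add[OF assms(1) coherent_uminus[OF assms(3)] assms(2)] ppow_uminus[OF assms(1,3)] by simp
  finally show ?thesis by (rule sym)
qed

lemma ppow_inv:
  assumes "x \<in> carrier G" "coherent p a"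
  shows "ppow (inv x) a = inv (ppow x a)"
proof -
  have "ppow (inv x) a = ppow (ppow x (\<lambda>_. -1)) a" using assms(1) by (simp add: int_pow_neg)
  also have "\<dots> = inv (ppow x a)"
    using ppow_ppow[OF assms(1) coherent_const assms(2)] ppow_uminus[OF assms] by simp
  finally show ?thesis .
qed

lemma conj_ppow_scalar:
  assumes "g \<in> carrier G" "x \<in> carrier G" "coherent p r" "coherent p i" "g \<otimes> x \<otimes> inv g = ppow x r"
  shows "g \<otimes> ppow x i \<otimes> inv g = ppow (ppow x i) r"
  using ppow_conj[OF assms(1,2,4)] ppow_ppow[OF assms(2,3,4)] ppow_ppow[OF assms(2,4,3)] assms(5)
  by (simp add: mult.commute)

end

context eigenvector
begin

text \<open>The element in question is \<open>[h, g a]\<close>, which \<open>g a\<close> scales. As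
  \<open>a\<close> commutes with the eigenspace, \<open>g\<close> alone has the same effect.\<close>

lemma conj_commutator_scalar:
  assumes g: "g \<in> carrier G" and a: "a \<in> eigenspace"
  shows "\<exists>t. coherent p t \<and>
    g \<otimes> (\<lbrakk>h,g\<rbrakk> \<otimes> ppow (g \<otimes> a \<otimes> inv g) (\<lambda>n. m n - 1)) \<otimes> inv g
     = ppow (\<lbrakk>h,g\<rbrakk> \<otimes> ppow (g \<otimes> a \<otimes> inv g) (\<lambda>n. m n - 1)) t"
proof -
  let ?c = "\<lbrakk>h,g\<rbrakk>" and ?d = "ppow (g \<otimes> a \<otimes> inv g) (\<lambda>n. m n - 1)"
  note A = eigenspaceD[OF a]
  have ga: "g \<otimes> a \<in> carrier G" using g A(1) by simp
  have cd: "?c \<otimes> ?d \<in> eigenspace"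
    using eigenspace_mult[OF commutator_in_eigenspace[OF g] eigenspace_ppow[OF eigenspace_conj[OF g a] m1]] .
  have cdc: "?c \<otimes> ?d \<in> carrier G" by (rule eigenspaceD(1)[OF cd])
  have "\<lbrakk>h, g \<otimes> a\<rbrakk> = ?c \<otimes> (g \<otimes> \<lbrakk>h,a\<rbrakk> \<otimes> inv g)" by (rule commutator_mult_right[OF h A(1) g])
  also have "g \<otimes> \<lbrakk>h,a\<rbrakk> \<otimes> inv g = ?d" unfolding A(3) by (rule ppow_conj[OF g A(1) m1])
  finally have e: "\<lbrakk>h, g \<otimes> a\<rbrakk> = ?c \<otimes> ?d" .
  obtain t where t: "coherent p t" "(g \<otimes> a) \<otimes> (?c \<otimes> ?d) \<otimes> inv (g \<otimes> a) = ppow (?c \<otimes> ?d) t"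
    using conj_pair[OF h ga pair_subgroup(4)[OF h ga]] unfolding e by blast
  have "a \<otimes> (?c \<otimes> ?d) \<otimes> inv a = ?c \<otimes> ?d"
    by (rule iffD2[OF conj_eq_iff_commute[OF A(1) cdc] eigenspace_commute[OF a cd]])
  then have "g \<otimes> (?c \<otimes> ?d) \<otimes> inv g = ppow (?c \<otimes> ?d) t"
    using conj_conj[OF g A(1) cdc] t(2) by simp
  then show ?thesis using t(1) by blast
qed

text \<open>Comparing \<open>[h, ga]\<close> with \<open>[h, ga\<^sup>-\<^sup>1]\<close> separates the two eigenvectors \<open>c = [h,g]\<close> and \<open>d\<close>.\<close>

lemma conj_eigenspace_scalar:
  assumes g: "g \<in> carrier G" and a: "a \<in> eigenspace"
  shows "\<exists>r. coherent p r \<and> g \<otimes> a \<otimes> inv g = ppow a r"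
proof -
  let ?c = "\<lbrakk>h,g\<rbrakk>" and ?b = "g \<otimes> a \<otimes> inv g"
  define d where "d = ppow ?b (\<lambda>n. m n - 1)"
  note A = eigenspaceD[OF a]
  have bE: "?b \<in> eigenspace" by (rule eigenspace_conj[OF g a])
  have cE: "?c \<in> eigenspace" by (rule commutator_in_eigenspace[OF g])
  have dE: "d \<in> eigenspace" unfolding d_def by (rule eigenspace_ppow[OF bE m1])
  note b = eigenspaceD(1)[OF bE] and c = eigenspaceD(1)[OF cE] and d = eigenspaceD(1)[OF dE]
  have cd: "?c \<otimes> d = d \<otimes> ?c" by (rule eigenspace_commute[OF cE dE])
  have cd': "?c \<otimes> inv d = inv d \<otimes> ?c" by (rule commute_inv[OF c d cd])
  obtain s where s: "coherent p s" "g \<otimes> ?c \<otimes> inv g = ppow ?c s"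
    using conj_pair[OF h g pair_subgroup(4)[OF h g]] by blast
  obtain t where t: "coherent p t" "g \<otimes> (?c \<otimes> d) \<otimes> inv g = ppow (?c \<otimes> d) t"
    using conj_commutator_scalar[OF g a] unfolding d_def by blast
  have ia: "inv a \<in> eigenspace"
    using eigenspace_ppow[OF a coherent_const, of "-1"] A(1) by (simp add: int_pow_neg)
  have "ppow (g \<otimes> inv a \<otimes> inv g) (\<lambda>n. m n - 1) = inv d"
    unfolding d_def conj_inv[OF g A(1)] by (rule ppow_inv[OF b m1])
  then obtain t' where t': "coherent p t'" "g \<otimes> (?c \<otimes> inv d) \<otimes> inv g = ppow (?c \<otimes> inv d) t'"
    using conj_commutator_scalar[OF g ia] by auto
  let ?d' = "g \<otimes> d \<otimes> inv g"
  have d': "?d' \<in> carrier G" using g d by simp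
  have d'E: "?d' \<in> eigenspace" by (rule eigenspace_conj[OF g dE])
  have ts: "coherent p (\<lambda>n. t n - s n)" "coherent p (\<lambda>n. s n - t' n)" "coherent p (\<lambda>n. t' n - t n)"
    using t(1) s(1) t'(1) by simp_all
  note car = ppow_closed[OF c s(1)] ppow_closed[OF c t(1)] ppow_closed[OF c t'(1)] ppow_closed[OF d t(1)] ppow_closed[OF d t'(1)]
  have "ppow ?c s \<otimes> ?d' = ppow ?c t \<otimes> ppow d t"
    using t(2) conj_mult[OF g c d] s(2) ppow_mult[OF c d cd t(1)] by simp
  then have "inv (ppow ?c s) \<otimes> (ppow ?c s \<otimes> ?d') = inv (ppow ?c s) \<otimes> ppow ?c t \<otimes> ppow d t"
    using car by (simp add: m_assoc)
  then have e1: "?d' = ppow ?c (\<lambda>n. t n - s n) \<otimes> ppow d t"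
    using car(1) d' ppow_inv_mult[OF c t(1) s(1)] by simp
  have "ppow ?c s \<otimes> inv ?d' = ppow ?c t' \<otimes> inv (ppow d t')"
    using t'(2) conj_mult[OF g c inv_closed[OF d]] conj_inv[OF g d] s(2) ppow_mult[OF c inv_closed[OF d] cd' t'(1)]
      ppow_inv[OF d t'(1)] by simp
  then have "inv (ppow ?c t') \<otimes> ppow ?c s = inv (ppow d t') \<otimes> inv (inv ?d')"
    using mult_eq_rearrange[OF car(1) car(3) inv_closed[OF d'] inv_closed[OF car(5)]] by simp
  then have "ppow ?c (\<lambda>n. s n - t' n) = inv (ppow d t') \<otimes> ?d'"
    using ppow_inv_mult[OF c s(1) t'(1)] d' by simp
  then have "ppow d t' \<otimes> ppow ?c (\<lambda>n. s n - t' n) = ?d'" using car(5) d' by simp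
  then have e2: "?d' = ppow ?c (\<lambda>n. s n - t' n) \<otimes> ppow d t'"
    using eigenspace_commute[OF eigenspace_ppow[OF dE t'(1)] eigenspace_ppow[OF cE ts(2)]] by simp
  \<comment> \<open>The conjugate of \<open>d\<close> equals \<open>c^(t-s) d^t\<close> by the first
    comparison and \<open>c^(s-t') d^(t')\<close> by the second. Hence \<open>c^i = d^j\<close>; if
    this common power is nontrivial, the scalar \<open>s\<close> of \<open>c\<close> is also that of
    \<open>d\<close>.\<close>
  let ?i = "\<lambda>n. (t n - s n) - (s n - t' n)" and ?j = "\<lambda>n. t' n - t n"
  have i: "coherent p ?i" using ts(1,2) by (rule coherent_diff)
  have w: "ppow ?c ?i = ppow d ?j"
    using mult_eq_rearrange[OF ppow_closed[OF c ts(1)] ppow_closed[OF c ts(2)] car(4,5)] e1 e2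
      ppow_inv_mult[OF c ts(1,2)] ppow_diff[OF d t'(1) t(1)] by simp
  have "\<exists>r. coherent p r \<and> ?d' = ppow d r"
  proof (cases "ppow ?c ?i = \<one>")
    case False
    have "\<not> zero_exponent ?j" using ppow_zero[OF d ts(3)] w False by auto
    moreover have "g \<otimes> ppow d ?j \<otimes> inv g = ppow (ppow d ?j) s"
      unfolding w[symmetric] by (rule conj_ppow_scalar[OF g c s(1) i s(2)])
    ultimately have "?d' = ppow d s" by (rule conj_root[OF g d ts(3) _ s(1)])
    then show ?thesis using s(1) by blast
  next
    case True
    consider "?c = \<one>" | "d = \<one>" | "zero_exponent ?i" "zero_exponent ?j"
      using ppow_eq_one[OF c i True] ppow_eq_one[OF d ts(3)] w True by auto
    then have "?d' = ppow d t"
    proof cases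
      case 1
      then show ?thesis using e1 ts(1) car(4) by simp
    next
      case 2
      then show ?thesis using g t(1) by simp
    next
      case 3
      \<comment> \<open>With \<open>j = 0\<close> the two comparisons combine to twice
        \<open>t - s\<close>. The factor 2 is a nonzero exponent, also for \<open>p = 2\<close>, so
        it can be cancelled.\<close>
      have "padic_eq p ?i (\<lambda>n. (t n - s n) * 2)"
        unfolding padic_eq_def
      proof
        fix n
        have "?i n - (t n - s n) * 2 = ?j n" by simp
        moreover have "int p ^ n dvd ?j n" using 3(2) by (simp add: padic_eq_def cong_0_iff)
        ultimately show "[?i n = (t n - s n) * 2] (mod int p ^ n)" by (simp only: cong_iff_dvd_diff)
      qed
      then have "ppow ?c ?i = ppow ?c (\<lambda>n. (t n - s n) * 2)"
        by (rule ppow_cong[OF c i coherent_mult[OF ts(1) coherent_const]])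
      then have "ppow ?c (\<lambda>n. (t n - s n) * 2) = \<one>" using True by (rule trans[OF sym])
      then have z: "ppow (ppow ?c (\<lambda>n. t n - s n)) (\<lambda>_. 2) = \<one>"
        using ppow_ppow[OF c ts(1) coherent_const] by simp
      have "\<not> zero_exponent (\<lambda>_. 2)"
        by (rule padic_const_nonzero[OF prime_gt_1_nat[OF prime]]) simp
      then have "ppow ?c (\<lambda>n. t n - s n) = \<one>"
        using ppow_eq_one[OF ppow_closed[OF c ts(1)] coherent_const z] by simp
      then show ?thesis using e1 car(4) by simp
    qed
    then show ?thesis using t(1) by blast
  qed
  then obtain r where r: "coherent p r" "?d' = ppow d r" by blast
  have "g \<otimes> ?b \<otimes> inv g = ppow ?b r"
    by (rule conj_root[OF g b m1 m1_nonzero r(1)]) (use r(2) in \<open>simp add: d_def\<close>)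
  also have "\<dots> = g \<otimes> ppow a r \<otimes> inv g" by (rule ppow_conj[OF g A(1) r(1), symmetric])
  finally have "?b = ppow a r" using g b ppow_closed[OF A(1) r(1)] by simp
  then show ?thesis using r(1) by blast
qed

text \<open>As for a linear map that has every vector as an eigenvector, the scalars on
  \<open>k\<close>, \<open>a\<close> and \<open>k a\<close> are compared.\<close>

lemma conj_eigenspace_common_scalar:
  assumes g: "g \<in> carrier G" and r: "coherent p r" "g \<otimes> k \<otimes> inv g = ppow k r" and a: "a \<in> eigenspace"
  shows "g \<otimes> a \<otimes> inv g = ppow a r"
proof -
  note A = eigenspaceD[OF a]
  obtain r' where r': "coherent p r'" "g \<otimes> a \<otimes> inv g = ppow a r'" using conj_eigenspace_scalar[OF g a] by blast
  obtain t where t: "coherent p t" "g \<otimes> (k \<otimes> a) \<otimes> inv g = ppow (k \<otimes> a) t"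
    using conj_eigenspace_scalar[OF g eigenspace_mult[OF k_eigenspace a]] by blast
  have rt: "coherent p (\<lambda>n. r n - t n)" "coherent p (\<lambda>n. t n - r' n)" using r t r' by simp_all
  have "ppow k r \<otimes> ppow a r' = ppow k t \<otimes> ppow a t"
    using conj_mult[OF g k A(1)] r(2) r'(2) t(2) ppow_mult[OF k A(1) eigenspace_commute[OF k_eigenspace a] t(1)] by simp
  from mult_eq_rearrange[OF ppow_closed[OF k r(1)] ppow_closed[OF k t(1)] ppow_closed[OF A(1) r'(1)] ppow_closed[OF A(1) t(1)] this]
  have w: "ppow k (\<lambda>n. r n - t n) = ppow a (\<lambda>n. t n - r' n)"
    using ppow_inv_mult[OF k r(1) t(1)] ppow_diff[OF A(1) t(1) r'(1)] by simp
  show ?thesis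
  proof (cases "ppow k (\<lambda>n. r n - t n) = \<one>")
    case False
    have nz: "\<not> zero_exponent (\<lambda>n. t n - r' n)" using ppow_zero[OF A(1) rt(2)] w False by auto
    have "g \<otimes> ppow a (\<lambda>n. t n - r' n) \<otimes> inv g = ppow (ppow a (\<lambda>n. t n - r' n)) r"
      unfolding w[symmetric] by (rule conj_ppow_scalar[OF g k r(1) rt(1) r(2)])
    then show ?thesis by (rule conj_root[OF g A(1) rt(2) nz r(1)])
  next
    case True
    show ?thesis
    proof (cases "a = \<one>")
      case False
      have "padic_eq p r t" using ppow_eq_one[OF k rt(1) True] k_nontrivial padic_eq_diff_0 by blast
      moreover have "padic_eq p t r'"
        using ppow_eq_one[OF A(1) rt(2)] w True False padic_eq_diff_0 by metis
      ultimately have "padic_eq p r r'" by (rule padic_eq_trans)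
      then show ?thesis using ppow_cong[OF A(1) r(1) r'(1)] r'(2) by simp
    qed (use g r(1) in simp)
  qed
qed

text \<open>Such a \<open>g\<close> commutes with the whole eigenspace. If \<open>[h,g]\<close> is
  nontrivial, it commutes with \<open>g\<close> and is therefore a nonzero power of
  \<open>g\<close>; since it lies in the eigenspace, so does its root \<open>g\<close>. If
  \<open>[h,g] = 1\<close>, the same argument is applied to \<open>g k\<close>. This identifies the
  kernel of the later \<open>character\<close>.\<close>

lemma centralizer_in_eigenspace:
  assumes g: "g \<in> carrier G" and gk: "g \<otimes> k = k \<otimes> g"
  shows "g \<in> eigenspace"
proof -
  have aux: "x \<in> eigenspace"
    if x: "x \<in> carrier G" and xc: "x \<otimes> \<lbrakk>h,x\<rbrakk> = \<lbrakk>h,x\<rbrakk> \<otimes> x" and nx: "\<lbrakk>h,x\<rbrakk> \<noteq> \<one>" for x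
  proof -
    have c: "\<lbrakk>h,x\<rbrakk> \<in> carrier G" using h x by simp
    have "x \<otimes> \<lbrakk>x,h\<rbrakk> = \<lbrakk>x,h\<rbrakk> \<otimes> x"
      using commute_inv[OF x c xc] inv_commutator[OF h x] by simp
    then obtain i where i: "coherent p i" "\<lbrakk>x,h\<rbrakk> = ppow x i" using commutator_eq_ppow[OF x h] by blast
    have "\<lbrakk>x,h\<rbrakk> \<noteq> \<one>" using nx commutator_eq_one_iff[OF h x] commutator_eq_one_iff[OF x h] by auto
    then have nz: "\<not> zero_exponent i" using ppow_zero[OF x i(1)] i(2) by auto
    have "\<lbrakk>x,h\<rbrakk> = ppow \<lbrakk>h,x\<rbrakk> (\<lambda>_. -1)" using inv_commutator[OF h x] c by (simp add: int_pow_neg)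
    then have "ppow x i \<in> eigenspace"
      using eigenspace_ppow[OF commutator_in_eigenspace[OF x] coherent_const, of "-1"] i(2) by simp
    then show ?thesis by (rule eigenspace_root[OF x i(1) nz])
  qed
  have "g \<otimes> k \<otimes> inv g = k" by (rule iffD2[OF conj_eq_iff_commute[OF g k] gk])
  then have gk1: "g \<otimes> k \<otimes> inv g = ppow k (\<lambda>_. 1)" using k by simp
  have cen: "g \<otimes> a = a \<otimes> g" if a: "a \<in> eigenspace" for a
  proof -
    note A = eigenspaceD(1)[OF a]
    have "g \<otimes> a \<otimes> inv g = a" using conj_eigenspace_common_scalar[OF g coherent_const gk1 a] A by simp
    then show ?thesis by (rule iffD1[OF conj_eq_iff_commute[OF g A]])
  qed
  show ?thesis
  proof (cases "\<lbrakk>h,g\<rbrakk> = \<one>")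
    case False
    then show ?thesis by (rule aux[OF g cen[OF commutator_in_eigenspace[OF g]]])
  next
    case True
    let ?g = "g \<otimes> k"
    have gc: "?g \<in> carrier G" using g k by simp
    have "\<lbrakk>h,?g\<rbrakk> = \<lbrakk>h,g\<rbrakk> \<otimes> (g \<otimes> \<lbrakk>h,k\<rbrakk> \<otimes> inv g)" by (rule commutator_mult_right[OF h k g])
    then have n: "\<lbrakk>h,?g\<rbrakk> \<noteq> \<one>" using True conj_eq_one_iff[OF g commutator_closed[OF h k]] nontrivial g h k by simp
    have cE: "\<lbrakk>h,?g\<rbrakk> \<in> eigenspace" by (rule commutator_in_eigenspace[OF gc])
    note c = eigenspaceD(1)[OF cE]
    have "\<lbrakk>h,?g\<rbrakk> \<otimes> ?g = ?g \<otimes> \<lbrakk>h,?g\<rbrakk>"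
      using commute_mult[OF c g k cen[OF cE, symmetric] eigenspace_commute[OF cE k_eigenspace]] .
    then have gE: "?g \<in> eigenspace" using aux[OF gc _ n] by simp
    have ik: "inv k \<in> eigenspace"
      using eigenspace_ppow[OF k_eigenspace coherent_const, of "-1"] k by (simp add: int_pow_neg)
    have "g = ?g \<otimes> inv k" using g k by (simp add: m_assoc)
    then show ?thesis using eigenspace_mult[OF gE ik] by simp
  qed
qed

text \<open>The scalar of \<open>g\<close> on the eigenspace, read off at the one vector
  \<open>k\<close>. Requiring a reduced representative makes the exponent unique.\<close>

definition character :: "'a \<Rightarrow> nat \<Rightarrow> int" where
  "character g = (THE a. a \<in> carrier (padic_int p) \<and> ppow k a = g \<otimes> k \<otimes> inv g)"

lemma ppow_k_inject:
  assumes "a \<in> carrier (padic_int p)" "b \<in> carrier (padic_int p)" "ppow k a = ppow k b"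
  shows "a = b"
proof -
  have "padic_eq p a b"
    using ppow_inject[OF k padic_carrier_coherent[OF assms(1)] padic_carrier_coherent[OF assms(2)] assms(3)]
      k_nontrivial by simp
  then show ?thesis by (rule padic_carrier_eqI[OF assms(1,2)])
qed

lemma character_eqI:
  assumes "a \<in> carrier (padic_int p)" "ppow k a = g \<otimes> k \<otimes> inv g"
  shows "character g = a"
  unfolding character_def
proof (rule the_equality)
  fix b assume "b \<in> carrier (padic_int p) \<and> ppow k b = g \<otimes> k \<otimes> inv g"
  then show "b = a" using ppow_k_inject[OF _ assms(1), of b] assms(2) by simp
qed (use assms in simp)

lemma character:
  assumes g: "g \<in> carrier G"
  shows "character g \<in> carrier (padic_int p)" "coherent p (character g)" "g \<otimes> k \<otimes> inv g = ppow k (character g)"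
proof -
  obtain r where r: "coherent p r" "g \<otimes> k \<otimes> inv g = ppow k r"
    using conj_eigenspace_scalar[OF g k_eigenspace] by blast
  have "ppow k (padic_normal_form p r) = g \<otimes> k \<otimes> inv g" using ppow_normal_form[OF k r(1)] r(2) by simp
  then have e: "character g = padic_normal_form p r"
    by (rule character_eqI[OF padic_normal_form(1)[OF p_pos r(1)]])
  show 1: "character g \<in> carrier (padic_int p)" unfolding e by (rule padic_normal_form(1)[OF p_pos r(1)])
  show "coherent p (character g)" by (rule padic_carrier_coherent[OF 1])
  show "g \<otimes> k \<otimes> inv g = ppow k (character g)" unfolding e using ppow_normal_form[OF k r(1)] r(2) by simp
qed

lemma character_mult:
  assumes g: "g \<in> carrier G" and g': "g' \<in> carrier G"
  shows "character (g \<otimes> g') = padic_normal_form p (\<lambda>n. character g n * character g' n)"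
proof (rule character_eqI)
  note C = character[OF g] and C' = character[OF g']
  have cm: "coherent p (\<lambda>n. character g n * character g' n)" using C(2) C'(2) by simp
  show "padic_normal_form p (\<lambda>n. character g n * character g' n) \<in> carrier (padic_int p)"
    by (rule padic_normal_form(1)[OF p_pos cm])
  have "ppow k (padic_normal_form p (\<lambda>n. character g n * character g' n)) = ppow (ppow k (character g)) (character g')"
    using ppow_normal_form[OF k cm] ppow_ppow[OF k C(2) C'(2)] by simp
  also have "\<dots> = g \<otimes> ppow k (character g') \<otimes> inv g"
    using ppow_conj[OF g k C'(2)] C(3) by simp
  also have "\<dots> = g \<otimes> g' \<otimes> k \<otimes> inv (g \<otimes> g')"
    using conj_conj[OF g g' k] C'(3) by simp
  finally show "ppow k (padic_normal_form p (\<lambda>n. character g n * character g' n)) = g \<otimes> g' \<otimes> k \<otimes> inv (g \<otimes> g')" .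
qed

lemma character_one: "character \<one> = padic_normal_form p (\<lambda>_. 1)"
  by (rule character_eqI[OF padic_normal_form(1)[OF p_pos coherent_const]])
    (use ppow_normal_form[OF k coherent_const] k in simp)

lemma character_hom: "character \<in> hom G (padic_units p)"
proof (rule homI)
  fix g assume g: "g \<in> carrier G"
  have "character g \<otimes>\<^bsub>padic_int p\<^esub> character (inv g) = \<one>\<^bsub>padic_int p\<^esub>"
    using character_mult[OF g inv_closed[OF g]] character_one g by (simp add: padic_mult_eq padic_one_eq)
  then show "character g \<in> carrier (padic_units p)"
    unfolding padic_units_iff using character(1)[OF g] character(1)[OF inv_closed[OF g]] by blast
qed (simp add: character_mult padic_units_mult)

text \<open>The map \<open>a \<mapsto> k^a\<close> is a continuous injection of a compact space into
  a Hausdorff one, so it has a continuous inverse on its image. The character is that inverse after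
  \<open>g \<mapsto> g k g^(-1)\<close>.\<close>

lemma character_continuous: "continuous_map T (padic_units_topology p) character"
proof -
  let ?R = "{ppow k a | a. coherent p a}" and ?f = "\<lambda>a. ppow k a"
  have im: "?f ` carrier (padic_int p) = ?R" using ppow_range_eq_image[OF k] by simp
  have R: "?R \<subseteq> carrier G" using im padic_carrier_coherent ppow_closed[OF k] by auto
  have cf: "continuous_map (padic_topology p) (subtopology T ?R) ?f"
  proof -
    have "?f \<in> topspace (padic_topology p) \<rightarrow> ?R" using im by auto
    then show ?thesis using continuous_map_ppow[OF k] by (simp only: continuous_map_in_subtopology)
  qed
  have "homeomorphic_map (padic_topology p) (subtopology T ?R) ?f"
  proof (rule continuous_imp_homeomorphic_map[OF cf compact_space_padic])
    show "Hausdorff_space (subtopology T ?R)" using Hausdorff by (rule Hausdorff_space_subtopology)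
    show "?f ` topspace (padic_topology p) = topspace (subtopology T ?R)"
      using im R by (simp add: topspace_eq Int_absorb1)
    show "inj_on ?f (topspace (padic_topology p))"
      using ppow_k_inject by (simp add: inj_on_def)
  qed
  then obtain f' where f': "homeomorphic_maps (padic_topology p) (subtopology T ?R) ?f f'"
    unfolding homeomorphic_map_maps by blast
  have cj: "continuous_map T T (\<lambda>g. g \<otimes> k \<otimes> inv g)"
    using k by (intro continuous_map_mult continuous_map_inv continuous_map_const_carrier continuous_map_identity)
  have "(\<lambda>g. g \<otimes> k \<otimes> inv g) ` topspace T \<subseteq> ?R" using character topspace_eq by auto
  then have cj': "continuous_map T (subtopology T ?R) (\<lambda>g. g \<otimes> k \<otimes> inv g)"
    using cj by (auto simp: continuous_map_in_subtopology)
  have "continuous_map (subtopology T ?R) (padic_topology p) f'"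
    using f' by (simp add: homeomorphic_maps_def)
  from continuous_map_compose[OF cj' this]
  have cc: "continuous_map T (padic_topology p) (\<lambda>g. f' (g \<otimes> k \<otimes> inv g))" by (simp add: o_def)
  have eq: "f' (g \<otimes> k \<otimes> inv g) = character g" if g: "g \<in> topspace T" for g
  proof -
    have gc: "g \<in> carrier G" using g topspace_eq by simp
    have "f' (?f (character g)) = character g"
      using f' character(1)[OF gc] by (simp add: homeomorphic_maps_def)
    then show ?thesis using character(3)[OF gc] by simp
  qed
  have "continuous_map T (padic_topology p) character"
    using continuous_map_eq[OF cc eq] .
  moreover have "character ` topspace T \<subseteq> carrier (padic_units p)"
    using character_hom topspace_eq by (auto simp: hom_def)
  ultimately show ?thesis
    unfolding padic_units_topology_def by (auto simp: continuous_map_in_subtopology)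
qed

lemma character_theta_abelian: "theta_abelian p G T character"
proof -
  have "x \<in> theta_center p G T character" if x: "x \<in> kernel G (padic_units p) character" for x
  proof -
    have xc: "x \<in> carrier G" and x1: "character x = padic_normal_form p (\<lambda>_. 1)"
      using x by (auto simp: kernel_def padic_units_one)
    have "x \<otimes> k \<otimes> inv x = k"
      using character(3)[OF xc] ppow_normal_form[OF k coherent_const] k unfolding x1 by simp
    then have "x \<otimes> k = k \<otimes> x" by (rule iffD1[OF conj_eq_iff_commute[OF xc k]])
    then have xE: "x \<in> eigenspace" by (rule centralizer_in_eigenspace[OF xc])
    have "g \<otimes> x \<otimes> inv g = ppow x (character g)" if g: "g \<in> carrier G" for g
      by (rule conj_eigenspace_common_scalar[OF g character(2,3)[OF g] xE])
    then show ?thesis using x by (simp add: theta_center_def)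
  qed
  moreover have "theta_center p G T character \<subseteq> kernel G (padic_units p) character"
    unfolding theta_center_def by (rule Collect_restrict)
  ultimately show ?thesis unfolding theta_abelian_def by blast
qed

end

context torsion_free_locally_powerful
begin

proposition ex_theta_abelian: "\<exists>\<theta>. orientation p G T \<theta> \<and> theta_abelian p G T \<theta>"
proof (cases "\<forall>x\<in>carrier G. \<forall>y\<in>carrier G. x \<otimes> y = y \<otimes> x")
  case False
  then obtain x y where "x \<in> carrier G" "y \<in> carrier G" "x \<otimes> y \<noteq> y \<otimes> x" by auto
  from ex_eigenvector[OF this] obtain h k m where hkm: "h \<in> carrier G" "k \<in> carrier G" "coherent p m"
    "h \<otimes> k \<otimes> inv h = ppow k m" "\<lbrakk>h,k\<rbrakk> \<noteq> \<one>" by (elim exE conjE) (rule that)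
  interpret eigenvector p G T h k m by unfold_locales (fact hkm)+
  show ?thesis using character_hom character_continuous character_theta_abelian
    unfolding orientation_def by blast
next
  case True
  \<comment> \<open>In the abelian case the trivial orientation works: its kernel is everything and
    conjugation is the power with exponent 1.\<close>
  let ?one = "padic_normal_form p (\<lambda>_. 1)" and ?\<theta> = "\<lambda>x::'a. padic_normal_form p (\<lambda>_. 1)"
  have one: "?one \<in> carrier (padic_int p)" by (rule padic_normal_form(1)[OF p_pos coherent_const])
  have mult: "padic_normal_form p (\<lambda>n. ?one n * ?one n) = ?one"
    by (simp add: padic_normal_form_def fun_eq_iff mod_mult_eq)
  then have unit: "?one \<in> carrier (padic_units p)"
    unfolding padic_units_iff padic_mult_eq padic_one_eq using one by blast
  have "orientation p G T ?\<theta>"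
    unfolding orientation_def
  proof
    show "?\<theta> \<in> hom G (padic_units p)" using unit mult by (intro homI) (simp_all add: padic_units_mult)
    show "continuous_map T (padic_units_topology p) ?\<theta>"
      using unit one by (simp add: padic_units_topology_def)
  qed
  moreover have "theta_abelian p G T ?\<theta>"
  proof -
    have "g \<otimes> x \<otimes> inv g = ppow x ?one" if "g \<in> carrier G" "x \<in> carrier G" for g x
    proof -
      have "g \<otimes> x \<otimes> inv g = x" using True that conj_eq_iff_commute[OF that] by simp
      then show ?thesis using ppow_normal_form[OF that(2) coherent_const, of 1] that(2) by simp
    qed
    then show ?thesis
      by (auto simp: theta_abelian_def theta_center_def kernel_def)
  qed
  ultimately show ?thesis by (intro exI[of _ ?\<theta>] conjI)
qed

end

section \<open>Local powerfulness of \<open>\<theta>\<close>-abelian groups\<close>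

locale theta_abelian_pro_p = pro_p_group_prime +
  fixes \<theta> :: "'a \<Rightarrow> nat \<Rightarrow> int"
  assumes orientation: "orientation p G T \<theta>"
    and theta_abelian: "theta_abelian p G T \<theta>"
begin

lemma theta_units: "g \<in> carrier G \<Longrightarrow> \<theta> g \<in> carrier (padic_units p)"
  using orientation by (auto simp: orientation_def hom_def)

lemma theta_coherent: "g \<in> carrier G \<Longrightarrow> coherent p (\<theta> g)"
  using theta_units padic_units_iff padic_carrier_coherent by blast

lemma theta_mult:
  assumes "g \<in> carrier G" "h \<in> carrier G"
  shows "[\<theta> (g \<otimes> h) n = \<theta> g n * \<theta> h n] (mod int p ^ n)"
proof -
  have "\<theta> (g \<otimes> h) = padic_normal_form p (\<lambda>n. \<theta> g n * \<theta> h n)"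
    using orientation assms unfolding orientation_def by (auto simp: hom_mult padic_units_mult)
  then show ?thesis by (simp add: padic_normal_form_def)
qed

text \<open>An idempotent unit is 1; multiplicativity gives the idempotence.\<close>

lemma theta_one: "[\<theta> \<one> n = 1] (mod int p ^ n)"
proof -
  obtain b where b: "\<theta> \<one> \<otimes>\<^bsub>padic_int p\<^esub> b = \<one>\<^bsub>padic_int p\<^esub>" using theta_units padic_units_iff by blast
  have "(\<theta> \<one> \<otimes>\<^bsub>padic_int p\<^esub> b) n = \<one>\<^bsub>padic_int p\<^esub> n" unfolding b ..
  then have b1: "[\<theta> \<one> n * b n = 1] (mod int p ^ n)" by (simp add: padic_int_def cong_def)
  have "[\<theta> \<one> n * 1 = \<theta> \<one> n * (\<theta> \<one> n * b n)] (mod int p ^ n)" using b1 by (intro cong_mult cong_refl) (rule cong_sym)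
  also have "\<theta> \<one> n * (\<theta> \<one> n * b n) = \<theta> \<one> n * \<theta> \<one> n * b n" by simp
  also have "[\<dots> = \<theta> \<one> n * b n] (mod int p ^ n)"
    using theta_mult[of \<one> \<one> n] by (intro cong_mult cong_refl) (simp add: cong_sym)
  also note b1
  finally show ?thesis by simp
qed

lemma theta_inv:
  assumes "g \<in> carrier G"
  shows "[\<theta> g n * \<theta> (inv g) n = 1] (mod int p ^ n)"
  using cong_trans[OF cong_sym[OF theta_mult[of g "inv g" n]] ] theta_one assms by simp

lemma theta_nat_pow:
  assumes "g \<in> carrier G"
  shows "[\<theta> (g [^] (i::nat)) n = \<theta> g n ^ i] (mod int p ^ n)"
proof (induction i)
  case (Suc i)
  have "[\<theta> (g [^] i \<otimes> g) n = \<theta> (g [^] i) n * \<theta> g n] (mod int p ^ n)" using assms by (intro theta_mult) auto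
  also have "[\<theta> (g [^] i) n * \<theta> g n = \<theta> g n ^ i * \<theta> g n] (mod int p ^ n)" using Suc by (intro cong_mult cong_refl)
  finally show ?case by (simp add: mult.commute)
qed (use theta_one in simp)

abbreviation K :: "'a set" where "K \<equiv> kernel G (padic_units p) \<theta>"

lemma kernel_iff: "x \<in> K \<longleftrightarrow> x \<in> carrier G \<and> (\<forall>n. [\<theta> x n = 1] (mod int p ^ n))"
proof -
  have "\<theta> x = \<one>\<^bsub>padic_units p\<^esub> \<longleftrightarrow> (\<forall>n. [\<theta> x n = 1] (mod int p ^ n))" if x: "x \<in> carrier G"
  proof
    assume "\<forall>n. [\<theta> x n = 1] (mod int p ^ n)"
    then have eq: "padic_eq p (\<theta> x) (\<lambda>_. 1)" by (simp add: padic_eq_def)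
    note one = padic_normal_form[OF p_pos coherent_const, of 1]
    have "padic_eq p (\<theta> x) (padic_normal_form p (\<lambda>_. 1))" using padic_eq_trans[OF eq padic_eq_sym[OF one(2)]] .
    then show "\<theta> x = \<one>\<^bsub>padic_units p\<^esub>"
      using padic_carrier_eqI[OF _ one(1)] theta_units[OF x] by (simp add: padic_units_iff padic_units_one)
  next
    assume "\<theta> x = \<one>\<^bsub>padic_units p\<^esub>"
    then show "\<forall>n. [\<theta> x n = 1] (mod int p ^ n)" by (simp add: padic_units_one padic_normal_form_def)
  qed
  then show ?thesis unfolding kernel_def by blast
qed

lemma commutator_in_kernel:
  assumes x: "x \<in> carrier G" and y: "y \<in> carrier G"
  shows "\<lbrakk>x,y\<rbrakk> \<in> K"
  unfolding kernel_iff
proof (intro conjI allI)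
  fix n
  let ?c = "\<lbrakk>x,y\<rbrakk>" and ?N = "int p ^ n"
  let ?t = "\<theta> ?c n" and ?u = "\<theta> (y \<otimes> x) n" and ?v = "\<theta> (inv (y \<otimes> x)) n"
  have c: "?c \<in> carrier G" and yx: "y \<otimes> x \<in> carrier G" using x y by auto
  have uv: "[?u * ?v = 1] (mod ?N)" by (rule theta_inv[OF yx])
  have "?c \<otimes> (y \<otimes> x) = x \<otimes> y" using mult_eq_commutator_mult[OF x y] c x y by (simp add: m_assoc)
  then have "[?t * ?u = \<theta> (x \<otimes> y) n] (mod ?N)" using theta_mult[OF c yx] by (simp add: cong_sym)
  also have "[\<theta> (x \<otimes> y) n = \<theta> x n * \<theta> y n] (mod ?N)" by (rule theta_mult[OF x y])
  also have "\<theta> x n * \<theta> y n = \<theta> y n * \<theta> x n" by simp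
  also have "[\<dots> = ?u] (mod ?N)" by (rule cong_sym[OF theta_mult[OF y x]])
  finally have "[?t * ?u * ?v = ?u * ?v] (mod ?N)" by (intro cong_mult cong_refl)
  then have e: "[?t * (?u * ?v) = ?u * ?v] (mod ?N)" by (simp only: mult.assoc)
  have "[?t * 1 = ?t * (?u * ?v)] (mod ?N)" using uv by (intro cong_mult cong_refl) (rule cong_sym)
  also note e
  also note uv
  finally show "[?t = 1] (mod ?N)" by simp
qed (use assms in simp)

lemma commutator_kernel:
  assumes w: "w \<in> K" and g: "g \<in> carrier G"
  shows "\<lbrakk>g,w\<rbrakk> = ppow w (\<lambda>n. \<theta> g n - 1)"
proof -
  have wc: "w \<in> carrier G" using w by (simp add: kernel_def)
  have "g \<otimes> w \<otimes> inv g = ppow w (\<theta> g)"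
    using theta_abelian w g unfolding theta_abelian_def theta_center_def by blast
  then show ?thesis
    using ppow_diff[OF wc theta_coherent[OF g] coherent_const, of 1] wc by (simp add: group_commutator_def)
qed

lemma closedin_theta_one: "closedin T {g \<in> carrier G. [\<theta> g n = 1] (mod int p ^ n)}"
proof -
  let ?X = "product_topology (\<lambda>_. discrete_topology (UNIV :: int set)) (UNIV :: nat set)"
  have "continuous_map T ?X \<theta>"
    using orientation unfolding orientation_def padic_units_topology_def padic_topology_def
    by (simp add: continuous_map_in_subtopology)
  moreover have "continuous_map ?X (discrete_topology UNIV) (\<lambda>a. a n)"
    by (rule continuous_map_product_projection) simp
  ultimately have "continuous_map T (discrete_topology UNIV) ((\<lambda>a. a n) \<circ> \<theta>)" by (rule continuous_map_compose)
  then have "closedin T {g \<in> topspace T. ((\<lambda>a. a n) \<circ> \<theta>) g \<in> {i. [i = 1] (mod int p ^ n)}}"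
    by (rule closedin_continuous_map_preimage) simp
  then show ?thesis by (simp add: topspace_eq)
qed

text \<open>For a unit \<open>b\<close>, the element \<open>w\<close> is a p-adic power of
  \<open>w^b\<close>, so it sinks through the whole series together with it.\<close>

lemma kernel_unit_torsion:
  assumes un: "uniform p G T" and w: "w \<in> K" and b: "coherent p b" "\<not> int p dvd b 1"
    and step: "\<And>i. w \<in> series i \<Longrightarrow> ppow w b \<in> series (Suc i)"
  shows "w = \<one>"
proof -
  have wc: "w \<in> carrier G" using w by (simp add: kernel_def)
  obtain c where c: "coherent p c" "padic_eq p (\<lambda>n. b n * c n) (\<lambda>_. 1)"
    using coherent_inverse[OF prime b] by blast
  have bc: "coherent p (\<lambda>n. b n * c n)" using b(1) c(1) by (rule coherent_mult)
  have "w \<in> series i" for i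
  proof (induction i)
    case (Suc i)
    have "ppow (ppow w b) c \<in> series (Suc i)"
      by (rule ppow_mem[OF normal_imp_subgroup[OF series_normal] series_closed step[OF Suc] c(1)])
    also have "ppow (ppow w b) c = ppow w (\<lambda>_. 1)"
      unfolding ppow_ppow[OF wc b(1) c(1)] by (rule ppow_cong[OF wc bc coherent_const c(2)])
    finally show ?case using wc by simp
  qed (use wc in simp)
  then show ?thesis by (rule eq_one_if_in_series[OF wc])
qed

text \<open>If \<open>\<theta>(g) - 1\<close> were not divisible by the exponent in the definition of powerful, then
  commutation with \<open>g\<close> would move an element of the kernel too slowly down the lower \<open>p\<close>-series.\<close>

lemma theta_one_unit:
  assumes un: "uniform p G T" and w: "w \<in> K" "w \<noteq> \<one>" and g: "g \<in> carrier G"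
  shows "[\<theta> g 2 = 1] (mod int powerful_exponent)"
proof -
  have wc: "w \<in> carrier G" using w by (simp add: kernel_def)
  let ?d = "\<lambda>n. \<theta> g n - 1"
  have d: "coherent p ?d" using theta_coherent[OF g] by simp
  have d1: "int p dvd ?d 1"
  proof (rule ccontr)
    assume "\<not> int p dvd ?d 1"
    moreover have "ppow w ?d \<in> series (Suc i)" if "w \<in> series i" for i
      using series_commutator(2)[OF that g] commutator_kernel[OF w(1) g] by simp
    ultimately show False using kernel_unit_torsion[OF un w(1) d] w(2) by blast
  qed
  have c21: "[\<theta> g 2 = \<theta> g 1] (mod int p)" using coherent_le[OF theta_coherent[OF g], of 1 2] by simp
  show ?thesis
  proof (cases "p = 2")
    case False
    then show ?thesis using cong_trans[OF c21] d1 by (simp add: powerful_exponent_def cong_iff_dvd_diff)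
  next
    case True
    obtain u where u: "coherent p u" "padic_eq p ?d (\<lambda>n. int p ^ 1 * u n)"
      using coherent_divide[OF p_pos d, of 1] d1 by auto
    have "int p dvd u 1"
    proof (rule ccontr)
      assume "\<not> int p dvd u 1"
      \<comment> \<open>Here \<open>\<theta>(g) - 1\<close> is \<open>2 u\<close>, so
        \<open>[g,w]\<close> is the square of \<open>w^u\<close> and lies two steps down.
        Injectivity of squaring on the factors puts \<open>w^u\<close> one step down, which is
        impossible for a unit \<open>u\<close>.\<close>
      moreover have "ppow w u \<in> series (Suc i)" if wi: "w \<in> series i" for i
      proof (rule uniform_pow_injective[OF un])
        show "ppow w u \<in> series i"
          by (rule ppow_mem[OF normal_imp_subgroup[OF series_normal] series_closed wi u(1)])
        have pu: "coherent p (\<lambda>n. int p ^ 1 * u n)" using u(1) by simp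
        have "\<lbrakk>w,g\<rbrakk> \<in> series (i + 2)"
          using series_commutator_two[OF _ True wi g] un by (simp add: uniform_def)
        then have "\<lbrakk>g,w\<rbrakk> \<in> series (i + 2)"
          by (rule normal.commutator_swap_in[OF series_normal wc g])
        also have "\<lbrakk>g,w\<rbrakk> = ppow w (\<lambda>n. u n * int p)"
          unfolding commutator_kernel[OF w(1) g] using ppow_cong[OF wc d pu u(2)] by (simp add: mult.commute)
        also have "\<dots> = ppow (ppow w u) (\<lambda>_. int p)" by (rule ppow_ppow[OF wc u(1) coherent_const, symmetric])
        also have "\<dots> = ppow w u [^] p" using wc u(1) by (simp add: int_pow_int)
        finally show "ppow w u [^] p \<in> series (i + 2)" .
      qed
      ultimately show False using kernel_unit_torsion[OF un w(1) u(1)] w(2) by blast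
    qed
    moreover have "[u 2 = u 1] (mod int p)" using coherent_le[OF u(1), of 1 2] by simp
    ultimately have "int p dvd u 2" by (simp add: cong_dvd_iff)
    then have "4 dvd 2 * u 2" using True by auto
    moreover have "[?d 2 = 2 * u 2] (mod 4)" using u(2) True by (auto simp: padic_eq_def dest: spec[of _ 2])
    ultimately have "4 dvd ?d 2" by (simp add: cong_dvd_iff)
    moreover have "powerful_exponent = 4" unfolding powerful_exponent_def by (rule if_P[OF True])
    ultimately show ?thesis by (simp add: cong_iff_dvd_diff)
  qed
qed

text \<open>The exponent \<open>\<theta>(g) - 1\<close> of \<open>w\<close> is divisible by
  \<open>q = p^e\<close>; since \<open>e\<close> is at most 2, the entry of index 2 is enough to see
  it.\<close>

lemma commutator_kernel_pow:
  assumes w: "w \<in> K" and g: "g \<in> carrier G" and g1: "[\<theta> g 2 = 1] (mod int powerful_exponent)"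
  shows "\<exists>m. coherent p m \<and> \<lbrakk>g,w\<rbrakk> = ppow w m [^] powerful_exponent"
proof -
  have wc: "w \<in> carrier G" using w by (simp add: kernel_def)
  let ?d = "\<lambda>n. \<theta> g n - 1"
  define e where "e = (if p = 2 then 2 else 1 :: nat)"
  have q: "powerful_exponent = p ^ e" by (simp add: powerful_exponent_def e_def)
  have d: "coherent p ?d" using theta_coherent[OF g] by simp
  have "[?d 2 = ?d e] (mod int p ^ e)" by (rule coherent_le[OF d]) (simp add: e_def)
  then have "int p ^ e dvd ?d e" using g1 by (simp add: q cong_iff_dvd_diff[of _ 1] cong_dvd_iff)
  then obtain m where m: "coherent p m" "padic_eq p ?d (\<lambda>n. int p ^ e * m n)"
    using coherent_divide[OF p_pos d] by blast
  have pm: "coherent p (\<lambda>n. int p ^ e * m n)" using m(1) by simp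
  have "\<lbrakk>g,w\<rbrakk> = ppow w (\<lambda>n. m n * int (p ^ e))"
    unfolding commutator_kernel[OF w g] using ppow_cong[OF wc d pm m(2)] by (simp add: mult.commute)
  also have "\<dots> = ppow (ppow w m) (\<lambda>_. int (p ^ e))" by (rule ppow_ppow[OF wc m(1) coherent_const, symmetric])
  also have "\<dots> = ppow w m [^] (p ^ e)" unfolding ppow_const[OF ppow_closed[OF wc m(1)]] by (rule int_pow_int)
  finally show ?thesis using m(1) q by auto
qed

text \<open>The hypothesis gives an exponent for each level separately. The sets of all
  \<open>z y\<close> with \<open>z\<close> in the closure of the powers of \<open>x\<close> and
  \<theta>-value 1 modulo \<open>p^n\<close> are closed, nonempty and decreasing, so compactness
  provides one \<open>w\<close> for all levels.\<close>

lemma ppow_mult_kernel: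
  assumes x: "x \<in> carrier G" and y: "y \<in> carrier G"
    and cmp: "\<And>n. \<exists>i::nat. [\<theta> y n = \<theta> x n ^ i] (mod int p ^ n)"
  shows "\<exists>a w. coherent p a \<and> w \<in> K \<and> y = ppow x a \<otimes> w"
proof -
  let ?X = "closed_generate G T {x}"
  note X = closed_generate_subgroup[of "{x}"]
  have Xs: "subgroup ?X G" "closedin T ?X" "x \<in> ?X" using X x by auto
  define F where "F n = (?X #> y) \<inter> {g \<in> carrier G. [\<theta> g n = 1] (mod int p ^ n)}" for n
  have "closedin T (F n)" for n
    unfolding F_def by (intro closedin_Int closedin_r_coset closedin_theta_one Xs(2) subgroup.subset[OF Xs(1)] y)
  moreover have "F n \<noteq> {}" for n
  proof -
    obtain i :: nat where i: "[\<theta> y n = \<theta> x n ^ i] (mod int p ^ n)" using cmp by blast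
    let ?z = "x [^] i"
    have z: "?z \<in> carrier G" using x by simp
    have "[\<theta> (inv ?z \<otimes> y) n = \<theta> (inv ?z) n * \<theta> y n] (mod int p ^ n)" using z y by (intro theta_mult) auto
    also have "[\<theta> (inv ?z) n * \<theta> y n = \<theta> (inv ?z) n * \<theta> ?z n] (mod int p ^ n)"
      by (rule cong_mult[OF cong_refl cong_trans[OF i cong_sym[OF theta_nat_pow[OF x]]]])
    also have "\<theta> (inv ?z) n * \<theta> ?z n = \<theta> ?z n * \<theta> (inv ?z) n" by simp
    also have "[\<dots> = 1] (mod int p ^ n)" by (rule theta_inv[OF z])
    finally have "[\<theta> (inv ?z \<otimes> y) n = 1] (mod int p ^ n)" .
    moreover have "inv ?z \<otimes> y \<in> ?X #> y"
      using subgroup.m_inv_closed[OF Xs(1) subgroup_nat_pow_closed[OF Xs(1,3)]] by (auto simp: r_coset_def)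
    ultimately have "inv ?z \<otimes> y \<in> F n" using z y by (simp add: F_def)
    then show ?thesis by blast
  qed
  moreover have "decseq F"
  proof (rule decseq_SucI)
    fix n
    have "[\<theta> g n = 1] (mod int p ^ n)" if g: "g \<in> carrier G" and c: "[\<theta> g (Suc n) = 1] (mod int p ^ Suc n)" for g
    proof -
      have "[\<theta> g n = \<theta> g (Suc n)] (mod int p ^ n)" using theta_coherent[OF g] by (simp add: coherent_def cong_sym)
      also have "[\<theta> g (Suc n) = 1] (mod int p ^ n)" by (rule cong_dvd_modulus[OF c le_imp_power_dvd]) simp
      finally show ?thesis .
    qed
    then show "F (Suc n) \<subseteq> F n" unfolding F_def by blast
  qed
  ultimately have "(\<Inter>n. F n) \<noteq> {}" by (rule compact_space_imp_nest[OF compact])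
  then obtain w where w: "w \<in> F n" for n by blast
  then have wK: "w \<in> K" by (auto simp: kernel_iff F_def)
  obtain u where u: "u \<in> ?X" "w = u \<otimes> y" using w[of 0] by (auto simp: F_def r_coset_def)
  have uc: "u \<in> carrier G" using u(1) subgroup.subset[OF Xs(1)] by blast
  obtain a where a: "coherent p a" "u = ppow x a" using u(1) closed_generate_singleton[OF x] by auto
  have "ppow x (\<lambda>n. - a n) \<otimes> w = y" using ppow_uminus[OF x a(1)] u(2) uc y by (simp add: a(2)[symmetric] m_assoc[symmetric])
  then show ?thesis using wK coherent_uminus[OF a(1)] by blast
qed

lemma commutator_is_power:
  assumes H: "subgroup H G" "closedin T H" and x: "x \<in> H" and y: "y \<in> H"
    and x1: "[\<theta> x 2 = 1] (mod int powerful_exponent)"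
    and cmp: "\<And>n. \<exists>i::nat. [\<theta> y n = \<theta> x n ^ i] (mod int p ^ n)"
  shows "\<exists>z\<in>H. \<lbrakk>x,y\<rbrakk> = z [^] powerful_exponent"
proof -
  have xc: "x \<in> carrier G" and yc: "y \<in> carrier G" using x y subgroup.subset[OF H(1)] by blast+
  obtain a w where a: "coherent p a" and w: "w \<in> K" and yw: "y = ppow x a \<otimes> w"
    using ppow_mult_kernel[OF xc yc cmp] by blast
  let ?u = "ppow x a"
  have u: "?u \<in> H" by (rule ppow_mem[OF H x a])
  have uc: "?u \<in> carrier G" using xc a by simp
  have wc: "w \<in> carrier G" using w by (simp add: kernel_def)
  \<comment> \<open>The kernel part \<open>w\<close> stays in \<open>H\<close> because closed
    subgroups contain p-adic powers; so the \<open>q\<close>-th root of the commutator is found in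
    \<open>H\<close> and not just in \<open>G\<close>.\<close>
  have "w = inv ?u \<otimes> y" unfolding yw using uc wc by (simp add: m_assoc[symmetric])
  then have wH: "w \<in> H" using subgroup.m_closed[OF H(1) subgroup.m_inv_closed[OF H(1) u] y] by simp
  obtain m where m: "coherent p m" "\<lbrakk>x,w\<rbrakk> = ppow w m [^] powerful_exponent"
    using commutator_kernel_pow[OF w xc x1] by blast
  have mH: "ppow w m \<in> H" by (rule ppow_mem[OF H wH m(1)])
  have mc: "ppow w m \<in> carrier G" using wc m(1) by simp
  have "\<lbrakk>x,?u\<rbrakk> = \<one>" using commutator_eq_one_iff[OF xc uc] commute_ppow[OF xc xc a refl] by simp
  then have "\<lbrakk>x,y\<rbrakk> = ?u \<otimes> \<lbrakk>x,w\<rbrakk> \<otimes> inv ?u"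
    unfolding yw using commutator_mult_right[OF xc wc uc] uc wc xc by simp
  also have "\<dots> = (?u \<otimes> ppow w m \<otimes> inv ?u) [^] powerful_exponent"
    unfolding m(2) by (rule conj_nat_pow[OF uc mc])
  finally show ?thesis
    using subgroup.m_closed[OF H(1) subgroup.m_closed[OF H(1) u mH] subgroup.m_inv_closed[OF H(1) u]] by blast
qed

proposition uniform_locally_powerful:
  assumes un: "uniform p G T"
  shows "locally_powerful p G T"
  unfolding locally_powerful_def
proof (intro allI impI, elim conjE)
  fix H assume H: "subgroup H G" "closedin T H"
  let ?P = "{h [^] powerful_exponent | h. h \<in> H}"
  have Pc: "?P \<subseteq> carrier G" using subgroup.subset[OF H(1)] by auto
  have P: "z [^] powerful_exponent \<in> closed_generate G T ?P" if "z \<in> H" for z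
    using closed_generate_subgroup(3)[OF Pc] that by blast
  have "\<lbrakk>x,y\<rbrakk> \<in> closed_generate G T ?P" if x: "x \<in> H" and y: "y \<in> H" for x y
  proof (cases "\<lbrakk>x,y\<rbrakk> = \<one>")
    case True
    then show ?thesis using subgroup.one_closed[OF closed_generate_subgroup(1)[OF Pc]] by simp
  next
    case False
    have xc: "x \<in> carrier G" and yc: "y \<in> carrier G" using x y subgroup.subset[OF H(1)] by blast+
    \<comment> \<open>The nontrivial commutator \<open>[x,y]\<close> is itself the kernel element
      that forces \<theta> to be 1 modulo \<open>q\<close> everywhere.\<close>
    have one: "[\<theta> g 2 = 1] (mod int powerful_exponent)" if "g \<in> carrier G" for g
      using theta_one_unit[OF un commutator_in_kernel[OF xc yc] False that] .
    from one_units_comparable[OF prime theta_coherent[OF xc] theta_coherent[OF yc]] one[OF xc] one[OF yc]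
    consider "\<And>n. \<exists>i::nat. [\<theta> y n = \<theta> x n ^ i] (mod int p ^ n)" | "\<And>n. \<exists>i::nat. [\<theta> x n = \<theta> y n ^ i] (mod int p ^ n)"
      unfolding powerful_exponent_def by blast
    then show ?thesis
    proof cases
      case 1
      then obtain z where "z \<in> H" "\<lbrakk>x,y\<rbrakk> = z [^] powerful_exponent"
        using commutator_is_power[OF H x y one[OF xc]] by blast
      then show ?thesis using P by simp
    next
      case 2
      then obtain z where z: "z \<in> H" "\<lbrakk>y,x\<rbrakk> = z [^] powerful_exponent"
        using commutator_is_power[OF H y x one[OF yc]] by blast
      have "\<lbrakk>x,y\<rbrakk> = inv \<lbrakk>y,x\<rbrakk>" using inv_commutator[OF yc xc] by simp
      then show ?thesis
        using subgroup.m_inv_closed[OF closed_generate_subgroup(1)[OF Pc] P[OF z(1)]] z(2) by simp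
    qed
  qed
  then show "powerful p (G\<lparr>carrier := H\<rparr>) (subtopology T H)"
    unfolding powerful_restrict_iff[OF H] powerful_exponent_def by blast
qed

end

theorem theoremA:
  fixes p :: nat and G :: "('a, 'b) monoid_scheme" and T :: "'a topology"
  assumes "prime p"
    and "pro_p_group p G T"
    and "topologically_fg G T"
    and "uniform p G T"
  shows "locally_powerful p G T \<longleftrightarrow> (\<exists>\<theta>. orientation p G T \<theta> \<and> theta_abelian p G T \<theta>)"
proof -
  interpret pro_p_group_prime p G T
    using assms(1,2) by (simp add: pro_p_group_prime_def pro_p_group_prime_axioms_def)
  show ?thesis
  proof
    assume lp: "locally_powerful p G T"
    interpret torsion_free_locally_powerful p G T
      by unfold_locales (use lp uniform_torsion_free[OF assms(4)] in auto)
    show "\<exists>\<theta>. orientation p G T \<theta> \<and> theta_abelian p G T \<theta>" by (rule ex_theta_abelian)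
  next
    assume "\<exists>\<theta>. orientation p G T \<theta> \<and> theta_abelian p G T \<theta>"
    then obtain \<theta> where \<theta>: "orientation p G T \<theta>" "theta_abelian p G T \<theta>" by blast
    interpret theta_abelian_pro_p p G T \<theta> by unfold_locales (fact \<theta>)+
    show "locally_powerful p G T" by (rule uniform_locally_powerful[OF assms(4)])
  qed
qed

end
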